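(* Let $b:\mathbb{R}\to\mathbb{R}$ be locally Lipschitz and let $\sigma:\mathbb{R}\to\mathbb{R}$ be $C^1$ with locally Lipschitz derivative. Assume that $b(x)>0$ and $\sigma(x)>0$ for every $x\in\mathbb{R}$, and that $$\int_0^\infty\frac{1}{b(z)}\,dz<\infty.$$ Then, for every $x_0\in\mathbb{R}$, the one-dimensional Stratonovich SDE $$dX=b(X)\,dt+\sigma(X)\circ dW,\qquad X_0=x_0,$$ explodes $\mathbb{P}$-almost surely, i.e. the explosion time $\tau$ of its maximal local solution satisfies $\mathbb{P}(\tau<\infty)=1$.
   Context: $W$ is a one-dimensional Brownian motion on a filtered probability space $(\Omega,\mathcal{A},(\mathcal{F}_t)_t,\mathbb{P})$ satisfying the standard assumptions. $\circ$ denotes Stratonovich integration: the equation means the Itô SDE $dX=\left(b(X)+\frac12\sigma(X)\sigma'(X)\right)dt+\sigma(X)\,dW$. Its coefficients are locally Lipschitz, so there is a unique maximal local strong solution $(X_t)_{t\in[0,\tau)}$, where $\tau$ is the explosion time; on $\{\tau<\infty\}$ one has $\lim_{t\nearrow\tau}|X_t|=\infty$ $\mathbb{P}$-almost surely. *)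

theory Defs
  imports "HOL-Probability.Probability"
begin

text \<open>
  Filtrations and stopping times are those of the library, indexed by the type of extended
  nonnegative reals, which is exactly the time axis from 0 to infinity, so that stopping times
  may be infinite.  The sigma-algebra at time infinity is an arbitrary one between all the others
  and that of the ambient space and is never used.  Processes are indexed by real times and only
  their values at nonnegative times matter.
\<close>

locale usual_filtered_prob_space =
  prob_space M + complete_measure M + filtration "space M" F
  for M :: "'a measure" and F :: "ennreal \<Rightarrow> 'a measure" +
  assumes filtration_subalgebra: "\<And>t. subalgebra M (F t)"
    and filtration_null_sets: "null_sets M \<subseteq> sets (F 0)"
    and filtration_right_continuous: "\<And>t. t < \<infinity> \<Longrightarrow> sets (F t) = (\<Inter>s\<in>{t<..}. sets (F s))"

definition adapted :: "(ennreal \<Rightarrow> 'a measure) \<Rightarrow> (real \<Rightarrow> 'a \<Rightarrow> real) \<Rightarrow> bool" where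
  "adapted F X \<longleftrightarrow> (\<forall>t\<ge>0. X t \<in> borel_measurable (F (ennreal t)))"

locale brownian_motion = usual_filtered_prob_space M F
  for M :: "'a measure" and F :: "ennreal \<Rightarrow> 'a measure" +
  fixes W :: "real \<Rightarrow> 'a \<Rightarrow> real"
  assumes bm_adapted: "adapted F W"
    and bm_start: "AE \<omega> in M. W 0 \<omega> = 0"
    and bm_continuous: "AE \<omega> in M. continuous_on {0..} (\<lambda>t. W t \<omega>)"
    and bm_gaussian: "\<And>s t. 0 \<le> s \<Longrightarrow> s < t \<Longrightarrow>
      distributed M lborel (\<lambda>\<omega>. W t \<omega> - W s \<omega>) (normal_density 0 (sqrt (t - s)))"
    and bm_independent: "\<And>s t. 0 \<le> s \<Longrightarrow> s < t \<Longrightarrow>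
      indep_set (sets (F (ennreal s))) (sets (vimage_algebra (space M) (\<lambda>\<omega>. W t \<omega> - W s \<omega>) borel))"

text \<open>
  Ito integral.  A step process takes the bounded, past-measurable value \<open>\<xi> i\<close> on the interval
  from \<open>p i\<close> (excluded) to \<open>p (Suc i)\<close> (included), for \<open>i < n\<close>, and vanishes elsewhere.
\<close>

definition step_data ::
  "'a measure \<Rightarrow> (ennreal \<Rightarrow> 'a measure) \<Rightarrow> nat \<Rightarrow> (nat \<Rightarrow> real) \<Rightarrow> (nat \<Rightarrow> 'a \<Rightarrow> real) \<Rightarrow> bool" where
  "step_data M F n p \<xi> \<longleftrightarrow>
     0 \<le> p 0 \<and>
     (\<forall>i<n. p i < p (Suc i) \<and> \<xi> i \<in> borel_measurable (F (ennreal (p i))) \<and>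
        (\<exists>C. \<forall>\<omega>\<in>space M. \<bar>\<xi> i \<omega>\<bar> \<le> C))"

definition step_process ::
  "nat \<Rightarrow> (nat \<Rightarrow> real) \<Rightarrow> (nat \<Rightarrow> 'a \<Rightarrow> real) \<Rightarrow> real \<Rightarrow> 'a \<Rightarrow> real" where
  "step_process n p \<xi> s \<omega> = (\<Sum>i<n. \<xi> i \<omega> * indicator {p i<..p (Suc i)} s)"

definition step_integral ::
  "(real \<Rightarrow> 'a \<Rightarrow> real) \<Rightarrow> nat \<Rightarrow> (nat \<Rightarrow> real) \<Rightarrow> (nat \<Rightarrow> 'a \<Rightarrow> real) \<Rightarrow> real \<Rightarrow> 'a \<Rightarrow> real" where
  "step_integral W n p \<xi> t \<omega> = (\<Sum>i<n. \<xi> i \<omega> * (W (min (p (Suc i)) t) \<omega> - W (min (p i) t) \<omega>))"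

definition tendsto_zero_in_prob :: "'a measure \<Rightarrow> (nat \<Rightarrow> 'a \<Rightarrow> ennreal) \<Rightarrow> bool" where
  "tendsto_zero_in_prob M Z \<longleftrightarrow>
     (\<forall>\<epsilon>>0. (\<lambda>k. emeasure M {\<omega> \<in> space M. ennreal \<epsilon> < Z k \<omega>}) \<longlonglongrightarrow> 0)"

definition progressive :: "(ennreal \<Rightarrow> 'a measure) \<Rightarrow> (real \<Rightarrow> 'a \<Rightarrow> real) \<Rightarrow> bool" where
  "progressive F H \<longleftrightarrow>
     (\<forall>T\<ge>0. (\<lambda>(s, \<omega>). H s \<omega>) \<in> borel_measurable (restrict_space borel {0..T} \<Otimes>\<^sub>M F (ennreal T)))"

text \<open>
  \<open>I\<close> is (a continuous version of) the Ito integral of \<open>H\<close> with respect to \<open>W\<close>: the standard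
  extension from step processes, localised through convergence in probability, to integrands that
  are progressively measurable (up to indistinguishability) and pathwise locally square integrable.
  The Lebesgue integrals and suprema are taken in the extended nonnegative reals, so that
  divergence cannot be mistaken for the value 0.
\<close>

definition has_ito_integral ::
  "'a measure \<Rightarrow> (ennreal \<Rightarrow> 'a measure) \<Rightarrow> (real \<Rightarrow> 'a \<Rightarrow> real) \<Rightarrow>
   (real \<Rightarrow> 'a \<Rightarrow> real) \<Rightarrow> (real \<Rightarrow> 'a \<Rightarrow> real) \<Rightarrow> bool" where
  "has_ito_integral M F W H I \<longleftrightarrow>
     (\<exists>H'. progressive F H' \<and> (AE \<omega> in M. \<forall>s\<ge>0. H' s \<omega> = H s \<omega>)) \<and>
     (AE \<omega> in M. \<forall>T\<ge>0. (\<integral>\<^sup>+s\<in>{0..T}. ennreal ((H s \<omega>)\<^sup>2) \<partial>lborel) < \<infinity>) \<and>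
     adapted F I \<and>
     (AE \<omega> in M. continuous_on {0..} (\<lambda>t. I t \<omega>)) \<and>
     (\<exists>n p \<xi>. (\<forall>k. step_data M F (n k) (p k) (\<xi> k)) \<and>
        (\<forall>T\<ge>0.
           tendsto_zero_in_prob M (\<lambda>k \<omega>.
             \<integral>\<^sup>+s\<in>{0..T}. ennreal ((step_process (n k) (p k) (\<xi> k) s \<omega> - H s \<omega>)\<^sup>2) \<partial>lborel) \<and>
           tendsto_zero_in_prob M (\<lambda>k \<omega>.
             SUP t\<in>{0..T}. ennreal \<bar>step_integral W (n k) (p k) (\<xi> k) t \<omega> - I t \<omega>\<bar>)))"

text \<open>
  A local solution of \<open>dX = \<mu>(X) dt + \<sigma>(X) dW\<close>, \<open>X\<^sub>0 = x0\<close>, is a process \<open>X\<close> living on the times before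
  a stopping time \<open>\<tau>\<close> (its values from \<open>\<tau>\<close> on are irrelevant) that satisfies the integral equation
  up to each member of a sequence of stopping times increasing to \<open>\<tau>\<close> strictly from below.
\<close>

definition ito_local_solution ::
  "'a measure \<Rightarrow> (ennreal \<Rightarrow> 'a measure) \<Rightarrow> (real \<Rightarrow> 'a \<Rightarrow> real) \<Rightarrow> (real \<Rightarrow> real) \<Rightarrow> (real \<Rightarrow> real) \<Rightarrow>
   real \<Rightarrow> (real \<Rightarrow> 'a \<Rightarrow> real) \<Rightarrow> ('a \<Rightarrow> ennreal) \<Rightarrow> bool" where
  "ito_local_solution M F W \<mu> \<sigma> x0 X \<tau> \<longleftrightarrow>
     stopping_time F \<tau> \<and> (AE \<omega> in M. 0 < \<tau> \<omega>) \<and>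
     (\<forall>t\<ge>0. X t \<in> borel_measurable (restrict_space (F (ennreal t)) {\<omega> \<in> space M. ennreal t < \<tau> \<omega>})) \<and>
     (AE \<omega> in M. X 0 \<omega> = x0 \<and> continuous_on {t. 0 \<le> t \<and> ennreal t < \<tau> \<omega>} (\<lambda>t. X t \<omega>)) \<and>
     (\<exists>T :: nat \<Rightarrow> 'a \<Rightarrow> ennreal.
        (\<forall>n. stopping_time F (T n)) \<and>
        (AE \<omega> in M. incseq (\<lambda>n. T n \<omega>) \<and> (\<forall>n. T n \<omega> < \<tau> \<omega>) \<and> (\<lambda>n. T n \<omega>) \<longlonglongrightarrow> \<tau> \<omega>) \<and>
        (\<forall>n. \<exists>I.
           has_ito_integral M F W (\<lambda>s \<omega>. if ennreal s \<le> T n \<omega> then \<sigma> (X s \<omega>) else 0) I \<and>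
           (AE \<omega> in M. \<forall>t\<ge>0. ennreal t \<le> T n \<omega> \<longrightarrow>
              X t \<omega> = x0 + (LBINT s:{0..t}. \<mu> (X s \<omega>)) + I t \<omega>)))"

definition stratonovich_local_solution ::
  "'a measure \<Rightarrow> (ennreal \<Rightarrow> 'a measure) \<Rightarrow> (real \<Rightarrow> 'a \<Rightarrow> real) \<Rightarrow> (real \<Rightarrow> real) \<Rightarrow> (real \<Rightarrow> real) \<Rightarrow>
   real \<Rightarrow> (real \<Rightarrow> 'a \<Rightarrow> real) \<Rightarrow> ('a \<Rightarrow> ennreal) \<Rightarrow> bool" where
  "stratonovich_local_solution M F W b \<sigma> x0 X \<tau> \<longleftrightarrow>
     ito_local_solution M F W (\<lambda>x. b x + 1/2 * \<sigma> x * deriv \<sigma> x) \<sigma> x0 X \<tau>"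

text \<open>Maximal means not properly extendable; then \<open>\<tau>\<close> is the explosion time.\<close>

definition stratonovich_maximal_solution ::
  "'a measure \<Rightarrow> (ennreal \<Rightarrow> 'a measure) \<Rightarrow> (real \<Rightarrow> 'a \<Rightarrow> real) \<Rightarrow> (real \<Rightarrow> real) \<Rightarrow> (real \<Rightarrow> real) \<Rightarrow>
   real \<Rightarrow> (real \<Rightarrow> 'a \<Rightarrow> real) \<Rightarrow> ('a \<Rightarrow> ennreal) \<Rightarrow> bool" where
  "stratonovich_maximal_solution M F W b \<sigma> x0 X \<tau> \<longleftrightarrow>
     stratonovich_local_solution M F W b \<sigma> x0 X \<tau> \<and>
     (\<forall>Y \<rho>. stratonovich_local_solution M F W b \<sigma> x0 Y \<rho> \<longrightarrow>
        (AE \<omega> in M. \<tau> \<omega> \<le> \<rho> \<omega> \<and> (\<forall>t\<ge>0. ennreal t < \<tau> \<omega> \<longrightarrow> Y t \<omega> = X t \<omega>)) \<longrightarrow>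
        (AE \<omega> in M. \<rho> \<omega> = \<tau> \<omega>))"

text \<open>The library notion allows time dependence; the time argument is a dummy here.\<close>

abbreviation locally_lipschitz :: "(real \<Rightarrow> real) \<Rightarrow> bool" where
  "locally_lipschitz f \<equiv> local_lipschitz (UNIV :: real set) UNIV (\<lambda>_. f)"

end

theory Submission
  imports Defs
begin

text \<open>
  Suppose that the solution survives for ever with positive probability, and call this event A.
  Two opposite estimates of the time that X spends above 1 contradict each other.

  It is long.  Let S be an antiderivative of \<open>1 / \<sigma>\<close>.  The Ito formula turns the equation into
  \<open>S(X\<^sub>t) - S(x0) = (W\<^sub>t - W\<^sub>0) + \<integral> (b / \<sigma>)(X\<^sub>s) ds\<close>, and the drift is positive, so \<open>S(X\<^sub>t) - S(x0)\<close>
  dominates the Brownian increment.  Hence X is above 1 as soon as this increment exceeds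
  \<open>S(1) - S(x0)\<close>.  Since A is a decreasing limit of the events \<open>n < \<tau>\<close> of the past, the independence
  of increments makes this happen, within A, with a probability that is bounded below at all late times
  (\<open>W_large_on_survival_event\<close>).  So the mean time spent above 1 before T grows linearly in T.

  It is short.  Let \<open>L f = \<mu> f' + \<sigma>\<^sup>2 f'' / 2\<close> be the generator, with the Ito drift
  \<open>\<mu> = b + \<sigma> \<sigma>' / 2\<close>.  There is a nonnegative nonincreasing u
  with \<open>L u = - k\<close>, where k is the function equal to 0 below 0, to 1 above 1 and linear in between
  (\<open>lyapunov_function\<close>; the finiteness of the integral of \<open>1 / b\<close> is what keeps u nonnegative).  Then
  \<open>u(X\<^sub>t) + \<integral> k(X\<^sub>s) ds\<close> is a local martingale, and the mean time spent above 1 is at most \<open>u(x0)\<close>.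

  Both estimates use the Ito formula only through its statement along a fine partition of a bounded time
  interval.  There X is replaced by an Euler scheme whose coefficients are evaluated along X itself and
  are switched off once X has been seen outside \<open>[-R, R]\<close>.  This switch replaces exit times: it keeps
  all weights bounded and adapted, so that the orthogonality of Brownian increments is all that the
  estimates need.  The scheme is close to X on some arbitrarily fine partition
  (\<open>euler_close_to_solution\<close>), because the step processes that define the Ito integral of X can be compared
  with it cell by cell, and it satisfies an Ito formula with a small error in mean (\<open>euler_ito_defect_bound\<close>).
  Test functions are cut off outside \<open>[-R, R]\<close> to have bounded derivatives; R is taken so large
  that X stays in \<open>[-R, R]\<close> up to time T on most of A.
\<close>

section \<open>Sums of adapted weights against Brownian increments\<close>

text \<open>
  The partition points are \<open>q 0, \<dots>, q N\<close>; h is only an upper bound for the mesh.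
\<close>
definition time_grid :: "(nat \<Rightarrow> real) \<Rightarrow> nat \<Rightarrow> real \<Rightarrow> real \<Rightarrow> bool" where
  "time_grid q N T h \<longleftrightarrow> q 0 = 0 \<and> q N = T \<and> (\<forall>j<N. q j < q (Suc j) \<and> q (Suc j) - q j \<le> h)"

lemma time_grid_mono:
  assumes "time_grid q N T h" "i \<le> j" "j \<le> N"
  shows "q i \<le> q j"
  using assms(2,3)
proof (induction j rule: dec_induct)
  case (step j)
  with assms(1) show ?case unfolding time_grid_def
    by (meson Suc_le_lessD dual_order.trans le_less less_imp_le_nat)
qed simp

lemma time_grid_nonneg: "time_grid q N T h \<Longrightarrow> j \<le> N \<Longrightarrow> 0 \<le> q j"
  using time_grid_mono[of q N T h 0 j] by (simp add: time_grid_def)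

lemma time_grid_le: "time_grid q N T h \<Longrightarrow> j \<le> N \<Longrightarrow> q j \<le> T"
  using time_grid_mono[of q N T h j N] by (simp add: time_grid_def)

lemma time_grid_step: "time_grid q N T h \<Longrightarrow> j < N \<Longrightarrow> q j < q (Suc j)"
  "time_grid q N T h \<Longrightarrow> j < N \<Longrightarrow> q (Suc j) - q j \<le> h"
  by (auto simp: time_grid_def)

lemma time_grid_sum_steps:
  assumes "time_grid q N T h" "l \<le> N"
  shows "(\<Sum>j<l. q (Suc j) - q j) = q l"
  using assms by (simp add: sum_lessThan_telescope time_grid_def)

lemma time_grid_weighted_sum_le:
  assumes "time_grid q N T h" "\<And>j. j < N \<Longrightarrow> w j \<le> B"
  shows "(\<Sum>j<N. w j * (q (Suc j) - q j)) \<le> B * T"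
proof -
  have "(\<Sum>j<N. w j * (q (Suc j) - q j)) \<le> (\<Sum>j<N. B * (q (Suc j) - q j))"
    using assms time_grid_step[OF assms(1)] by (intro sum_mono mult_right_mono) (auto simp: less_imp_le)
  also have "\<dots> = B * T"
    using time_grid_sum_steps[OF assms(1), of N] assms(1)
    by (simp add: sum_distrib_left[symmetric] time_grid_def)
  finally show ?thesis .
qed

context brownian_motion
begin

abbreviation known_at :: "real \<Rightarrow> ('a \<Rightarrow> real) set" where
  "known_at t \<equiv> borel_measurable (F (ennreal t))"

abbreviation dW :: "(nat \<Rightarrow> real) \<Rightarrow> nat \<Rightarrow> 'a \<Rightarrow> real" where
  "dW q j \<omega> \<equiv> W (q (Suc j)) \<omega> - W (q j) \<omega>"

lemma space_filtration [simp]: "space (F t) = space M"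
  by (rule space_F)

lemma filtration_measurableD:
  assumes "Y \<in> borel_measurable (F t)"
  shows "Y \<in> borel_measurable M"
  using measurable_from_subalg[OF filtration_subalgebra assms] .

lemma filtration_measurable_mono:
  assumes "Y \<in> borel_measurable (F s)" "s \<le> t"
  shows "Y \<in> borel_measurable (F t)"
  using assms sets_F_mono[OF assms(2)] by (auto simp: measurable_def)

lemma W_measurable: "0 \<le> t \<Longrightarrow> W t \<in> known_at t"
  using bm_adapted by (auto simp: adapted_def)

lemma W_random_variable: "0 \<le> t \<Longrightarrow> W t \<in> borel_measurable M"
  using W_measurable filtration_measurableD by blast

lemma W_increment_measurable:
  assumes "0 \<le> s" "s \<le> t" "t \<le> r"
  shows "(\<lambda>\<omega>. W t \<omega> - W s \<omega>) \<in> known_at r"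
proof -
  have "W t \<in> known_at r" "W s \<in> known_at r"
    using assms by (auto intro!: filtration_measurable_mono[OF W_measurable] ennreal_leI)
  then show ?thesis by measurable
qed

lemma indep_var_past_increment:
  assumes "0 \<le> s" "s < t" and Y: "Y \<in> known_at s"
    and g [measurable]: "g \<in> borel_measurable borel"
  shows "indep_var borel Y borel (\<lambda>\<omega>. g (W t \<omega> - W s \<omega>))"
proof -
  have Z [measurable]: "(\<lambda>\<omega>. W t \<omega> - W s \<omega>) \<in> borel_measurable M"
    using W_increment_measurable[of s t t] assms filtration_measurableD by auto
  have ind: "indep_set (sets (F (ennreal s)))
      (sets (vimage_algebra (space M) (\<lambda>\<omega>. W t \<omega> - W s \<omega>) borel))"
    using bm_independent assms by blast
  have 1: "sigma_sets (space M) {Y -` A \<inter> space M |A. A \<in> sets borel} \<subseteq> sets (F (ennreal s))"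
  proof -
    have "{Y -` A \<inter> space M |A. A \<in> sets borel} \<subseteq> sets (F (ennreal s))"
      using measurable_sets[OF Y] by auto
    then show ?thesis
      using sets.sigma_sets_subset[of _ "F (ennreal s)"] by simp
  qed
  have 2: "sigma_sets (space M) {(\<lambda>\<omega>. g (W t \<omega> - W s \<omega>)) -` A \<inter> space M |A. A \<in> sets borel}
      \<subseteq> sets (vimage_algebra (space M) (\<lambda>\<omega>. W t \<omega> - W s \<omega>) borel)"
  proof -
    have "(\<lambda>\<omega>. g (W t \<omega> - W s \<omega>)) \<in> borel_measurable (vimage_algebra (space M) (\<lambda>\<omega>. W t \<omega> - W s \<omega>) borel)"
      by (rule measurable_compose[OF measurable_vimage_algebra1 g]) auto
    from measurable_sets[OF this]
    have "{(\<lambda>\<omega>. g (W t \<omega> - W s \<omega>)) -` A \<inter> space M |A. A \<in> sets borel}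
      \<subseteq> sets (vimage_algebra (space M) (\<lambda>\<omega>. W t \<omega> - W s \<omega>) borel)"
      by auto
    then show ?thesis
      using sets.sigma_sets_subset[of _ "vimage_algebra (space M) (\<lambda>\<omega>. W t \<omega> - W s \<omega>) borel"] by simp
  qed
  show ?thesis
    unfolding indep_var_eq
  proof (intro conjI)
    show "random_variable borel Y" using Y filtration_measurableD by blast
    show "random_variable borel (\<lambda>\<omega>. g (W t \<omega> - W s \<omega>))" by measurable
    show "indep_set (sigma_sets (space M) {Y -` A \<inter> space M |A. A \<in> sets borel})
      (sigma_sets (space M) {(\<lambda>\<omega>. g (W t \<omega> - W s \<omega>)) -` A \<inter> space M |A. A \<in> sets borel})"
      using ind 1 2 unfolding indep_sets2_eq by blast
  qed
qed

lemma expectation_past_times_increment: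
  fixes Y :: "'a \<Rightarrow> real" and g :: "real \<Rightarrow> real"
  assumes "0 \<le> s" "s < t" "Y \<in> known_at s" "g \<in> borel_measurable borel"
    and "integrable M Y" "integrable M (\<lambda>\<omega>. g (W t \<omega> - W s \<omega>))"
  shows "integrable M (\<lambda>\<omega>. Y \<omega> * g (W t \<omega> - W s \<omega>))"
    and "expectation (\<lambda>\<omega>. Y \<omega> * g (W t \<omega> - W s \<omega>)) = expectation Y * expectation (\<lambda>\<omega>. g (W t \<omega> - W s \<omega>))"
  using indep_var_integrable[OF indep_var_past_increment[OF assms(1-4)] assms(5,6)]
    indep_var_lebesgue_integral[OF indep_var_past_increment[OF assms(1-4)] assms(5,6)] by auto

lemma increment_moments:
  assumes "0 \<le> s" "s < t"
  shows "integrable M (\<lambda>\<omega>. (W t \<omega> - W s \<omega>) ^ k)"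
    and "expectation (\<lambda>\<omega>. W t \<omega> - W s \<omega>) = 0"
    and "expectation (\<lambda>\<omega>. (W t \<omega> - W s \<omega>)\<^sup>2) = t - s"
    and "expectation (\<lambda>\<omega>. (W t \<omega> - W s \<omega>) ^ 4) = 3 * (t - s)\<^sup>2"
proof -
  have pos: "0 < sqrt (t - s)" using assms by simp
  note D = bm_gaussian[OF assms]
  have I: "expectation (\<lambda>\<omega>. (W t \<omega> - W s \<omega>) ^ k)
      = (\<integral>x. normal_density 0 (sqrt (t - s)) x * (x - 0) ^ k \<partial>lborel)" for k
    using distributed_integral[OF D, of "\<lambda>x. x ^ k"] by simp
  show "integrable M (\<lambda>\<omega>. (W t \<omega> - W s \<omega>) ^ k)"
    using distributed_integrable[OF D, of "\<lambda>x. x ^ k"] integrable_normal_moment[OF pos, of 0 k] by simp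
  show "expectation (\<lambda>\<omega>. W t \<omega> - W s \<omega>) = 0"
    using I[of 1] integral_normal_moment_odd[OF pos, of 0 0] by simp
  show "expectation (\<lambda>\<omega>. (W t \<omega> - W s \<omega>)\<^sup>2) = t - s"
    using I[of 2] integral_normal_moment_even[OF pos, of 0 1] assms by (simp add: fact_numeral)
  show "expectation (\<lambda>\<omega>. (W t \<omega> - W s \<omega>) ^ 4) = 3 * (t - s)\<^sup>2"
    using I[of 4] integral_normal_moment_even[OF pos, of 0 2] assms
    by (simp add: fact_numeral field_simps)
qed

lemma integrable_bounded:
  fixes Y :: "'a \<Rightarrow> real"
  assumes "Y \<in> borel_measurable M" "\<And>\<omega>. \<omega> \<in> space M \<Longrightarrow> \<bar>Y \<omega>\<bar> \<le> B"
  shows "integrable M Y"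
  using assms by (intro integrable_const_bound[of _ B]) auto

lemma adapted_transform_sum:
  fixes a :: "nat \<Rightarrow> 'a \<Rightarrow> real" and p :: "nat \<Rightarrow> real \<Rightarrow> real"
  assumes g: "time_grid q N T h" and l: "l \<le> N"
    and a: "\<And>j. j < N \<Longrightarrow> a j \<in> known_at (q j)"
    and p [measurable]: "\<And>j. p j \<in> borel_measurable borel"
  shows "(\<lambda>\<omega>. \<Sum>j<l. a j \<omega> * p j (dW q j \<omega>)) \<in> known_at (q l)"
proof (rule borel_measurable_sum)
  fix j assume "j \<in> {..<l}"
  then have j: "j < N" "Suc j \<le> l" using l by auto
  have 1: "a j \<in> known_at (q l)"
    by (rule filtration_measurable_mono[OF a[OF j(1)]])
      (use time_grid_mono[OF g, of j l] j l in \<open>auto intro: ennreal_leI\<close>)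
  have 2: "(\<lambda>\<omega>. dW q j \<omega>) \<in> known_at (q l)"
    using time_grid_nonneg[OF g, of j] time_grid_step(1)[OF g, of j] time_grid_mono[OF g, of "Suc j" l] j l
    by (intro W_increment_measurable) auto
  show "(\<lambda>\<omega>. a j \<omega> * p j (dW q j \<omega>)) \<in> known_at (q l)"
    using 1 measurable_compose[OF 2 p[of j]] by measurable
qed

text \<open>
  Orthogonality of martingale increments.  The weight \<open>a j\<close> is known at time \<open>q j\<close> and the centred
  variable \<open>p j\<close> of the next Brownian increment is independent of that past, so in the square of the
  sum all mixed terms have mean zero.  The function \<open>p j\<close> is the identity for stochastic sums and the
  centred square for quadratic variations.
\<close>
lemma transform_sum_moments:
  fixes a :: "nat \<Rightarrow> 'a \<Rightarrow> real" and p :: "nat \<Rightarrow> real \<Rightarrow> real"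
  assumes g: "time_grid q N T h" and l: "l \<le> N"
    and a: "\<And>j. j < N \<Longrightarrow> a j \<in> known_at (q j)"
    and ab: "\<And>j \<omega>. j < N \<Longrightarrow> \<omega> \<in> space M \<Longrightarrow> \<bar>a j \<omega>\<bar> \<le> B"
    and p [measurable]: "\<And>j. p j \<in> borel_measurable borel"
    and pint: "\<And>j. j < N \<Longrightarrow> integrable M (\<lambda>\<omega>. (p j (dW q j \<omega>))\<^sup>2)"
    and p0: "\<And>j. j < N \<Longrightarrow> expectation (\<lambda>\<omega>. p j (dW q j \<omega>)) = 0"
    and pv: "\<And>j. j < N \<Longrightarrow> expectation (\<lambda>\<omega>. (p j (dW q j \<omega>))\<^sup>2) = v j"
  defines "S \<equiv> \<lambda>l \<omega>. \<Sum>j<l. a j \<omega> * p j (dW q j \<omega>)"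
  shows "integrable M (S l)" "expectation (S l) = 0" "integrable M (\<lambda>\<omega>. (S l \<omega>)\<^sup>2)"
    "expectation (\<lambda>\<omega>. (S l \<omega>)\<^sup>2) = (\<Sum>j<l. expectation (\<lambda>\<omega>. (a j \<omega>)\<^sup>2) * v j)"
proof -
  have SF: "S l \<in> known_at (q l)" if "l \<le> N" for l
    unfolding S_def by (rule adapted_transform_sum[OF g that a p])
  have SM: "S l \<in> borel_measurable M" if "l \<le> N" for l
    using SF[OF that] filtration_measurableD by blast
  have "integrable M (S l) \<and> expectation (S l) = 0 \<and> integrable M (\<lambda>\<omega>. (S l \<omega>)\<^sup>2) \<and>
    expectation (\<lambda>\<omega>. (S l \<omega>)\<^sup>2) = (\<Sum>j<l. expectation (\<lambda>\<omega>. (a j \<omega>)\<^sup>2) * v j)"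
    using l
  proof (induction l)
    case 0
    then show ?case by (simp add: S_def)
  next
    case (Suc l)
    then have l: "l < N" "l \<le> N" by auto
    let ?D = "\<lambda>\<omega>. dW q l \<omega>"
    note IH = Suc.IH[OF l(2)]
    have st: "0 \<le> q l" "q l < q (Suc l)"
      using time_grid_nonneg[OF g l(2)] time_grid_step[OF g l(1)] by auto
    have aF [measurable]: "a l \<in> known_at (q l)" by (rule a[OF l(1)])
    have aM [measurable]: "a l \<in> borel_measurable M" using aF filtration_measurableD by blast
    have DM [measurable]: "?D \<in> borel_measurable M"
      using W_increment_measurable[of "q l" "q (Suc l)" "q (Suc l)"] st filtration_measurableD by auto
    have SFl [measurable]: "S l \<in> known_at (q l)" by (rule SF[OF l(2)])
    have SMl [measurable]: "S l \<in> borel_measurable M" by (rule SM[OF l(2)])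
    have ai: "integrable M (a l)" using integrable_bounded[OF aM ab[OF l(1)]] .
    have ai2: "integrable M (\<lambda>\<omega>. (a l \<omega>)\<^sup>2)"
    proof (rule integrable_bounded)
      show "\<bar>(a l \<omega>)\<^sup>2\<bar> \<le> B\<^sup>2" if "\<omega> \<in> space M" for \<omega>
        using ab[OF l(1) that] by (simp add: abs_le_square_iff[symmetric])
    qed measurable
    have aS: "integrable M (\<lambda>\<omega>. 2 * (S l \<omega> * a l \<omega>))"
    proof (rule Bochner_Integration.integrable_bound)
      show "integrable M (\<lambda>\<omega>. 2 * B * S l \<omega>)" using IH by auto
      show "AE \<omega> in M. norm (2 * (S l \<omega> * a l \<omega>)) \<le> norm (2 * B * S l \<omega>)"
      proof (intro AE_I2)
        fix \<omega> assume "\<omega> \<in> space M"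
        then have "\<bar>a l \<omega>\<bar> \<le> \<bar>B\<bar>" using ab[OF l(1)] by fastforce
        then show "norm (2 * (S l \<omega> * a l \<omega>)) \<le> norm (2 * B * S l \<omega>)"
          using mult_left_mono[of "\<bar>a l \<omega>\<bar>" "\<bar>B\<bar>" "\<bar>S l \<omega>\<bar>"] by (simp add: abs_mult mult.commute)
      qed
    qed measurable
    have pi: "integrable M (\<lambda>\<omega>. p l (?D \<omega>))"
      by (rule square_integrable_imp_integrable[OF _ pint[OF l(1)]]) measurable
    have c1: "integrable M (\<lambda>\<omega>. a l \<omega> * p l (?D \<omega>))" "expectation (\<lambda>\<omega>. a l \<omega> * p l (?D \<omega>)) = 0"
      using expectation_past_times_increment[OF st aF p ai pi] p0[OF l(1)] by auto
    have c2: "integrable M (\<lambda>\<omega>. (2 * (S l \<omega> * a l \<omega>)) * p l (?D \<omega>))"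
      "expectation (\<lambda>\<omega>. (2 * (S l \<omega> * a l \<omega>)) * p l (?D \<omega>)) = 0"
      using expectation_past_times_increment[OF st _ p aS pi] p0[OF l(1)] by auto
    have c3: "integrable M (\<lambda>\<omega>. (a l \<omega>)\<^sup>2 * (p l (?D \<omega>))\<^sup>2)"
      "expectation (\<lambda>\<omega>. (a l \<omega>)\<^sup>2 * (p l (?D \<omega>))\<^sup>2) = expectation (\<lambda>\<omega>. (a l \<omega>)\<^sup>2) * v l"
      using expectation_past_times_increment[OF st _ _ ai2, of "\<lambda>x. (p l x)\<^sup>2"] pint[OF l(1)] pv[OF l(1)] by auto
    have eq: "S (Suc l) = (\<lambda>\<omega>. S l \<omega> + a l \<omega> * p l (?D \<omega>))" by (simp add: S_def fun_eq_iff)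
    have eq2: "(\<lambda>\<omega>. (S (Suc l) \<omega>)\<^sup>2)
        = (\<lambda>\<omega>. (S l \<omega>)\<^sup>2 + (2 * (S l \<omega> * a l \<omega>)) * p l (?D \<omega>) + (a l \<omega>)\<^sup>2 * (p l (?D \<omega>))\<^sup>2)"
      unfolding eq by (simp add: fun_eq_iff power2_eq_square algebra_simps)
    show ?case
      unfolding eq2 unfolding eq using IH c1 c2 c3 by simp
  qed
  then show "integrable M (S l)" "expectation (S l) = 0" "integrable M (\<lambda>\<omega>. (S l \<omega>)\<^sup>2)"
    "expectation (\<lambda>\<omega>. (S l \<omega>)\<^sup>2) = (\<Sum>j<l. expectation (\<lambda>\<omega>. (a j \<omega>)\<^sup>2) * v j)"
    by auto
qed

lemma stochastic_sum_moments:
  fixes a :: "nat \<Rightarrow> 'a \<Rightarrow> real"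
  assumes g: "time_grid q N T h" and l: "l \<le> N"
    and a: "\<And>j. j < N \<Longrightarrow> a j \<in> known_at (q j)"
    and ab: "\<And>j \<omega>. j < N \<Longrightarrow> \<omega> \<in> space M \<Longrightarrow> \<bar>a j \<omega>\<bar> \<le> B"
  defines "S \<equiv> \<lambda>\<omega>. \<Sum>j<l. a j \<omega> * (dW q j \<omega>)"
  shows "integrable M S" "expectation S = 0" "integrable M (\<lambda>\<omega>. (S \<omega>)\<^sup>2)"
    "expectation (\<lambda>\<omega>. (S \<omega>)\<^sup>2) = (\<Sum>j<l. expectation (\<lambda>\<omega>. (a j \<omega>)\<^sup>2) * (q (Suc j) - q j))"
  unfolding S_def
  using transform_sum_moments[OF g l a ab, of "\<lambda>_ x. x" "\<lambda>j. q (Suc j) - q j"]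
    increment_moments(1)[of "q _" "q (Suc _)" 2] increment_moments(2,3)
    time_grid_nonneg[OF g] time_grid_step(1)[OF g] by auto

lemma variation_sum_moments:
  fixes a :: "nat \<Rightarrow> 'a \<Rightarrow> real"
  assumes g: "time_grid q N T h" and l: "l \<le> N"
    and a: "\<And>j. j < N \<Longrightarrow> a j \<in> known_at (q j)"
    and ab: "\<And>j \<omega>. j < N \<Longrightarrow> \<omega> \<in> space M \<Longrightarrow> \<bar>a j \<omega>\<bar> \<le> B"
  defines "S \<equiv> \<lambda>\<omega>. \<Sum>j<l. a j \<omega> * ((dW q j \<omega>)\<^sup>2 - (q (Suc j) - q j))"
  shows "integrable M S" "integrable M (\<lambda>\<omega>. (S \<omega>)\<^sup>2)"
    "expectation (\<lambda>\<omega>. (S \<omega>)\<^sup>2) = (\<Sum>j<l. expectation (\<lambda>\<omega>. (a j \<omega>)\<^sup>2) * (2 * (q (Suc j) - q j)\<^sup>2))"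
proof -
  define p where "p j x = x\<^sup>2 - (q (Suc j) - q j)" for j and x :: real
  have pm: "p j \<in> borel_measurable borel" for j unfolding p_def by measurable
  have st: "0 \<le> q j" "q j < q (Suc j)" if "j < N" for j
    using time_grid_nonneg[OF g, of j] time_grid_step[OF g, of j] that by auto
  have eq: "(p j x)\<^sup>2 = x ^ 4 - 2 * (q (Suc j) - q j) * x\<^sup>2 + (q (Suc j) - q j)\<^sup>2" for j x
    unfolding p_def by (simp add: power2_eq_square power4_eq_xxxx algebra_simps)
  have 1: "integrable M (\<lambda>\<omega>. (p j (dW q j \<omega>))\<^sup>2)" if "j < N" for j
    unfolding eq using increment_moments(1)[OF st[OF that]] by auto
  have 2: "expectation (\<lambda>\<omega>. p j (dW q j \<omega>)) = 0" if "j < N" for j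
    unfolding p_def using increment_moments(1)[OF st[OF that], of 2] increment_moments(3)[OF st[OF that]]
    by (simp add: prob_space)
  have 3: "expectation (\<lambda>\<omega>. (p j (dW q j \<omega>))\<^sup>2) = 2 * (q (Suc j) - q j)\<^sup>2" if "j < N" for j
  proof -
    define D where "D \<omega> = dW q j \<omega>" for \<omega>
    define d where "d = q (Suc j) - q j"
    have "integrable M (\<lambda>\<omega>. D \<omega> ^ 4)" "integrable M (\<lambda>\<omega>. (D \<omega>)\<^sup>2)"
      "expectation (\<lambda>\<omega>. (D \<omega>)\<^sup>2) = d" "expectation (\<lambda>\<omega>. D \<omega> ^ 4) = 3 * d\<^sup>2"
      using increment_moments(1,3,4)[OF st[OF that]] unfolding D_def d_def by auto
    then have "expectation (\<lambda>\<omega>. D \<omega> ^ 4 - 2 * d * (D \<omega>)\<^sup>2 + d\<^sup>2) = 3 * d\<^sup>2 - 2 * d * d + d\<^sup>2"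
      by (simp add: prob_space)
    then show ?thesis
      unfolding eq D_def[symmetric] d_def[symmetric] by (simp add: power2_eq_square)
  qed
  show "integrable M S" "integrable M (\<lambda>\<omega>. (S \<omega>)\<^sup>2)"
    "expectation (\<lambda>\<omega>. (S \<omega>)\<^sup>2) = (\<Sum>j<l. expectation (\<lambda>\<omega>. (a j \<omega>)\<^sup>2) * (2 * (q (Suc j) - q j)\<^sup>2))"
    using transform_sum_moments[OF g l a ab pm 1 2 3] unfolding S_def p_def by auto
qed

text \<open>
  A discrete Lenglart inequality.  The weights are switched off before their accumulated square
  exceeds \<open>\<eta>\<close>; the accumulated square up to and including the step j is already known at time \<open>q j\<close>, so the new
  weights are still adapted.  The new sum has second moment at most \<open>\<eta>\<close>, and it is equal to the old
  one unless the full accumulated square exceeds \<open>\<eta>\<close>.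
\<close>
lemma stochastic_sum_tail_bound:
  fixes a :: "nat \<Rightarrow> 'a \<Rightarrow> real"
  assumes g: "time_grid q N T h" and l: "l \<le> N"
    and a: "\<And>j. j < N \<Longrightarrow> a j \<in> known_at (q j)"
    and ab: "\<And>j \<omega>. j < N \<Longrightarrow> \<omega> \<in> space M \<Longrightarrow> \<bar>a j \<omega>\<bar> \<le> B"
    and "0 < \<epsilon>" "0 \<le> \<eta>"
  shows "prob {\<omega> \<in> space M. \<epsilon> < \<bar>\<Sum>j<l. a j \<omega> * (dW q j \<omega>)\<bar>}
    \<le> prob {\<omega> \<in> space M. \<eta> < (\<Sum>j<N. (a j \<omega>)\<^sup>2 * (q (Suc j) - q j))} + \<eta> / \<epsilon>\<^sup>2"
proof -
  define Q where "Q j \<omega> = (\<Sum>i<j. (a i \<omega>)\<^sup>2 * (q (Suc i) - q i))" for j \<omega>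
  define a' where "a' j \<omega> = (if Q (Suc j) \<omega> \<le> \<eta> then a j \<omega> else 0)" for j \<omega>
  have st: "0 \<le> q j" "q j < q (Suc j)" if "j < N" for j
    using time_grid_nonneg[OF g, of j] time_grid_step[OF g, of j] that by auto
  have Qmono: "Q i \<omega> \<le> Q j \<omega>" if "i \<le> j" "j \<le> N" for i j \<omega>
    unfolding Q_def using that st by (intro sum_mono2) (auto simp: less_imp_le)
  have QF: "Q (Suc j) \<in> known_at (q j)" if "j < N" for j
    unfolding Q_def
  proof (rule borel_measurable_sum)
    fix i assume "i \<in> {..<Suc j}"
    then have i: "i \<le> j" "i < N" using that by auto
    have "a i \<in> known_at (q j)"
      by (rule filtration_measurable_mono[OF a[OF i(2)]])
        (use time_grid_mono[OF g, of i j] i that in \<open>auto intro: ennreal_leI\<close>)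
    then show "(\<lambda>\<omega>. (a i \<omega>)\<^sup>2 * (q (Suc i) - q i)) \<in> known_at (q j)" by measurable
  qed
  have a'F: "a' j \<in> known_at (q j)" if "j < N" for j
    using QF[OF that] a[OF that] unfolding a'_def by measurable
  have a'b: "\<bar>a' j \<omega>\<bar> \<le> \<bar>B\<bar>" if "j < N" "\<omega> \<in> space M" for j \<omega>
    using ab[OF that] unfolding a'_def by auto
  have Q'le: "(\<Sum>j<l. (a' j \<omega>)\<^sup>2 * (q (Suc j) - q j)) \<le> (if Q l \<omega> \<le> \<eta> then Q l \<omega> else \<eta>)" if "l \<le> N" for l \<omega>
    using that
  proof (induction l)
    case 0
    then show ?case using \<open>0 \<le> \<eta>\<close> by (simp add: Q_def)
  next
    case (Suc l)
    have "Q l \<omega> \<le> Q (Suc l) \<omega>" using Qmono Suc.prems by simp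
    then show ?case using Suc unfolding a'_def by (auto simp: Q_def split: if_splits)
  qed
  let ?S = "\<lambda>\<omega>. \<Sum>j<l. a j \<omega> * (dW q j \<omega>)"
  let ?S' = "\<lambda>\<omega>. \<Sum>j<l. a' j \<omega> * (dW q j \<omega>)"
  have SM [measurable]: "?S \<in> borel_measurable M" "?S' \<in> borel_measurable M"
    using adapted_transform_sum[OF g l a, of "\<lambda>_ x. x"] adapted_transform_sum[OF g l a'F, of "\<lambda>_ x. x"]
      filtration_measurableD by auto
  have aM: "a j \<in> borel_measurable M" if "j < N" for j using a[OF that] filtration_measurableD by blast
  have a'M: "a' j \<in> borel_measurable M" if "j < N" for j using a'F[OF that] filtration_measurableD by blast
  have QM [measurable]: "Q N \<in> borel_measurable M"
    unfolding Q_def using aM by (intro borel_measurable_sum) auto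
  have a'2: "integrable M (\<lambda>\<omega>. (a' j \<omega>)\<^sup>2)" if "j < N" for j
    using a'b[OF that] a'M[OF that]
    by (intro integrable_bounded[of _ "B\<^sup>2"]) (auto simp: abs_le_square_iff)
  note mom = stochastic_sum_moments[OF g l a'F a'b]
  have "expectation (\<lambda>\<omega>. (?S' \<omega>)\<^sup>2) = expectation (\<lambda>\<omega>. \<Sum>j<l. (a' j \<omega>)\<^sup>2 * (q (Suc j) - q j))"
    using mom(4) a'2 l by (simp add: Bochner_Integration.integral_sum)
  also have "\<dots> \<le> expectation (\<lambda>\<omega>. \<eta>)"
  proof (rule integral_mono)
    show "integrable M (\<lambda>\<omega>. \<Sum>j<l. (a' j \<omega>)\<^sup>2 * (q (Suc j) - q j))" using a'2 l by auto
    show "(\<Sum>j<l. (a' j \<omega>)\<^sup>2 * (q (Suc j) - q j)) \<le> \<eta>" for \<omega>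
      using Q'le[OF l, of \<omega>] by (auto split: if_splits)
  qed simp
  finally have E: "expectation (\<lambda>\<omega>. (?S' \<omega>)\<^sup>2) \<le> \<eta>" by (simp add: prob_space)
  have "prob {\<omega> \<in> space M. \<epsilon> < \<bar>?S' \<omega>\<bar>} \<le> prob {\<omega> \<in> space M. (?S' \<omega>)\<^sup>2 \<ge> \<epsilon>\<^sup>2}"
    using \<open>0 < \<epsilon>\<close> by (intro finite_measure_mono) (auto simp: abs_le_square_iff[symmetric])
  also have "\<dots> \<le> expectation (\<lambda>\<omega>. (?S' \<omega>)\<^sup>2) / \<epsilon>\<^sup>2"
    using mom(3) \<open>0 < \<epsilon>\<close> by (intro integral_Markov_inequality_measure[where A="{}"]) auto
  also have "\<dots> \<le> \<eta> / \<epsilon>\<^sup>2" using E by (simp add: divide_right_mono)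
  finally have S': "prob {\<omega> \<in> space M. \<epsilon> < \<bar>?S' \<omega>\<bar>} \<le> \<eta> / \<epsilon>\<^sup>2" .
  have eq: "?S \<omega> = ?S' \<omega>" if "Q N \<omega> \<le> \<eta>" for \<omega>
  proof (rule sum.cong)
    fix j assume "j \<in> {..<l}"
    then have "Q (Suc j) \<omega> \<le> \<eta>" using Qmono[of "Suc j" N \<omega>] that l by auto
    then show "a j \<omega> * (dW q j \<omega>) = a' j \<omega> * (dW q j \<omega>)"
      by (simp add: a'_def)
  qed simp
  have "{\<omega> \<in> space M. \<epsilon> < \<bar>?S \<omega>\<bar>} \<subseteq> {\<omega> \<in> space M. \<eta> < Q N \<omega>} \<union> {\<omega> \<in> space M. \<epsilon> < \<bar>?S' \<omega>\<bar>}"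
  proof
    fix \<omega> assume "\<omega> \<in> {\<omega> \<in> space M. \<epsilon> < \<bar>?S \<omega>\<bar>}"
    then show "\<omega> \<in> {\<omega> \<in> space M. \<eta> < Q N \<omega>} \<union> {\<omega> \<in> space M. \<epsilon> < \<bar>?S' \<omega>\<bar>}"
      using eq[of \<omega>] by (cases "Q N \<omega> \<le> \<eta>") auto
  qed
  then have "prob {\<omega> \<in> space M. \<epsilon> < \<bar>?S \<omega>\<bar>} \<le> prob ({\<omega> \<in> space M. \<eta> < Q N \<omega>} \<union> {\<omega> \<in> space M. \<epsilon> < \<bar>?S' \<omega>\<bar>})"
    by (intro finite_measure_mono) auto
  also have "\<dots> \<le> prob {\<omega> \<in> space M. \<eta> < Q N \<omega>} + prob {\<omega> \<in> space M. \<epsilon> < \<bar>?S' \<omega>\<bar>}"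
    by (intro measure_Un_le) auto
  finally show ?thesis using S' unfolding Q_def by simp
qed

end

section \<open>An Ito formula for Euler schemes\<close>

text \<open>
  Where \<open>d\<close> exceeds the scale \<open>\<eta>\<close> on which f2 varies little, the crude bound \<open>2 K\<close> for the variation
  of f2 is absorbed into a fourth power of \<open>d\<close>, whose mean is of second order in the time step.
\<close>
lemma second_order_taylor_bound:
  fixes f f1 f2 :: "real \<Rightarrow> real"
  assumes f1: "\<And>x. (f has_real_derivative f1 x) (at x)"
    and f2: "\<And>x. (f1 has_real_derivative f2 x) (at x)"
    and K: "\<And>x. \<bar>f2 x\<bar> \<le> K" and "0 < \<eta>" "0 \<le> \<rho>"
    and mod: "\<And>x y. \<bar>x - y\<bar> \<le> \<eta> \<Longrightarrow> \<bar>f2 x - f2 y\<bar> \<le> \<rho>"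
  shows "\<bar>f (x + d) - f x - f1 x * d - f2 x * d\<^sup>2 / 2\<bar> \<le> \<rho> / 2 * d\<^sup>2 + K * d ^ 4 / \<eta>\<^sup>2"
proof (cases "d = 0")
  case False
  define diff where "diff n = (if n = 0 then f else if n = 1 then f1 else f2)" for n :: nat
  have "\<exists>t. (if x + d < x then x + d < t \<and> t < x else x < t \<and> t < x + d) \<and>
     f (x + d) = (\<Sum>m<2. diff m x / fact m * (x + d - x) ^ m) + diff 2 t / fact 2 * (x + d - x) ^ 2"
    by (rule Taylor[where a = "min x (x + d)" and b = "max x (x + d)"])
      (use f1 f2 False in \<open>auto simp: diff_def less_2_cases_iff\<close>)
  then obtain t where t0: "if x + d < x then x + d < t \<and> t < x else x < t \<and> t < x + d"
    "f (x + d) = (\<Sum>m<2. diff m x / fact m * (x + d - x) ^ m) + diff 2 t / fact 2 * (x + d - x) ^ 2"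
    by blast
  have t: "\<bar>t - x\<bar> \<le> \<bar>d\<bar>" "f (x + d) = f x + f1 x * d + f2 t * d\<^sup>2 / 2"
    using t0 by (auto simp: diff_def numeral_2_eq_2 split: if_splits)
  have K0: "0 \<le> K" using K[of x] by linarith
  have "\<bar>f2 t - f2 x\<bar> \<le> \<rho> + 2 * K * d\<^sup>2 / \<eta>\<^sup>2"
  proof (cases "\<bar>t - x\<bar> \<le> \<eta>")
    case True
    then show ?thesis using mod[of t x] K0 by (simp add: add_increasing2)
  next
    case False
    then have "\<eta>\<^sup>2 \<le> d\<^sup>2" using t(1) \<open>0 < \<eta>\<close> by (intro abs_le_square_iff[THEN iffD1]) auto
    then have "1 \<le> d\<^sup>2 / \<eta>\<^sup>2" using \<open>0 < \<eta>\<close> by simp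
    then have "2 * K * 1 \<le> 2 * K * (d\<^sup>2 / \<eta>\<^sup>2)" using K0 by (intro mult_left_mono) auto
    moreover have "\<bar>f2 t - f2 x\<bar> \<le> 2 * K" using K[of t] K[of x] by linarith
    ultimately show ?thesis using \<open>0 \<le> \<rho>\<close> by simp
  qed
  then have "\<bar>f2 t - f2 x\<bar> * (d\<^sup>2 / 2) \<le> (\<rho> + 2 * K * d\<^sup>2 / \<eta>\<^sup>2) * (d\<^sup>2 / 2)"
    by (intro mult_right_mono) auto
  moreover have "\<bar>f (x + d) - f x - f1 x * d - f2 x * d\<^sup>2 / 2\<bar> = \<bar>f2 t - f2 x\<bar> * (d\<^sup>2 / 2)"
  proof -
    have "f (x + d) - f x - f1 x * d - f2 x * d\<^sup>2 / 2 = (f2 t - f2 x) * (d\<^sup>2 / 2)"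
      using t(2) by (simp add: algebra_simps diff_divide_distrib)
    then show ?thesis by (simp only: abs_mult) simp
  qed
  moreover have "(\<rho> + 2 * K * d\<^sup>2 / \<eta>\<^sup>2) * (d\<^sup>2 / 2) = \<rho> / 2 * d\<^sup>2 + K * d ^ 4 / \<eta>\<^sup>2"
    by (simp add: algebra_simps power2_eq_square power4_eq_xxxx)
  ultimately show ?thesis by linarith
qed (use assms in simp)

lemma abs_le_square_over:
  fixes x \<theta> :: real
  assumes "0 < \<theta>"
  shows "\<bar>x\<bar> \<le> \<theta> + x\<^sup>2 / \<theta>"
proof (cases "\<bar>x\<bar> \<le> \<theta>")
  case False
  then have "\<bar>x\<bar> * \<theta> \<le> \<bar>x\<bar> * \<bar>x\<bar>" by (intro mult_left_mono) auto
  then have "\<bar>x\<bar> \<le> x\<^sup>2 / \<theta>" using assms by (simp add: field_simps power2_eq_square)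
  then show ?thesis using assms by simp
qed (use assms in \<open>simp add: add_increasing2\<close>)

lemma (in prob_space) expectation_abs_le_second_moment:
  fixes Y :: "'a \<Rightarrow> real"
  assumes "integrable M Y" "integrable M (\<lambda>\<omega>. (Y \<omega>)\<^sup>2)" "expectation (\<lambda>\<omega>. (Y \<omega>)\<^sup>2) \<le> B * \<theta>\<^sup>2" "0 < \<theta>"
  shows "expectation (\<lambda>\<omega>. \<bar>Y \<omega>\<bar>) \<le> (1 + B) * \<theta>"
proof -
  have "expectation (\<lambda>\<omega>. \<bar>Y \<omega>\<bar>) \<le> expectation (\<lambda>\<omega>. \<theta> + (Y \<omega>)\<^sup>2 / \<theta>)"
    using assms abs_le_square_over by (intro integral_mono) auto
  also have "\<dots> = \<theta> + expectation (\<lambda>\<omega>. (Y \<omega>)\<^sup>2) / \<theta>"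
    using assms by (simp add: prob_space)
  also have "\<dots> \<le> \<theta> + B * \<theta>\<^sup>2 / \<theta>"
    using assms by (intro add_left_mono divide_right_mono) auto
  finally show ?thesis using \<open>0 < \<theta>\<close> by (simp add: power2_eq_square algebra_simps)
qed

context brownian_motion
begin

text \<open>
  The weights m and s are arbitrary adapted sequences, and W is evaluated at the points of q: this is
  the discrete counterpart of a process \<open>x0 + \<integral> m dt + \<integral> s dW\<close>.
\<close>
definition euler :: "real \<Rightarrow> (nat \<Rightarrow> real) \<Rightarrow> (nat \<Rightarrow> 'a \<Rightarrow> real) \<Rightarrow> (nat \<Rightarrow> 'a \<Rightarrow> real) \<Rightarrow> nat \<Rightarrow> 'a \<Rightarrow> real" where
  "euler x0 q m s l \<omega> = x0 + (\<Sum>j<l. m j \<omega> * (q (Suc j) - q j)) +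
     (\<Sum>j<l. s j \<omega> * (dW q j \<omega>))"

lemma euler_Suc:
  "euler x0 q m s (Suc l) \<omega> = euler x0 q m s l \<omega> + (m l \<omega> * (q (Suc l) - q l) + s l \<omega> * (dW q l \<omega>))"
  by (simp add: euler_def)

lemma euler_adapted:
  assumes g: "time_grid q N T h" and l: "l \<le> N"
    and m: "\<And>j. j < N \<Longrightarrow> m j \<in> known_at (q j)"
    and s: "\<And>j. j < N \<Longrightarrow> s j \<in> known_at (q j)"
  shows "euler x0 q m s l \<in> known_at (q l)"
  using adapted_transform_sum[OF g l m, of "\<lambda>j _. q (Suc j) - q j"]
    adapted_transform_sum[OF g l s, of "\<lambda>_ x. x"]
  unfolding euler_def by measurable

text \<open>
  The error in the Ito formula when the derivatives of f are evaluated along a second process Z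
  in place of the scheme itself.
\<close>
definition euler_ito_defect ::
  "(real \<Rightarrow> real) \<Rightarrow> (real \<Rightarrow> real) \<Rightarrow> (real \<Rightarrow> real) \<Rightarrow> real \<Rightarrow> (nat \<Rightarrow> real) \<Rightarrow> nat \<Rightarrow>
    (nat \<Rightarrow> 'a \<Rightarrow> real) \<Rightarrow> (nat \<Rightarrow> 'a \<Rightarrow> real) \<Rightarrow> (nat \<Rightarrow> 'a \<Rightarrow> real) \<Rightarrow> 'a \<Rightarrow> real" where
  "euler_ito_defect f f1 f2 x0 q N m s Z \<omega> =
     f (euler x0 q m s N \<omega>) - f x0
     - (\<Sum>j<N. f1 (Z j \<omega>) * s j \<omega> * (dW q j \<omega>))
     - (\<Sum>j<N. (f1 (Z j \<omega>) * m j \<omega> + f2 (Z j \<omega>) * (s j \<omega>)\<^sup>2 / 2) * (q (Suc j) - q j))"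

text \<open>
  The defect is split into two sums of orthogonal terms, one from evaluating f1 along Z and one from
  replacing squared Brownian increments by time steps, and a remainder.  The orthogonal sums are small
  in mean square, while the terms of the remainder are, in mean, small multiples of the time step.  Every small
  quantity is tied to one parameter \<open>\<theta>\<close>; the constant in front of it depends only on K and T, so it does not change
  when the grid is refined.
\<close>
lemma euler_ito_defect_bound:
  fixes f f1 f2 :: "real \<Rightarrow> real"
  assumes g: "time_grid q N T h"
    and f1: "\<And>x. (f has_real_derivative f1 x) (at x)"
    and f2: "\<And>x. (f1 has_real_derivative f2 x) (at x)"
    and f2c: "continuous_on UNIV f2"
    and K: "\<And>x. \<bar>f1 x\<bar> \<le> K" "\<And>x. \<bar>f2 x\<bar> \<le> K"
    and \<theta>: "0 < \<theta>" "\<theta> \<le> 1" and \<eta>: "0 < \<eta>"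
    and mod1: "\<And>x y. \<bar>x - y\<bar> \<le> \<eta> \<Longrightarrow> \<bar>f1 x - f1 y\<bar> \<le> \<theta>\<^sup>2"
    and mod2: "\<And>x y. \<bar>x - y\<bar> \<le> \<eta> \<Longrightarrow> \<bar>f2 x - f2 y\<bar> \<le> \<theta>\<^sup>2"
    and h: "h \<le> \<theta> ^ 4" "h \<le> \<theta>\<^sup>2 * \<eta>\<^sup>2"
    and m: "\<And>j. j < N \<Longrightarrow> m j \<in> known_at (q j)"
      "\<And>j \<omega>. j < N \<Longrightarrow> \<omega> \<in> space M \<Longrightarrow> \<bar>m j \<omega>\<bar> \<le> K"
    and s: "\<And>j. j < N \<Longrightarrow> s j \<in> known_at (q j)"
      "\<And>j \<omega>. j < N \<Longrightarrow> \<omega> \<in> space M \<Longrightarrow> \<bar>s j \<omega>\<bar> \<le> K"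
    and Z: "\<And>j. j < N \<Longrightarrow> Z j \<in> known_at (q j)"
    and close: "\<And>j. j < N \<Longrightarrow>
      prob {\<omega> \<in> space M. (m j \<omega> \<noteq> 0 \<or> s j \<omega> \<noteq> 0) \<and> \<eta> < \<bar>euler x0 q m s j \<omega> - Z j \<omega>\<bar>} \<le> \<theta>\<^sup>2"
  shows "integrable M (euler_ito_defect f f1 f2 x0 q N m s Z)"
    and "expectation (\<lambda>\<omega>. \<bar>euler_ito_defect f f1 f2 x0 q N m s Z \<omega>\<bar>)
      \<le> (2 + T * (2 * K ^ 3 * (1 + 2 * K) + K ^ 6 / 2 +
            ((K + K\<^sup>2 / 2) * (1 + 2 * K) + 5 / 2 * K ^ 3 + 2 * K\<^sup>2 + 32 * K ^ 5))) * \<theta>"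
proof -
  define d where "d j = q (Suc j) - q j" for j
  define B where "B j \<omega> = dW q j \<omega>" for j \<omega>
  define E where "E = euler x0 q m s"
  define act where "act j \<omega> = (if m j \<omega> \<noteq> 0 \<or> s j \<omega> \<noteq> 0 then 1 else 0 :: real)" for j \<omega>
  define D1 where "D1 j \<omega> = act j \<omega> * \<bar>f1 (E j \<omega>) - f1 (Z j \<omega>)\<bar>" for j \<omega>
  define D2 where "D2 j \<omega> = act j \<omega> * \<bar>f2 (E j \<omega>) - f2 (Z j \<omega>)\<bar>" for j \<omega>
  have K0: "0 \<le> K" using K(1)[of 0] by linarith
  have st: "0 \<le> q j" "q j < q (Suc j)" "0 < d j" "d j \<le> h" "d j \<le> 1" if "j < N" for j
  proof -
    have "\<theta> ^ 4 \<le> 1" using \<theta> by (simp add: power_le_one)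
    then show "0 \<le> q j" "q j < q (Suc j)" "0 < d j" "d j \<le> h" "d j \<le> 1"
      using time_grid_nonneg[OF g, of j] time_grid_step[OF g that] h(1) that unfolding d_def by auto
  qed
  have f1c: "continuous_on UNIV f1" using f2 by (intro DERIV_continuous_on) auto
  have fc: "continuous_on UNIV f" using f1 by (intro DERIV_continuous_on) auto
  note f1M [measurable] = borel_measurable_continuous_onI[OF f1c]
  note f2M [measurable] = borel_measurable_continuous_onI[OF f2c]
  note [measurable] = borel_measurable_continuous_onI[OF fc]
  have EF: "E j \<in> known_at (q j)" if "j \<le> N" for j
    unfolding E_def by (rule euler_adapted[OF g that m(1) s(1)])
  have EM: "E j \<in> borel_measurable M" if "j \<le> N" for j using EF[OF that] filtration_measurableD by blast
  have mM: "m j \<in> borel_measurable M" and sM: "s j \<in> borel_measurable M" and ZM: "Z j \<in> borel_measurable M"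
    if "j < N" for j using m(1)[OF that] s(1)[OF that] Z[OF that] filtration_measurableD by blast+
  have BM: "B j \<in> borel_measurable M" if "j < N" for j
    using W_increment_measurable[of "q j" "q (Suc j)" "q (Suc j)"] st[OF that] filtration_measurableD
    unfolding B_def by auto
  \<comment> \<open>replacing the scheme by \<open>Z\<close> in a bounded and uniformly continuous function costs little in mean;
    the cost matters only at steps where the weights do not vanish\<close>
  have dev: "expectation (\<lambda>\<omega>. act j \<omega> * \<bar>u (E j \<omega>) - u (Z j \<omega>)\<bar>) \<le> (1 + 2 * K) * \<theta>\<^sup>2"
    and dev_int: "integrable M (\<lambda>\<omega>. act j \<omega> * \<bar>u (E j \<omega>) - u (Z j \<omega>)\<bar>)"
    if j: "j < N" and uK: "\<And>x. \<bar>u x\<bar> \<le> K" and um: "\<And>x y. \<bar>x - y\<bar> \<le> \<eta> \<Longrightarrow> \<bar>u x - u y\<bar> \<le> \<theta>\<^sup>2"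
      and [measurable]: "u \<in> borel_measurable borel" for j and u :: "real \<Rightarrow> real"
  proof -
    note [measurable] = mM[OF j] sM[OF j] ZM[OF j]
    have jN: "j \<le> N" using j by simp
    note [measurable] = EM[OF jN]
    define A where "A = {\<omega> \<in> space M. (m j \<omega> \<noteq> 0 \<or> s j \<omega> \<noteq> 0) \<and> \<eta> < \<bar>E j \<omega> - Z j \<omega>\<bar>}"
    have Am [measurable]: "A \<in> sets M" unfolding A_def by measurable
    have Ai: "integrable M (indicator A :: 'a \<Rightarrow> real)"
      by (rule integrable_real_indicator) (auto simp: less_top[symmetric])
    have PA: "prob A \<le> \<theta>\<^sup>2" using close[OF j] unfolding A_def E_def .
    have u2: "\<bar>u x - u y\<bar> \<le> 2 * K" for x y using uK[of x] uK[of y] by linarith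
    show int: "integrable M (\<lambda>\<omega>. act j \<omega> * \<bar>u (E j \<omega>) - u (Z j \<omega>)\<bar>)"
      unfolding act_def by (rule integrable_bounded[of _ "2 * K"]) (use u2 K0 in auto)
    have "expectation (\<lambda>\<omega>. act j \<omega> * \<bar>u (E j \<omega>) - u (Z j \<omega>)\<bar>) \<le> expectation (\<lambda>\<omega>. \<theta>\<^sup>2 + 2 * K * indicator A \<omega>)"
    proof (rule integral_mono[OF int])
      fix \<omega> assume "\<omega> \<in> space M"
      then show "act j \<omega> * \<bar>u (E j \<omega>) - u (Z j \<omega>)\<bar> \<le> \<theta>\<^sup>2 + 2 * K * indicator A \<omega>"
        using um[of "E j \<omega>" "Z j \<omega>"] u2[of "E j \<omega>" "Z j \<omega>"] K0
        by (cases "\<eta> < \<bar>E j \<omega> - Z j \<omega>\<bar>") (auto simp: A_def act_def indicator_def add_increasing)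
    qed (use Ai in auto)
    also have "\<dots> = \<theta>\<^sup>2 + 2 * K * prob A"
      using Ai by (simp add: prob_space)
    also have "\<dots> \<le> \<theta>\<^sup>2 + 2 * K * \<theta>\<^sup>2"
      using PA K0 by (intro add_left_mono mult_left_mono) auto
    finally show "expectation (\<lambda>\<omega>. act j \<omega> * \<bar>u (E j \<omega>) - u (Z j \<omega>)\<bar>) \<le> (1 + 2 * K) * \<theta>\<^sup>2"
      by (simp add: algebra_simps)
  qed
  have D1: "expectation (D1 j) \<le> (1 + 2 * K) * \<theta>\<^sup>2" "integrable M (D1 j)"
    and D2: "expectation (D2 j) \<le> (1 + 2 * K) * \<theta>\<^sup>2" "integrable M (D2 j)" if "j < N" for j
    unfolding D1_def D2_def
    using dev[of _ f1, OF that K(1) mod1 f1M] dev[of _ f2, OF that K(2) mod2 f2M]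
      dev_int[of _ f1, OF that K(1) mod1 f1M] dev_int[of _ f2, OF that K(2) mod2 f2M] by auto
  have D1b: "0 \<le> D1 j \<omega>" "D1 j \<omega> \<le> 2 * K" for j \<omega>
    using K(1)[of "E j \<omega>"] K(1)[of "Z j \<omega>"] K0 unfolding D1_def act_def by auto
  have D1m: "\<bar>(f1 (E j \<omega>) - f1 (Z j \<omega>)) * m j \<omega>\<bar> \<le> K * D1 j \<omega>"
    and D1s: "\<bar>(f1 (E j \<omega>) - f1 (Z j \<omega>)) * s j \<omega>\<bar> \<le> K * D1 j \<omega>"
    and D2s: "\<bar>(f2 (E j \<omega>) - f2 (Z j \<omega>)) * (s j \<omega>)\<^sup>2\<bar> \<le> K\<^sup>2 * D2 j \<omega>"
    if "j < N" "\<omega> \<in> space M" for j \<omega>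
  proof -
    show "\<bar>(f1 (E j \<omega>) - f1 (Z j \<omega>)) * m j \<omega>\<bar> \<le> K * D1 j \<omega>"
      using m(2)[OF that] unfolding D1_def act_def abs_mult by (auto simp: mult.commute intro: mult_right_mono mult_left_mono)
    show "\<bar>(f1 (E j \<omega>) - f1 (Z j \<omega>)) * s j \<omega>\<bar> \<le> K * D1 j \<omega>"
      using s(2)[OF that] unfolding D1_def act_def abs_mult by (auto simp: mult.commute intro: mult_right_mono mult_left_mono)
    have "(s j \<omega>)\<^sup>2 \<le> K\<^sup>2" using s(2)[OF that] by (simp add: abs_le_square_iff[symmetric])
    then show "\<bar>(f2 (E j \<omega>) - f2 (Z j \<omega>)) * (s j \<omega>)\<^sup>2\<bar> \<le> K\<^sup>2 * D2 j \<omega>"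
      unfolding D2_def act_def abs_mult by (auto simp: mult.commute intro: mult_right_mono mult_left_mono)
  qed
  \<comment> \<open>martingale part that comes from evaluating f1 along \<open>Z\<close>\<close>
  define a1 where "a1 j \<omega> = (f1 (E j \<omega>) - f1 (Z j \<omega>)) * s j \<omega>" for j \<omega>
  define M1 where "M1 \<omega> = (\<Sum>j<N. a1 j \<omega> * B j \<omega>)" for \<omega>
  have a1F: "a1 j \<in> known_at (q j)" if "j < N" for j
  proof -
    have jN: "j \<le> N" using that by simp
    note [measurable] = EF[OF jN] Z[OF that] s(1)[OF that]
    show ?thesis unfolding a1_def by measurable
  qed
  have a1b: "\<bar>a1 j \<omega>\<bar> \<le> K * (2 * K)" if "j < N" "\<omega> \<in> space M" for j \<omega>
    using D1s[OF that] mult_left_mono[OF D1b(2)[of j \<omega>] K0] unfolding a1_def by linarith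
  have M1: "integrable M M1" "integrable M (\<lambda>\<omega>. (M1 \<omega>)\<^sup>2)"
    "expectation (\<lambda>\<omega>. (M1 \<omega>)\<^sup>2) = (\<Sum>j<N. expectation (\<lambda>\<omega>. (a1 j \<omega>)\<^sup>2) * d j)"
    using stochastic_sum_moments[OF g order_refl a1F a1b] unfolding M1_def B_def d_def by auto
  have "expectation (\<lambda>\<omega>. (a1 j \<omega>)\<^sup>2) \<le> 2 * K ^ 3 * (1 + 2 * K) * \<theta>\<^sup>2" if j: "j < N" for j
  proof -
    have "expectation (\<lambda>\<omega>. (a1 j \<omega>)\<^sup>2) \<le> expectation (\<lambda>\<omega>. 2 * K ^ 3 * D1 j \<omega>)"
    proof (rule integral_mono)
      have [measurable]: "a1 j \<in> borel_measurable M" using a1F[OF j] filtration_measurableD by blast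
      show "integrable M (\<lambda>\<omega>. (a1 j \<omega>)\<^sup>2)"
      proof (rule integrable_bounded)
        show "\<bar>(a1 j \<omega>)\<^sup>2\<bar> \<le> (K * (2 * K))\<^sup>2" if "\<omega> \<in> space M" for \<omega>
          using a1b[OF j that] K0 by (simp add: abs_le_square_iff[symmetric])
      qed measurable
      show "integrable M (\<lambda>\<omega>. 2 * K ^ 3 * D1 j \<omega>)" using D1[OF j] by auto
      fix \<omega> assume w: "\<omega> \<in> space M"
      have "(a1 j \<omega>)\<^sup>2 = \<bar>a1 j \<omega>\<bar> * \<bar>a1 j \<omega>\<bar>" by (simp add: power2_eq_square)
      also have "\<dots> \<le> (K * D1 j \<omega>) * (K * (2 * K))"
        using D1s[OF j w] a1b[OF j w] K0 D1b(1)[of j \<omega>] unfolding a1_def by (intro mult_mono) auto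
      finally show "(a1 j \<omega>)\<^sup>2 \<le> 2 * K ^ 3 * D1 j \<omega>" by (simp add: power3_eq_cube mult_ac)
    qed
    also have "\<dots> \<le> 2 * K ^ 3 * ((1 + 2 * K) * \<theta>\<^sup>2)"
      using D1[OF j] K0 by (simp add: mult_left_mono)
    finally show ?thesis by (simp add: mult.assoc)
  qed
  then have "expectation (\<lambda>\<omega>. (M1 \<omega>)\<^sup>2) \<le> (2 * K ^ 3 * (1 + 2 * K) * \<theta>\<^sup>2) * T"
    unfolding M1(3) d_def by (rule time_grid_weighted_sum_le[OF g])
  then have EM1: "expectation (\<lambda>\<omega>. \<bar>M1 \<omega>\<bar>) \<le> (1 + T * (2 * K ^ 3 * (1 + 2 * K))) * \<theta>"
    by (intro expectation_abs_le_second_moment M1 \<theta>) (simp add: mult_ac)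
  \<comment> \<open>fluctuation of the quadratic variation\<close>
  define a2 where "a2 j \<omega> = f2 (E j \<omega>) * (s j \<omega>)\<^sup>2 / 2" for j \<omega>
  define M2 where "M2 \<omega> = (\<Sum>j<N. a2 j \<omega> * ((B j \<omega>)\<^sup>2 - d j))" for \<omega>
  have a2F: "a2 j \<in> known_at (q j)" if "j < N" for j
  proof -
    have jN: "j \<le> N" using that by simp
    note [measurable] = EF[OF jN] Z[OF that] s(1)[OF that]
    show ?thesis unfolding a2_def by measurable
  qed
  have a2b: "\<bar>a2 j \<omega>\<bar> \<le> K ^ 3 / 2" if "j < N" "\<omega> \<in> space M" for j \<omega>
  proof -
    have "(s j \<omega>)\<^sup>2 \<le> K\<^sup>2" using s(2)[OF that] by (simp add: abs_le_square_iff[symmetric])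
    then have "\<bar>f2 (E j \<omega>)\<bar> * (s j \<omega>)\<^sup>2 \<le> K * K\<^sup>2"
      using K(2) K0 by (intro mult_mono) auto
    then show ?thesis by (simp add: a2_def abs_mult power3_eq_cube power2_eq_square)
  qed
  have M2: "integrable M M2" "integrable M (\<lambda>\<omega>. (M2 \<omega>)\<^sup>2)"
    "expectation (\<lambda>\<omega>. (M2 \<omega>)\<^sup>2) = (\<Sum>j<N. expectation (\<lambda>\<omega>. (a2 j \<omega>)\<^sup>2) * (2 * (d j)\<^sup>2))"
    using variation_sum_moments[OF g order_refl a2F a2b] unfolding M2_def B_def d_def by auto
  have "expectation (\<lambda>\<omega>. (a2 j \<omega>)\<^sup>2) * (2 * d j) \<le> K ^ 6 / 2 * \<theta>\<^sup>2" if j: "j < N" for j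
  proof -
    have sq: "(a2 j \<omega>)\<^sup>2 \<le> K ^ 6 / 4" if "\<omega> \<in> space M" for \<omega>
    proof -
      have "(a2 j \<omega>)\<^sup>2 \<le> (K ^ 3 / 2)\<^sup>2"
        using a2b[OF j that] K0 by (simp add: abs_le_square_iff[symmetric])
      then show ?thesis by (simp add: power_divide)
    qed
    have "expectation (\<lambda>\<omega>. (a2 j \<omega>)\<^sup>2) \<le> expectation (\<lambda>\<omega>. K ^ 6 / 4)"
    proof (rule integral_mono)
      have [measurable]: "a2 j \<in> borel_measurable M" using a2F[OF j] filtration_measurableD by blast
      show "integrable M (\<lambda>\<omega>. (a2 j \<omega>)\<^sup>2)"
        by (rule integrable_bounded[of _ "K ^ 6 / 4"]) (use sq in auto)
    qed (use sq in auto)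
    then have "expectation (\<lambda>\<omega>. (a2 j \<omega>)\<^sup>2) \<le> K ^ 6 / 4" by (simp add: prob_space)
    moreover have "2 * d j \<le> 2 * \<theta>\<^sup>2"
    proof -
      have "\<theta> ^ 4 = \<theta>\<^sup>2 * \<theta>\<^sup>2" by (simp add: power2_eq_square power4_eq_xxxx)
      also have "\<dots> \<le> 1 * \<theta>\<^sup>2" using \<theta> by (intro mult_right_mono) (auto simp: power_le_one)
      finally show ?thesis using st(4)[OF j] h(1) by simp
    qed
    ultimately have "expectation (\<lambda>\<omega>. (a2 j \<omega>)\<^sup>2) * (2 * d j) \<le> K ^ 6 / 4 * (2 * \<theta>\<^sup>2)"
      using st[OF j] K0 by (intro mult_mono) auto
    then show ?thesis by (simp add: mult.commute)
  qed
  then have "(\<Sum>j<N. expectation (\<lambda>\<omega>. (a2 j \<omega>)\<^sup>2) * (2 * d j) * (q (Suc j) - q j)) \<le> (K ^ 6 / 2 * \<theta>\<^sup>2) * T"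
    by (rule time_grid_weighted_sum_le[OF g])
  then have "expectation (\<lambda>\<omega>. (M2 \<omega>)\<^sup>2) \<le> (K ^ 6 / 2 * \<theta>\<^sup>2) * T"
    unfolding M2(3) d_def[symmetric] by (simp add: power2_eq_square mult_ac)
  then have EM2: "expectation (\<lambda>\<omega>. \<bar>M2 \<omega>\<bar>) \<le> (1 + T * (K ^ 6 / 2)) * \<theta>"
    by (intro expectation_abs_le_second_moment M2 \<theta>) (simp add: mult_ac)
  \<comment> \<open>terms that are negligible without any cancellation\<close>
  define \<Delta> where "\<Delta> j \<omega> = m j \<omega> * d j + s j \<omega> * B j \<omega>" for j \<omega>
  define rem where "rem j \<omega> = f (E (Suc j) \<omega>) - f (E j \<omega>) - f1 (E j \<omega>) * \<Delta> j \<omega> - f2 (E j \<omega>) * (\<Delta> j \<omega>)\<^sup>2 / 2" for j \<omega>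
  define r where "r j \<omega> = d j * ((f1 (E j \<omega>) - f1 (Z j \<omega>)) * m j \<omega>) + d j / 2 * ((f2 (E j \<omega>) - f2 (Z j \<omega>)) * (s j \<omega>)\<^sup>2)
     + f2 (E j \<omega>) / 2 * ((m j \<omega>)\<^sup>2 * (d j)\<^sup>2 + 2 * m j \<omega> * s j \<omega> * d j * B j \<omega>) + rem j \<omega>" for j \<omega>
  have tele: "f (E N \<omega>) - f x0 = (\<Sum>j<N. f (E (Suc j) \<omega>) - f (E j \<omega>))" for \<omega>
    using sum_lessThan_telescope[of "\<lambda>j. f (E j \<omega>)" N] by (simp add: E_def euler_def[of _ _ _ _ 0])
  have decomp: "euler_ito_defect f f1 f2 x0 q N m s Z \<omega> = M1 \<omega> + M2 \<omega> + (\<Sum>j<N. r j \<omega>)" for \<omega>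
  proof -
    have "f (E (Suc j) \<omega>) - f (E j \<omega>) - f1 (Z j \<omega>) * s j \<omega> * B j \<omega>
        - (f1 (Z j \<omega>) * m j \<omega> + f2 (Z j \<omega>) * (s j \<omega>)\<^sup>2 / 2) * d j
      = a1 j \<omega> * B j \<omega> + a2 j \<omega> * ((B j \<omega>)\<^sup>2 - d j) + r j \<omega>" for j
      unfolding r_def rem_def a1_def a2_def \<Delta>_def by (simp add: power2_eq_square field_simps)
    then have "(\<Sum>j<N. f (E (Suc j) \<omega>) - f (E j \<omega>) - f1 (Z j \<omega>) * s j \<omega> * B j \<omega>
        - (f1 (Z j \<omega>) * m j \<omega> + f2 (Z j \<omega>) * (s j \<omega>)\<^sup>2 / 2) * d j)
      = (\<Sum>j<N. a1 j \<omega> * B j \<omega> + a2 j \<omega> * ((B j \<omega>)\<^sup>2 - d j) + r j \<omega>)"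
      by simp
    then show ?thesis
      unfolding euler_ito_defect_def E_def[symmetric] tele M1_def M2_def B_def d_def
      by (simp add: sum.distrib sum_subtractf)
  qed
  define bd where "bd j \<omega> = d j * (K * D1 j \<omega>) + d j / 2 * (K\<^sup>2 * D2 j \<omega>)
      + (K ^ 3 / 2 * (d j)\<^sup>2 + K ^ 3 * d j * (\<theta>\<^sup>2 + (B j \<omega>)\<^sup>2 / \<theta>\<^sup>2))
      + (\<theta>\<^sup>2 * K\<^sup>2 * ((d j)\<^sup>2 + (B j \<omega>)\<^sup>2) + 8 * K ^ 5 * ((d j) ^ 4 + (B j \<omega>) ^ 4) / \<eta>\<^sup>2)" for j \<omega>
  have rbd: "\<bar>r j \<omega>\<bar> \<le> bd j \<omega>" if j: "j < N" and w: "\<omega> \<in> space M" for j \<omega>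
  proof -
    note mw = m(2)[OF j w] and sw = s(2)[OF j w]
    have d0: "0 \<le> d j" using st(3)[OF j] by simp
    have t1: "\<bar>d j * ((f1 (E j \<omega>) - f1 (Z j \<omega>)) * m j \<omega>)\<bar> \<le> d j * (K * D1 j \<omega>)"
      using mult_left_mono[OF D1m[OF j w] d0] d0 by (simp add: abs_mult)
    have t2: "\<bar>d j / 2 * ((f2 (E j \<omega>) - f2 (Z j \<omega>)) * (s j \<omega>)\<^sup>2)\<bar> \<le> d j / 2 * (K\<^sup>2 * D2 j \<omega>)"
      using mult_left_mono[OF D2s[OF j w], of "d j / 2"] d0 by (simp add: abs_mult)
    have Bw: "\<bar>B j \<omega>\<bar> \<le> \<theta>\<^sup>2 + (B j \<omega>)\<^sup>2 / \<theta>\<^sup>2" using abs_le_square_over[of "\<theta>\<^sup>2"] \<theta> by simp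
    have "\<bar>(m j \<omega>)\<^sup>2 * (d j)\<^sup>2 + 2 * m j \<omega> * s j \<omega> * d j * B j \<omega>\<bar>
       \<le> \<bar>(m j \<omega>)\<^sup>2 * (d j)\<^sup>2\<bar> + \<bar>2 * m j \<omega> * s j \<omega> * d j * B j \<omega>\<bar>" by (rule abs_triangle_ineq)
    also have "\<dots> = \<bar>m j \<omega>\<bar> * \<bar>m j \<omega>\<bar> * (d j)\<^sup>2 + 2 * (\<bar>m j \<omega>\<bar> * \<bar>s j \<omega>\<bar> * d j) * \<bar>B j \<omega>\<bar>"
      using d0 by (simp add: abs_mult power2_eq_square)
    also have "\<dots> \<le> K * K * (d j)\<^sup>2 + 2 * (K * K * d j) * (\<theta>\<^sup>2 + (B j \<omega>)\<^sup>2 / \<theta>\<^sup>2)"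
      using mw sw d0 K0 Bw by (intro add_mono mult_mono mult_nonneg_nonneg) auto
    finally have "\<bar>f2 (E j \<omega>)\<bar> / 2 * \<bar>(m j \<omega>)\<^sup>2 * (d j)\<^sup>2 + 2 * m j \<omega> * s j \<omega> * d j * B j \<omega>\<bar>
        \<le> K / 2 * (K * K * (d j)\<^sup>2 + 2 * (K * K * d j) * (\<theta>\<^sup>2 + (B j \<omega>)\<^sup>2 / \<theta>\<^sup>2))"
      using K(2) K0 by (intro mult_mono) auto
    then have "\<bar>f2 (E j \<omega>) / 2\<bar> * \<bar>(m j \<omega>)\<^sup>2 * (d j)\<^sup>2 + 2 * m j \<omega> * s j \<omega> * d j * B j \<omega>\<bar>
       \<le> K ^ 3 / 2 * (d j)\<^sup>2 + K ^ 3 * d j * (\<theta>\<^sup>2 + (B j \<omega>)\<^sup>2 / \<theta>\<^sup>2)"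
      by (simp add: power3_eq_cube field_simps)
    then have t3: "\<bar>f2 (E j \<omega>) / 2 * ((m j \<omega>)\<^sup>2 * (d j)\<^sup>2 + 2 * m j \<omega> * s j \<omega> * d j * B j \<omega>)\<bar>
       \<le> K ^ 3 / 2 * (d j)\<^sup>2 + K ^ 3 * d j * (\<theta>\<^sup>2 + (B j \<omega>)\<^sup>2 / \<theta>\<^sup>2)"
      by (simp only: abs_mult)
    have "\<bar>\<Delta> j \<omega>\<bar> \<le> K * (d j + \<bar>B j \<omega>\<bar>)"
    proof -
      have "\<bar>\<Delta> j \<omega>\<bar> \<le> \<bar>m j \<omega>\<bar> * d j + \<bar>s j \<omega>\<bar> * \<bar>B j \<omega>\<bar>"
        unfolding \<Delta>_def using d0 abs_triangle_ineq[of "m j \<omega> * d j" "s j \<omega> * B j \<omega>"] by (simp add: abs_mult)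
      also have "\<dots> \<le> K * d j + K * \<bar>B j \<omega>\<bar>"
        using mw sw d0 K0 by (intro add_mono mult_right_mono) auto
      finally show ?thesis by (simp add: algebra_simps)
    qed
    then have "(\<Delta> j \<omega>)\<^sup>2 \<le> (K * (d j + \<bar>B j \<omega>\<bar>))\<^sup>2"
      using K0 d0 by (simp add: abs_le_square_iff[symmetric])
    also have "\<dots> = K\<^sup>2 * (d j + \<bar>B j \<omega>\<bar>)\<^sup>2" by (simp add: power_mult_distrib)
    also have "\<dots> \<le> K\<^sup>2 * (2 * ((d j)\<^sup>2 + (B j \<omega>)\<^sup>2))"
      using sum_squares_bound[of "d j" "\<bar>B j \<omega>\<bar>"] by (intro mult_left_mono) (auto simp: power2_sum)
    finally have \<Delta>2: "(\<Delta> j \<omega>)\<^sup>2 \<le> 2 * K\<^sup>2 * ((d j)\<^sup>2 + (B j \<omega>)\<^sup>2)" by (simp add: algebra_simps)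
    have "\<Delta> j \<omega> ^ 4 = ((\<Delta> j \<omega>)\<^sup>2)\<^sup>2" by simp
    also have "\<dots> \<le> (2 * K\<^sup>2 * ((d j)\<^sup>2 + (B j \<omega>)\<^sup>2))\<^sup>2"
      using \<Delta>2 by (intro power_mono) auto
    also have "\<dots> = 4 * K ^ 4 * ((d j)\<^sup>2 + (B j \<omega>)\<^sup>2)\<^sup>2" by (simp add: power_mult_distrib)
    also have "\<dots> \<le> 4 * K ^ 4 * (2 * ((d j) ^ 4 + (B j \<omega>) ^ 4))"
      using sum_squares_bound[of "(d j)\<^sup>2" "(B j \<omega>)\<^sup>2"] by (intro mult_left_mono) (auto simp: power2_sum)
    finally have \<Delta>4: "\<Delta> j \<omega> ^ 4 \<le> 8 * K ^ 4 * ((d j) ^ 4 + (B j \<omega>) ^ 4)" by (simp add: algebra_simps)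
    have "\<bar>rem j \<omega>\<bar> \<le> \<theta>\<^sup>2 / 2 * (\<Delta> j \<omega>)\<^sup>2 + K * \<Delta> j \<omega> ^ 4 / \<eta>\<^sup>2"
      using second_order_taylor_bound[OF f1 f2 K(2) \<eta> _ mod2, of "E j \<omega>" "\<Delta> j \<omega>"]
      unfolding rem_def E_def euler_Suc by (simp add: \<Delta>_def B_def d_def)
    also have "\<dots> \<le> \<theta>\<^sup>2 / 2 * (2 * K\<^sup>2 * ((d j)\<^sup>2 + (B j \<omega>)\<^sup>2)) + K * (8 * K ^ 4 * ((d j) ^ 4 + (B j \<omega>) ^ 4)) / \<eta>\<^sup>2"
      using \<Delta>2 \<Delta>4 K0 by (intro add_mono mult_left_mono divide_right_mono) auto
    also have "K * (8 * K ^ 4 * ((d j) ^ 4 + (B j \<omega>) ^ 4)) = 8 * K ^ 5 * ((d j) ^ 4 + (B j \<omega>) ^ 4)"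
      by (simp add: eval_nat_numeral)
    finally have t4: "\<bar>rem j \<omega>\<bar> \<le> \<theta>\<^sup>2 * K\<^sup>2 * ((d j)\<^sup>2 + (B j \<omega>)\<^sup>2) + 8 * K ^ 5 * ((d j) ^ 4 + (B j \<omega>) ^ 4) / \<eta>\<^sup>2"
      by (simp add: mult.assoc)
    show ?thesis using t1 t2 t3 t4 unfolding r_def bd_def by linarith
  qed
  have Bmom: "integrable M (\<lambda>\<omega>. (B j \<omega>)\<^sup>2)" "integrable M (\<lambda>\<omega>. (B j \<omega>) ^ 4)"
    "expectation (\<lambda>\<omega>. (B j \<omega>)\<^sup>2) = d j" "expectation (\<lambda>\<omega>. (B j \<omega>) ^ 4) = 3 * (d j)\<^sup>2" if "j < N" for j
    using increment_moments[OF st(1,2)[OF that]] unfolding B_def d_def by auto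
  have bdi: "integrable M (bd j)" if j: "j < N" for j
    unfolding bd_def using D1[OF j] D2[OF j] Bmom[OF j] by auto
  have rM: "r j \<in> borel_measurable M" if j: "j < N" for j
  proof -
    have jN: "j \<le> N" "Suc j \<le> N" using j by auto
    note [measurable] = EM[OF jN(1)] EM[OF jN(2)] mM[OF j] sM[OF j] ZM[OF j] BM[OF j]
    show ?thesis unfolding r_def rem_def \<Delta>_def by measurable
  qed
  have ri: "integrable M (r j)" if j: "j < N" for j
    by (rule Bochner_Integration.integrable_bound[OF bdi[OF j] rM[OF j]])
      (use rbd[OF j] in \<open>force intro!: AE_I2\<close>)
  define C where "C = (K + K\<^sup>2 / 2) * (1 + 2 * K) + 5 / 2 * K ^ 3 + 2 * K\<^sup>2 + 32 * K ^ 5"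
  have Er: "expectation (\<lambda>\<omega>. \<bar>r j \<omega>\<bar>) \<le> (C * \<theta>\<^sup>2) * d j" if j: "j < N" for j
  proof -
    have "expectation (\<lambda>\<omega>. \<bar>r j \<omega>\<bar>) \<le> expectation (bd j)"
      using ri[OF j] bdi[OF j] rbd[OF j] by (intro integral_mono) auto
    also have "\<dots> = d j * (K * expectation (D1 j)) + d j / 2 * (K\<^sup>2 * expectation (D2 j))
      + (K ^ 3 / 2 * (d j)\<^sup>2 + K ^ 3 * d j * (\<theta>\<^sup>2 + d j / \<theta>\<^sup>2))
      + (\<theta>\<^sup>2 * K\<^sup>2 * ((d j)\<^sup>2 + d j) + 8 * K ^ 5 * ((d j) ^ 4 + 3 * (d j)\<^sup>2) / \<eta>\<^sup>2)"
      unfolding bd_def using D1[OF j] D2[OF j] Bmom[OF j] by (simp add: prob_space)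
    also have "\<dots> \<le> d j * (K * ((1 + 2 * K) * \<theta>\<^sup>2)) + d j / 2 * (K\<^sup>2 * ((1 + 2 * K) * \<theta>\<^sup>2))
      + (K ^ 3 / 2 * (d j * \<theta>\<^sup>2) + K ^ 3 * d j * (\<theta>\<^sup>2 + \<theta>\<^sup>2))
      + (\<theta>\<^sup>2 * K\<^sup>2 * (d j + d j) + 8 * K ^ 5 * (4 * d j * \<theta>\<^sup>2))"
    proof -
      have d0: "0 \<le> d j" "d j \<le> 1" using st[OF j] by auto
      have "d j \<le> \<theta> ^ 4" using st(4)[OF j] h(1) by simp
      then have d1: "d j / \<theta>\<^sup>2 \<le> \<theta>\<^sup>2"
        using \<theta> by (simp add: divide_le_eq power2_eq_square power4_eq_xxxx)
      moreover have "d j \<le> d j / \<theta>\<^sup>2" using \<theta> d0 by (simp add: le_divide_eq mult_left_le power_le_one)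
      ultimately have d2: "d j \<le> \<theta>\<^sup>2" by simp
      have d3: "(d j)\<^sup>2 \<le> d j" using d0 by (simp add: power2_eq_square mult_left_le)
      have "(d j) ^ 4 \<le> (d j)\<^sup>2" using d0 by (intro power_decreasing) auto
      then have "((d j) ^ 4 + 3 * (d j)\<^sup>2) / \<eta>\<^sup>2 \<le> 4 * (d j)\<^sup>2 / \<eta>\<^sup>2"
        by (intro divide_right_mono) auto
      also have "\<dots> = 4 * d j * (d j / \<eta>\<^sup>2)" by (simp add: power2_eq_square)
      also have "\<dots> \<le> 4 * d j * \<theta>\<^sup>2"
        using st(4)[OF j] h(2) \<eta> d0 by (intro mult_left_mono) (auto simp: divide_le_eq)
      finally have d4: "((d j) ^ 4 + 3 * (d j)\<^sup>2) / \<eta>\<^sup>2 \<le> 4 * d j * \<theta>\<^sup>2" .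
      have d5: "8 * K ^ 5 * ((d j) ^ 4 + 3 * (d j)\<^sup>2) / \<eta>\<^sup>2 \<le> 8 * K ^ 5 * (4 * d j * \<theta>\<^sup>2)"
        using mult_left_mono[OF d4, of "8 * K ^ 5"] K0 by simp
      have d6: "(d j)\<^sup>2 \<le> d j * \<theta>\<^sup>2" using d2 d0 by (simp add: power2_eq_square mult_left_mono)
      show ?thesis
        using D1(1)[OF j] D2(1)[OF j] d0 d1 d3 d5 d6 K0
        by (intro add_mono mult_left_mono d5) auto
    qed
    also have "\<dots> = (C * \<theta>\<^sup>2) * d j" unfolding C_def by (simp add: field_simps)
    finally show ?thesis .
  qed
  show I: "integrable M (euler_ito_defect f f1 f2 x0 q N m s Z)"
    unfolding decomp[abs_def] using M1(1) M2(1) ri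
    by (intro Bochner_Integration.integrable_add Bochner_Integration.integrable_sum) auto
  have "expectation (\<lambda>\<omega>. \<bar>euler_ito_defect f f1 f2 x0 q N m s Z \<omega>\<bar>)
     \<le> expectation (\<lambda>\<omega>. \<bar>M1 \<omega>\<bar> + \<bar>M2 \<omega>\<bar> + (\<Sum>j<N. \<bar>r j \<omega>\<bar>))"
  proof (rule integral_mono)
    show "integrable M (\<lambda>\<omega>. \<bar>M1 \<omega>\<bar> + \<bar>M2 \<omega>\<bar> + (\<Sum>j<N. \<bar>r j \<omega>\<bar>))"
      using M1(1) M2(1) ri
      by (intro Bochner_Integration.integrable_add Bochner_Integration.integrable_sum integrable_abs) auto
    fix \<omega>
    show "\<bar>euler_ito_defect f f1 f2 x0 q N m s Z \<omega>\<bar> \<le> \<bar>M1 \<omega>\<bar> + \<bar>M2 \<omega>\<bar> + (\<Sum>j<N. \<bar>r j \<omega>\<bar>)"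
      unfolding decomp using sum_abs[of "\<lambda>j. r j \<omega>" "{..<N}"] by linarith
  qed (use I in auto)
  also have "\<dots> = expectation (\<lambda>\<omega>. \<bar>M1 \<omega>\<bar>) + expectation (\<lambda>\<omega>. \<bar>M2 \<omega>\<bar>) + (\<Sum>j<N. expectation (\<lambda>\<omega>. \<bar>r j \<omega>\<bar>))"
  proof -
    have i: "integrable M (\<lambda>\<omega>. \<bar>M1 \<omega>\<bar>)" "integrable M (\<lambda>\<omega>. \<bar>M2 \<omega>\<bar>)" "\<And>j. j \<in> {..<N} \<Longrightarrow> integrable M (\<lambda>\<omega>. \<bar>r j \<omega>\<bar>)"
      using M1(1) M2(1) ri by (auto intro!: integrable_abs)
    have i4: "integrable M (\<lambda>\<omega>. \<Sum>j<N. \<bar>r j \<omega>\<bar>)"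
      by (rule Bochner_Integration.integrable_sum) (use i(3) in auto)
    have i5: "expectation (\<lambda>\<omega>. \<Sum>j<N. \<bar>r j \<omega>\<bar>) = (\<Sum>j<N. expectation (\<lambda>\<omega>. \<bar>r j \<omega>\<bar>))"
      by (rule Bochner_Integration.integral_sum) (use i(3) in auto)
    show ?thesis
      by (simp only: Bochner_Integration.integral_add[OF Bochner_Integration.integrable_add[OF i(1,2)] i4]
          Bochner_Integration.integral_add[OF i(1,2)] i5)
  qed
  also have "(\<Sum>j<N. expectation (\<lambda>\<omega>. \<bar>r j \<omega>\<bar>)) \<le> (\<Sum>j<N. (C * \<theta>\<^sup>2) * (q (Suc j) - q j))"
    using Er unfolding d_def by (intro sum_mono) auto
  also have "\<dots> \<le> (C * \<theta>\<^sup>2) * T" by (rule time_grid_weighted_sum_le[OF g]) simp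
  also have "\<dots> \<le> T * C * \<theta>"
  proof -
    have "0 \<le> T" using time_grid_nonneg[OF g, of N] g by (simp add: time_grid_def)
    moreover have "0 \<le> C" unfolding C_def using K0 by simp
    moreover have "\<theta>\<^sup>2 \<le> \<theta>" using \<theta> by (simp add: power2_eq_square mult_left_le)
    ultimately have "(T * C) * \<theta>\<^sup>2 \<le> (T * C) * \<theta>" by (intro mult_left_mono) auto
    then show ?thesis by (simp add: mult_ac)
  qed
  finally show "expectation (\<lambda>\<omega>. \<bar>euler_ito_defect f f1 f2 x0 q N m s Z \<omega>\<bar>)
      \<le> (2 + T * (2 * K ^ 3 * (1 + 2 * K) + K ^ 6 / 2 +
            ((K + K\<^sup>2 / 2) * (1 + 2 * K) + 5 / 2 * K ^ 3 + 2 * K\<^sup>2 + 32 * K ^ 5))) * \<theta>"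
    using EM1 EM2 unfolding C_def[symmetric] by (simp add: algebra_simps)
qed

end

section \<open>Step integrals along a partition\<close>

lemma time_grid_between:
  assumes g: "time_grid q N T h" and "i \<le> N" "j < N" "q i < q (Suc j)"
  shows "q i \<le> q j"
proof -
  have "i < Suc j" using time_grid_mono[OF g, of "Suc j" i] assms by (meson leD leI Suc_leI)
  then show ?thesis using time_grid_mono[OF g, of i j] assms by simp
qed

lemma uniform_time_grid:
  assumes "0 < T" "0 < h"
  obtains q N where "time_grid q N T h"
proof -
  obtain N :: nat where N: "T / h < real N" using reals_Archimedean2 by blast
  then have N0: "0 < real N" using assms by (meson divide_pos_pos less_trans)
  have "time_grid (\<lambda>j. real j * (T / real N)) N T h"
    unfolding time_grid_def
  proof (intro conjI allI impI)
    fix j assume "j < N"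
    show "real j * (T / real N) < real (Suc j) * (T / real N)"
      using N0 assms by (intro mult_strict_right_mono) auto
    have "real (Suc j) * (T / real N) - real j * (T / real N) = T / real N" by (simp add: algebra_simps add_divide_distrib)
    also have "\<dots> \<le> h" using N N0 assms by (simp add: field_simps)
    finally show "real (Suc j) * (T / real N) - real j * (T / real N) \<le> h" .
  qed (use N0 in auto)
  then show ?thesis by (rule that)
qed

lemma time_grid_insert:
  assumes g: "time_grid q N T h" and p: "0 \<le> p" "p \<le> T"
  shows "\<exists>q' N'. time_grid q' N' T h \<and> insert p (q ` {..N}) \<subseteq> q' ` {..N'}"
proof (cases "p \<in> q ` {..N}")
  case True
  then show ?thesis using g by blast
next
  case False
  define j where "j = (GREATEST j. j \<le> N \<and> q j \<le> p)"
  have ex: "0 \<le> N \<and> q 0 \<le> p" using g p by (simp add: time_grid_def)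
  have j: "j \<le> N \<and> q j \<le> p"
    unfolding j_def by (rule GreatestI_nat[of "\<lambda>j. j \<le> N \<and> q j \<le> p", OF ex, of N]) auto
  have "q N = T" using g by (simp add: time_grid_def)
  have jlt: "q j < p" using j False by (metis atMost_iff image_eqI order_le_less)
  have jN: "j < N" using jlt j \<open>q N = T\<close> p by (cases "j = N") auto
  have pj: "p < q (Suc j)"
  proof (rule ccontr)
    assume "\<not> p < q (Suc j)"
    then have "Suc j \<le> j"
      unfolding j_def using jN
      by (intro Greatest_le_nat[of "\<lambda>j. j \<le> N \<and> q j \<le> p" _ N]) (auto simp: j_def)
    then show False by simp
  qed
  define q' where "q' i = (if i \<le> j then q i else if i = Suc j then p else q (i - 1))" for i
  have "time_grid q' (Suc N) T h"
    unfolding time_grid_def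
  proof (intro conjI allI impI)
    show "q' 0 = 0" using g by (simp add: q'_def time_grid_def)
    show "q' (Suc N) = T" using g jN by (auto simp: q'_def time_grid_def)
    fix i assume i: "i < Suc N"
    consider "i < j" | "i = j" | "i = Suc j" | "i > Suc j" by linarith
    then have "q' i < q' (Suc i) \<and> q' (Suc i) - q' i \<le> h"
    proof cases
      case 1
      then show ?thesis using time_grid_step[OF g, of i] jN by (simp add: q'_def)
    next
      case 2
      then show ?thesis using time_grid_step[OF g, of j] jN jlt pj by (simp add: q'_def)
    next
      case 3
      then show ?thesis using time_grid_step[OF g, of j] jN jlt pj by (simp add: q'_def)
    next
      case 4
      then have "i = Suc (i - 1)" by simp
      then show ?thesis using time_grid_step[OF g, of "i - 1"] i 4 by (simp add: q'_def)
    qed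
    then show "q' i < q' (Suc i)" "q' (Suc i) - q' i \<le> h" by auto
  qed
  moreover have "p \<in> q' ` {..Suc N}" using jN by (intro image_eqI[of _ _ "Suc j"]) (auto simp: q'_def)
  moreover have "q i \<in> q' ` {..Suc N}" if "i \<le> N" for i
    using that by (cases "i \<le> j") (auto simp: q'_def intro!: image_eqI[of _ _ "if i \<le> j then i else Suc i"])
  ultimately show ?thesis by (intro exI[of _ q'] exI[of _ "Suc N"]) auto
qed

lemma time_grid_refinement:
  assumes "finite P" "0 < T" "0 < h"
  obtains q N where "time_grid q N T h" "\<And>p. p \<in> P \<Longrightarrow> 0 \<le> p \<Longrightarrow> p \<le> T \<Longrightarrow> \<exists>i\<le>N. q i = p"
proof -
  have "\<exists>q N. time_grid q N T h \<and> (\<forall>p\<in>P. 0 \<le> p \<longrightarrow> p \<le> T \<longrightarrow> (\<exists>i\<le>N. q i = p))"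
    using \<open>finite P\<close>
  proof (induction P)
    case empty
    obtain q N where "time_grid q N T h" using uniform_time_grid[OF assms(2,3)] by blast
    then show ?case by auto
  next
    case (insert r P)
    then obtain q N where q: "time_grid q N T h" "\<forall>p\<in>P. 0 \<le> p \<longrightarrow> p \<le> T \<longrightarrow> (\<exists>i\<le>N. q i = p)" by blast
    show ?case
    proof (cases "0 \<le> r \<and> r \<le> T")
      case True
      obtain q' N' where q': "time_grid q' N' T h" "insert r (q ` {..N}) \<subseteq> q' ` {..N'}"
        using time_grid_insert[OF q(1)] True by blast
      have "\<exists>i\<le>N'. q' i = p" if p: "p \<in> insert r P" "0 \<le> p" "p \<le> T" for p
      proof -
        have "p \<in> insert r (q ` {..N})" using p q(2) by auto
        then have "p \<in> q' ` {..N'}" by (rule subsetD[OF q'(2)])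
        then show ?thesis by auto
      qed
      then show ?thesis using q'(1) by blast
    qed (use q in blast)
  qed
  then show ?thesis using that by blast
qed

text \<open>
  All break points of a step process that lie in \<open>[0, T]\<close> are grid points, so the step process is
  constant on every cell and its Ito integral is a stochastic sum over the grid.
\<close>
definition grid_carries :: "(nat \<Rightarrow> real) \<Rightarrow> nat \<Rightarrow> real \<Rightarrow> nat \<Rightarrow> (nat \<Rightarrow> real) \<Rightarrow> bool" where
  "grid_carries q N T n p \<longleftrightarrow> (\<forall>i\<le>n. 0 \<le> p i \<and> (p i \<le> T \<longrightarrow> (\<exists>j\<le>N. q j = p i)))"

lemma grid_carries_less_iff:
  assumes g: "time_grid q N T h" and c: "grid_carries q N T n p" and "i \<le> n" "j < N"
    and s: "q j < s" "s \<le> q (Suc j)"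
  shows "p i < s \<longleftrightarrow> p i \<le> q j"
proof
  assume "p i < s"
  then have "p i < q (Suc j)" "p i \<le> T" using s time_grid_le[OF g, of "Suc j"] \<open>j < N\<close> by auto
  then show "p i \<le> q j"
    using c \<open>i \<le> n\<close> time_grid_between[OF g _ \<open>j < N\<close>] unfolding grid_carries_def by metis
qed (use s in simp)

lemma step_process_const_on_cell:
  assumes g: "time_grid q N T h" and c: "grid_carries q N T n p" and "j < N"
    and s: "q j < s" "s \<le> q (Suc j)"
  shows "step_process n p \<xi> s \<omega> = step_process n p \<xi> (q (Suc j)) \<omega>"
  unfolding step_process_def
proof (rule sum.cong)
  fix i assume i: "i \<in> {..<n}"
  have "p i < s \<longleftrightarrow> p i < q (Suc j)" "p (Suc i) < s \<longleftrightarrow> p (Suc i) < q (Suc j)"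
    using grid_carries_less_iff[OF g c _ \<open>j < N\<close>, of i] grid_carries_less_iff[OF g c _ \<open>j < N\<close>, of "Suc i"]
      s i time_grid_step(1)[OF g \<open>j < N\<close>] by auto
  then have "s \<in> {p i<..p (Suc i)} \<longleftrightarrow> q (Suc j) \<in> {p i<..p (Suc i)}" by (simp add: not_less[symmetric])
  then show "\<xi> i \<omega> * indicator {p i<..p (Suc i)} s = \<xi> i \<omega> * indicator {p i<..p (Suc i)} (q (Suc j))"
    by (simp add: indicator_def)
qed simp

text \<open>
  Since \<open>p i\<close> does not lie inside a cell, stopping the path w at \<open>p i\<close> deletes the increments of the cells
  after \<open>p i\<close> and leaves the others unchanged.
\<close>
lemma stopped_path_on_grid:
  fixes w :: "real \<Rightarrow> real"
  assumes g: "time_grid q N T h" and c: "grid_carries q N T n p" and "i \<le> n" "l \<le> N"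
  shows "w (min (p i) (q l)) = w 0 + (\<Sum>j<l. (if p i < q (Suc j) then 0 else w (q (Suc j)) - w (q j)))"
  using \<open>l \<le> N\<close>
proof (induction l)
  case 0
  then show ?case using g c \<open>i \<le> n\<close> by (simp add: time_grid_def grid_carries_def)
next
  case (Suc l)
  have st: "q l < q (Suc l)" using time_grid_step(1)[OF g] Suc.prems by simp
  show ?case
  proof (cases "p i < q (Suc l)")
    case True
    then have "p i \<le> q l"
      using grid_carries_less_iff[OF g c \<open>i \<le> n\<close>, of l "q (Suc l)"] Suc.prems st by auto
    then show ?thesis using True Suc by (simp add: min_def)
  next
    case False
    then show ?thesis using Suc st by (simp add: min_def)
  qed
qed

lemma step_integral_on_grid:
  assumes g: "time_grid q N T h" and c: "grid_carries q N T n p" and "l \<le> N"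
    and p: "\<And>i. i < n \<Longrightarrow> p i < p (Suc i)"
  shows "step_integral W n p \<xi> (q l) \<omega> =
    (\<Sum>j<l. step_process n p \<xi> (q (Suc j)) \<omega> * (W (q (Suc j)) \<omega> - W (q j) \<omega>))"
proof -
  have "\<xi> i \<omega> * (W (min (p (Suc i)) (q l)) \<omega> - W (min (p i) (q l)) \<omega>)
     = (\<Sum>j<l. \<xi> i \<omega> * indicator {p i<..p (Suc i)} (q (Suc j)) * (W (q (Suc j)) \<omega> - W (q j) \<omega>))"
    if i: "i < n" for i
  proof -
    have "W (min (p (Suc i)) (q l)) \<omega> - W (min (p i) (q l)) \<omega>
      = (\<Sum>j<l. (if p (Suc i) < q (Suc j) then 0 else W (q (Suc j)) \<omega> - W (q j) \<omega>)
            - (if p i < q (Suc j) then 0 else W (q (Suc j)) \<omega> - W (q j) \<omega>))"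
      using stopped_path_on_grid[OF g c _ \<open>l \<le> N\<close>, of i "\<lambda>t. W t \<omega>"]
        stopped_path_on_grid[OF g c _ \<open>l \<le> N\<close>, of "Suc i" "\<lambda>t. W t \<omega>"] i
      by (simp add: sum_subtractf)
    also have "\<dots> = (\<Sum>j<l. indicator {p i<..p (Suc i)} (q (Suc j)) * (W (q (Suc j)) \<omega> - W (q j) \<omega>))"
      using p[OF i] by (intro sum.cong) (auto simp: indicator_def)
    finally show ?thesis by (simp only: sum_distrib_left mult.assoc)
  qed
  then have "step_integral W n p \<xi> (q l) \<omega> =
    (\<Sum>i<n. \<Sum>j<l. \<xi> i \<omega> * indicator {p i<..p (Suc i)} (q (Suc j)) * (W (q (Suc j)) \<omega> - W (q j) \<omega>))"
    unfolding step_integral_def by simp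
  also have "\<dots> = (\<Sum>j<l. \<Sum>i<n. \<xi> i \<omega> * indicator {p i<..p (Suc i)} (q (Suc j)) * (W (q (Suc j)) \<omega> - W (q j) \<omega>))"
    by (rule sum.swap)
  finally show ?thesis unfolding step_process_def by (simp only: sum_distrib_right)
qed

lemma (in complete_measure) measurable_AE_eq:
  assumes f: "f \<in> M \<rightarrow>\<^sub>M N" and eq: "AE x in M. f x = g x" and g: "\<And>x. x \<in> space M \<Longrightarrow> g x \<in> space N"
  shows "g \<in> M \<rightarrow>\<^sub>M N"
proof (rule measurableI)
  fix A assume "A \<in> sets N"
  show "g -` A \<inter> space M \<in> sets M"
  proof (rule in_sets_AE)
    show "f -` A \<inter> space M \<in> sets M" using f \<open>A \<in> sets N\<close> by (rule measurable_sets)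
    show "AE x in M. x \<in> f -` A \<inter> space M \<longleftrightarrow> x \<in> g -` A \<inter> space M"
      using eq by eventually_elim auto
  qed auto
qed (use g in auto)

text \<open>
  Used to see that suprema over a time interval are measurable.
\<close>
lemma continuous_SUP_eq_rational_SUP:
  fixes u :: "real \<Rightarrow> real"
  assumes "0 < T" and u: "continuous_on {0..T} u"
  shows "(SUP t\<in>{0..T}. ennreal \<bar>u t\<bar>) = (SUP t\<in>{0<..<T} \<inter> \<rat>. ennreal \<bar>u t\<bar>)"
proof (rule antisym)
  show "(SUP t\<in>{0<..<T} \<inter> \<rat>. ennreal \<bar>u t\<bar>) \<le> (SUP t\<in>{0..T}. ennreal \<bar>u t\<bar>)"
    by (rule SUP_subset_mono) auto
  let ?S = "SUP t\<in>{0<..<T} \<inter> \<rat>. ennreal \<bar>u t\<bar>"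
  show "(SUP t\<in>{0..T}. ennreal \<bar>u t\<bar>) \<le> ?S"
  proof (rule SUP_least)
    fix t assume t: "t \<in> {0..T}"
    have cl: "{0..T} \<subseteq> closure ({0<..<T} \<inter> \<rat>)"
    proof -
      have "closure ({0<..<T} \<inter> \<rat>) = closure {0<..<T}"
        using closure_open_Int_superset[of "{0<..<T}" "\<rat>"] Rats_closure_real by auto
      also have "\<dots> = {0..T}" using \<open>0 < T\<close> by simp
      finally show ?thesis by simp
    qed
    then obtain x where x: "\<And>n. x n \<in> {0<..<T} \<inter> \<rat>" "x \<longlonglongrightarrow> t"
      using closure_sequential[of t "{0<..<T} \<inter> \<rat>"] t by (meson subsetD)
    have "x n \<in> {0..T}" for n using x(1)[of n] by auto
    then have "(\<lambda>n. u (x n)) \<longlonglongrightarrow> u t"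
      by (intro continuous_on_tendsto_compose[OF u x(2) t] always_eventually allI)
    then have "(\<lambda>n. ennreal \<bar>u (x n)\<bar>) \<longlonglongrightarrow> ennreal \<bar>u t\<bar>"
      by (intro tendsto_ennrealI tendsto_rabs)
    then show "ennreal \<bar>u t\<bar> \<le> ?S"
      by (rule LIMSEQ_le_const2) (use x(1) in \<open>auto intro!: exI[of _ 0] SUP_upper\<close>)
  qed
qed

lemma (in prob_space) AE_convergent_subsequence:
  fixes Z1 Z2 :: "nat \<Rightarrow> 'a \<Rightarrow> ennreal"
  assumes Z: "tendsto_zero_in_prob M Z1" "tendsto_zero_in_prob M Z2"
    and [measurable]: "\<And>k. Z1 k \<in> borel_measurable M" "\<And>k. Z2 k \<in> borel_measurable M"
  obtains r :: "nat \<Rightarrow> nat" where "AE \<omega> in M. (\<lambda>k. Z1 (r k) \<omega>) \<longlonglongrightarrow> 0" "AE \<omega> in M. (\<lambda>k. Z2 (r k) \<omega>) \<longlonglongrightarrow> 0"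
proof -
  have "\<exists>r. emeasure M {\<omega> \<in> space M. ennreal ((1/2)^k) < Z1 r \<omega>} < ennreal ((1/2)^k) \<and>
         emeasure M {\<omega> \<in> space M. ennreal ((1/2)^k) < Z2 r \<omega>} < ennreal ((1/2)^k)" for k :: nat
  proof -
    have "(\<lambda>r. emeasure M {\<omega> \<in> space M. ennreal ((1/2)^k) < Z1 r \<omega>}) \<longlonglongrightarrow> 0"
      "(\<lambda>r. emeasure M {\<omega> \<in> space M. ennreal ((1/2)^k) < Z2 r \<omega>}) \<longlonglongrightarrow> 0"
      using Z unfolding tendsto_zero_in_prob_def by auto
    from order_tendstoD(2)[OF this(1), of "ennreal ((1/2)^k)"] order_tendstoD(2)[OF this(2), of "ennreal ((1/2)^k)"]
    have "eventually (\<lambda>r. emeasure M {\<omega> \<in> space M. ennreal ((1/2)^k) < Z1 r \<omega>} < ennreal ((1/2)^k) \<and>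
         emeasure M {\<omega> \<in> space M. ennreal ((1/2)^k) < Z2 r \<omega>} < ennreal ((1/2)^k)) sequentially"
      by (intro eventually_conj) (simp_all add: zero_less_power)
    from eventually_happens[OF this] show ?thesis by simp
  qed
  then have "\<exists>r. \<forall>k. emeasure M {\<omega> \<in> space M. ennreal ((1/2)^k) < Z1 (r k) \<omega>} < ennreal ((1/2)^k) \<and>
         emeasure M {\<omega> \<in> space M. ennreal ((1/2)^k) < Z2 (r k) \<omega>} < ennreal ((1/2)^k)"
    by (intro choice allI)
  then obtain r where r: "\<And>k. emeasure M {\<omega> \<in> space M. ennreal ((1/2)^k) < Z1 (r k) \<omega>} < ennreal ((1/2)^k)"
    "\<And>k. emeasure M {\<omega> \<in> space M. ennreal ((1/2)^k) < Z2 (r k) \<omega>} < ennreal ((1/2)^k)"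
    by blast
  have conv: "AE \<omega> in M. (\<lambda>k. Z (r k) \<omega>) \<longlonglongrightarrow> 0"
    if [measurable]: "\<And>k. Z k \<in> borel_measurable M"
      and P: "\<And>k. emeasure M {\<omega> \<in> space M. ennreal ((1/2)^k) < Z (r k) \<omega>} < ennreal ((1/2)^k)"
    for Z :: "nat \<Rightarrow> 'a \<Rightarrow> ennreal"
  proof -
    let ?A = "\<lambda>k. {\<omega> \<in> space M. ennreal ((1/2)^k) < Z (r k) \<omega>}"
    have "AE \<omega> in M. eventually (\<lambda>k. \<omega> \<in> space M - ?A k) sequentially"
    proof (rule borel_cantelli_AE1)
      have le: "prob (?A k) \<le> (1/2)^k" for k
        using P[of k] by (simp add: emeasure_eq_measure ennreal_less_iff less_imp_le)
      show "summable (\<lambda>k. prob (?A k))"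
        by (rule summable_comparison_test'[of "\<lambda>k. (1/2)^k" 0]) (use le in \<open>auto intro: summable_geometric\<close>)
    qed (auto simp: less_top[symmetric])
    then show ?thesis
    proof eventually_elim
      case (elim \<omega>)
      have lim: "(\<lambda>k. ennreal ((1/2)^k)) \<longlonglongrightarrow> 0"
        using tendsto_ennrealI[OF LIMSEQ_power_zero[of "1/2 :: real"]] by simp
      have ev: "eventually (\<lambda>k. Z (r k) \<omega> \<le> ennreal ((1/2)^k)) sequentially"
        using elim by (rule eventually_mono) (simp add: not_less)
      show ?case
        by (rule tendsto_sandwich[OF _ ev tendsto_const lim]) (rule always_eventually, rule allI, rule zero_le)
    qed
  qed
  show ?thesis
    by (rule that[OF conv conv]) (use r in auto)
qed

context brownian_motion
begin

lemma step_process_on_cell_adapted: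
  assumes g: "time_grid q N T h" and c: "grid_carries q N T n p" and "j < N"
    and sd: "step_data M F n p \<xi>"
  shows "step_process n p \<xi> (q (Suc j)) \<in> known_at (q j)"
  unfolding step_process_def
proof (rule borel_measurable_sum)
  fix i assume i: "i \<in> {..<n}"
  have st: "q j < q (Suc j)" using time_grid_step(1)[OF g \<open>j < N\<close>] .
  show "(\<lambda>\<omega>. \<xi> i \<omega> * indicator {p i<..p (Suc i)} (q (Suc j))) \<in> known_at (q j)"
  proof (cases "p i < q (Suc j)")
    case True
    then have "p i \<le> q j" using grid_carries_less_iff[OF g c _ \<open>j < N\<close> st order_refl, of i] i by auto
    then have "ennreal (p i) \<le> ennreal (q j)" by (rule ennreal_leI)
    moreover have "\<xi> i \<in> borel_measurable (F (ennreal (p i)))"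
      using sd i unfolding step_data_def by blast
    ultimately have "\<xi> i \<in> known_at (q j)"
      using filtration_measurable_mono by blast
    then show ?thesis by measurable
  qed simp
qed

lemma step_process_bounded:
  assumes "step_data M F n p \<xi>"
  obtains C where "\<And>s \<omega>. \<omega> \<in> space M \<Longrightarrow> \<bar>step_process n p \<xi> s \<omega>\<bar> \<le> C"
proof -
  have "\<forall>i. \<exists>C. i < n \<longrightarrow> (\<forall>\<omega>\<in>space M. \<bar>\<xi> i \<omega>\<bar> \<le> C)" using assms unfolding step_data_def by blast
  then obtain C where C: "\<And>i \<omega>. i < n \<Longrightarrow> \<omega> \<in> space M \<Longrightarrow> \<bar>\<xi> i \<omega>\<bar> \<le> C i" by metis
  have "\<bar>step_process n p \<xi> s \<omega>\<bar> \<le> (\<Sum>i<n. C i)" if w: "\<omega> \<in> space M" for s \<omega>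
    unfolding step_process_def
  proof (rule order_trans[OF sum_abs], rule sum_mono)
    fix i assume "i \<in> {..<n}"
    then show "\<bar>\<xi> i \<omega> * indicator {p i<..p (Suc i)} s\<bar> \<le> C i"
      using C[OF _ w, of i] by (auto simp: indicator_def abs_mult)
  qed
  then show ?thesis using that by blast
qed

lemma step_data_nonneg:
  assumes sd: "step_data M F n p \<xi>" and "i \<le> n"
  shows "0 \<le> p i"
  using \<open>i \<le> n\<close>
proof (induction i)
  case 0
  then show ?case using sd by (simp add: step_data_def)
next
  case (Suc i)
  then have "p i < p (Suc i)" using sd by (simp add: step_data_def)
  then show ?case using Suc by simp
qed

lemma step_integral_measurable:
  assumes sd: "step_data M F n p \<xi>" and "0 \<le> t"
  shows "step_integral W n p \<xi> t \<in> borel_measurable M"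
  unfolding step_integral_def
proof (rule borel_measurable_sum)
  have pos: "0 \<le> p i" if "i \<le> n" for i by (rule step_data_nonneg[OF sd that])
  fix i assume i: "i \<in> {..<n}"
  have [measurable]: "\<xi> i \<in> borel_measurable M" using sd i filtration_measurableD unfolding step_data_def by blast
  have [measurable]: "W (min (p (Suc i)) t) \<in> borel_measurable M" "W (min (p i) t) \<in> borel_measurable M"
    using W_random_variable pos[of i] pos[of "Suc i"] i \<open>0 \<le> t\<close> by auto
  show "(\<lambda>\<omega>. \<xi> i \<omega> * (W (min (p (Suc i)) t) \<omega> - W (min (p i) t) \<omega>)) \<in> borel_measurable M" by measurable
qed

lemma ito_error_measurable:
  assumes H': "progressive F H'" and HH: "AE \<omega> in M. \<forall>s\<ge>0. H' s \<omega> = H s \<omega>"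
    and sd: "step_data M F n p \<xi>" and "0 \<le> T"
  shows "(\<lambda>\<omega>. \<integral>\<^sup>+s\<in>{0..T}. ennreal ((step_process n p \<xi> s \<omega> - H s \<omega>)\<^sup>2) \<partial>lborel) \<in> borel_measurable M"
proof (rule measurable_AE_eq)
  \<comment> \<open>progressive measurability concerns times up to \<open>T\<close>, so other times are first projected there\<close>
  define cl where "cl s = max 0 (min T s)" for s
  have clT: "cl s \<in> {0..T}" for s using \<open>0 \<le> T\<close> unfolding cl_def by auto
  have cl_id: "cl s = s" if "s \<in> {0..T}" for s using that unfolding cl_def by auto
  have [measurable]: "(\<lambda>(s, \<omega>). step_process n p \<xi> s \<omega>) \<in> borel_measurable (lborel \<Otimes>\<^sub>M M)"
    unfolding step_process_def split_beta'
  proof (rule borel_measurable_sum)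
    fix i assume "i \<in> {..<n}"
    then have [measurable]: "\<xi> i \<in> borel_measurable M"
      using sd filtration_measurableD unfolding step_data_def by blast
    show "(\<lambda>x. \<xi> i (snd x) * indicator {p i<..p (Suc i)} (fst x)) \<in> borel_measurable (lborel \<Otimes>\<^sub>M M)"
      by measurable
  qed
  have 1: "(\<lambda>x. cl (fst x)) \<in> lborel \<Otimes>\<^sub>M M \<rightarrow>\<^sub>M restrict_space borel {0..T}"
    by (rule measurable_restrict_space2) (use clT in \<open>auto simp: cl_def\<close>)
  have 2: "snd \<in> lborel \<Otimes>\<^sub>M M \<rightarrow>\<^sub>M F (ennreal T)"
    using filtration_subalgebra[of "ennreal T"]
    by (intro measurable_compose[OF measurable_snd]) (auto simp: measurable_def subalgebra_def)
  have 3: "(\<lambda>x. H' (fst x) (snd x)) \<in> borel_measurable (restrict_space borel {0..T} \<Otimes>\<^sub>M F (ennreal T))"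
    using H' \<open>0 \<le> T\<close> unfolding progressive_def by (simp add: split_beta')
  have [measurable]: "(\<lambda>(s, \<omega>). H' (cl s) \<omega>) \<in> borel_measurable (lborel \<Otimes>\<^sub>M M)"
    using measurable_compose[OF measurable_Pair[OF 1 2] 3] by (simp add: split_beta')
  show "(\<lambda>\<omega>. \<integral>\<^sup>+s. ennreal ((step_process n p \<xi> s \<omega> - H' (cl s) \<omega>)\<^sup>2) * indicator {0..T} s \<partial>lborel) \<in> borel_measurable M"
    by measurable
  show "AE \<omega> in M. (\<integral>\<^sup>+s. ennreal ((step_process n p \<xi> s \<omega> - H' (cl s) \<omega>)\<^sup>2) * indicator {0..T} s \<partial>lborel)
    = (\<integral>\<^sup>+s\<in>{0..T}. ennreal ((step_process n p \<xi> s \<omega> - H s \<omega>)\<^sup>2) \<partial>lborel)"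
    using HH
  proof eventually_elim
    case (elim \<omega>)
    then show ?case
      using cl_id by (intro nn_integral_cong) (auto simp: indicator_def)
  qed
qed auto

lemma sup_error_measurable:
  assumes I: "adapted F I" "AE \<omega> in M. continuous_on {0..} (\<lambda>t. I t \<omega>)"
    and sd: "step_data M F n p \<xi>" and "0 < T"
  shows "(\<lambda>\<omega>. SUP t\<in>{0..T}. ennreal \<bar>step_integral W n p \<xi> t \<omega> - I t \<omega>\<bar>) \<in> borel_measurable M"
proof (rule measurable_AE_eq)
  show "(\<lambda>\<omega>. SUP t\<in>{0<..<T} \<inter> \<rat>. ennreal \<bar>step_integral W n p \<xi> t \<omega> - I t \<omega>\<bar>) \<in> borel_measurable M"
  proof (rule borel_measurable_SUP)
    show "countable ({0<..<T} \<inter> \<rat>)" by (intro countable_Int2 countable_rat)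
    fix t assume "t \<in> {0<..<T} \<inter> \<rat>"
    then have "0 \<le> t" by auto
    note [measurable] = step_integral_measurable[OF sd this]
    have [measurable]: "I t \<in> borel_measurable M"
      using I(1) \<open>0 \<le> t\<close> filtration_measurableD unfolding adapted_def by blast
    show "(\<lambda>\<omega>. ennreal \<bar>step_integral W n p \<xi> t \<omega> - I t \<omega>\<bar>) \<in> borel_measurable M" by measurable
  qed
  have pos: "0 \<le> p i" if "i \<le> n" for i by (rule step_data_nonneg[OF sd that])
  show "AE \<omega> in M. (SUP t\<in>{0<..<T} \<inter> \<rat>. ennreal \<bar>step_integral W n p \<xi> t \<omega> - I t \<omega>\<bar>)
    = (SUP t\<in>{0..T}. ennreal \<bar>step_integral W n p \<xi> t \<omega> - I t \<omega>\<bar>)"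
    using I(2) bm_continuous
  proof eventually_elim
    case (elim \<omega>)
    have "continuous_on {0..T} (\<lambda>t. W (min (p i) t) \<omega>)" if "i \<le> n" for i
      by (rule continuous_on_compose2[OF elim(2)]) (use pos[OF that] in \<open>auto intro!: continuous_intros\<close>)
    then have "continuous_on {0..T} (\<lambda>t. step_integral W n p \<xi> t \<omega> - I t \<omega>)"
      unfolding step_integral_def
      by (intro continuous_intros continuous_on_subset[OF elim(1)]) auto
    then show ?case by (rule continuous_SUP_eq_rational_SUP[OF \<open>0 < T\<close>, symmetric])
  qed
qed auto

text \<open>
  Along a subsequence the approximations in the definition of the Ito integral converge almost surely.
  Borel-Cantelli applies because the two error functionals are random variables, which follows from the completeness of
  the measure: each is almost surely equal to a functional that is visibly measurable.
\<close>
lemma ito_integral_step_approximation: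
  assumes "has_ito_integral M F W H I" and "0 < T"
  obtains n p \<xi> where "\<And>k. step_data M F (n k) (p k) (\<xi> k)"
    and "AE \<omega> in M. (\<lambda>k. \<integral>\<^sup>+s\<in>{0..T}. ennreal ((step_process (n k) (p k) (\<xi> k) s \<omega> - H s \<omega>)\<^sup>2) \<partial>lborel) \<longlonglongrightarrow> 0"
    and "AE \<omega> in M. (\<lambda>k. SUP t\<in>{0..T}. ennreal \<bar>step_integral W (n k) (p k) (\<xi> k) t \<omega> - I t \<omega>\<bar>) \<longlonglongrightarrow> 0"
proof -
  from assms obtain H' n p \<xi> where H': "progressive F H'" "AE \<omega> in M. \<forall>s\<ge>0. H' s \<omega> = H s \<omega>"
    and I: "adapted F I" "AE \<omega> in M. continuous_on {0..} (\<lambda>t. I t \<omega>)"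
    and sd: "\<And>k. step_data M F (n k) (p k) (\<xi> k)"
    and lim: "\<And>T. 0 \<le> T \<Longrightarrow> tendsto_zero_in_prob M (\<lambda>k \<omega>.
             \<integral>\<^sup>+s\<in>{0..T}. ennreal ((step_process (n k) (p k) (\<xi> k) s \<omega> - H s \<omega>)\<^sup>2) \<partial>lborel)"
        "\<And>T. 0 \<le> T \<Longrightarrow> tendsto_zero_in_prob M (\<lambda>k \<omega>.
             SUP t\<in>{0..T}. ennreal \<bar>step_integral W (n k) (p k) (\<xi> k) t \<omega> - I t \<omega>\<bar>)"
    unfolding has_ito_integral_def by blast
  have T0: "0 \<le> T" using \<open>0 < T\<close> by simp
  define Z1 where "Z1 k \<omega> = (\<integral>\<^sup>+s\<in>{0..T}. ennreal ((step_process (n k) (p k) (\<xi> k) s \<omega> - H s \<omega>)\<^sup>2) \<partial>lborel)" for k \<omega>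
  define Z2 where "Z2 k \<omega> = (SUP t\<in>{0..T}. ennreal \<bar>step_integral W (n k) (p k) (\<xi> k) t \<omega> - I t \<omega>\<bar>)" for k \<omega>
  have "tendsto_zero_in_prob M Z1" "tendsto_zero_in_prob M Z2"
    using lim[OF T0] unfolding Z1_def[abs_def] Z2_def[abs_def] .
  moreover have "Z1 k \<in> borel_measurable M" "Z2 k \<in> borel_measurable M" for k
    using ito_error_measurable[OF H' sd T0, of k] sup_error_measurable[OF I sd \<open>0 < T\<close>, of k]
    unfolding Z1_def[abs_def] Z2_def[abs_def] .
  ultimately obtain r :: "nat \<Rightarrow> nat" where
    r: "AE \<omega> in M. (\<lambda>k. Z1 (r k) \<omega>) \<longlonglongrightarrow> 0" "AE \<omega> in M. (\<lambda>k. Z2 (r k) \<omega>) \<longlonglongrightarrow> 0"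
    using AE_convergent_subsequence by blast
  show ?thesis
    using that[of "\<lambda>k. n (r k)" "\<lambda>k. p (r k)" "\<lambda>k. \<xi> (r k)", OF sd] r unfolding Z1_def Z2_def by blast
qed

end

section \<open>Closeness of the Euler scheme to the solution\<close>

lemma riemann_sum_error:
  fixes y :: "real \<Rightarrow> real"
  assumes y: "continuous_on {0..b} y" and g: "time_grid q N T h" and "l \<le> N" "q l \<le> b"
    and osc: "\<And>s r. s \<in> {0..b} \<Longrightarrow> r \<in> {0..b} \<Longrightarrow> \<bar>s - r\<bar> \<le> h \<Longrightarrow> \<bar>y s - y r\<bar> \<le> \<epsilon>"
  shows "\<bar>(\<Sum>j<l. y (q j) * (q (Suc j) - q j)) - (LBINT s:{0..q l}. y s)\<bar> \<le> \<epsilon> * q l"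
proof -
  have LB: "(LBINT s:{0..t}. y s) = integral {0..t} y" if "t \<le> b" for t
    by (rule set_borel_integral_eq_integral(2)[OF borel_integrable_atLeastAtMost'])
      (use y that in \<open>auto elim: continuous_on_subset\<close>)
  have "\<bar>(\<Sum>j<l. y (q j) * (q (Suc j) - q j)) - integral {0..q l} y\<bar> \<le> \<epsilon> * q l"
    using \<open>l \<le> N\<close> \<open>q l \<le> b\<close>
  proof (induction l)
    case 0
    then show ?case using g by (simp add: time_grid_def)
  next
    case (Suc l)
    have st: "0 \<le> q l" "q l < q (Suc l)" "q (Suc l) - q l \<le> h"
      using time_grid_nonneg[OF g, of l] time_grid_step[OF g, of l] Suc.prems by auto
    have IH: "\<bar>(\<Sum>j<l. y (q j) * (q (Suc j) - q j)) - integral {0..q l} y\<bar> \<le> \<epsilon> * q l"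
      using Suc st by auto
    have yc: "continuous_on {q l..q (Suc l)} y" "continuous_on {0..q (Suc l)} y"
      using y st Suc.prems by (auto elim!: continuous_on_subset)
    have "integral {0..q l} y + integral {q l..q (Suc l)} y = integral {0..q (Suc l)} y"
      using st integrable_continuous_interval[OF yc(2)]
      by (intro Henstock_Kurzweil_Integration.integral_combine) auto
    moreover have "norm (integral {q l..q (Suc l)} (\<lambda>s. y (q l) - y s)) \<le> \<epsilon> * (q (Suc l) - q l)"
      by (rule integral_bound)
        (use st Suc.prems yc osc in \<open>auto intro!: continuous_intros\<close>)
    moreover have "integral {q l..q (Suc l)} (\<lambda>s. y (q l) - y s)
        = y (q l) * (q (Suc l) - q l) - integral {q l..q (Suc l)} y"
      using integrable_continuous_interval[OF yc(1)] st
      by (subst Henstock_Kurzweil_Integration.integral_diff) auto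
    ultimately show ?case using IH by (simp add: algebra_simps)
  qed
  then show ?thesis using LB[OF \<open>q l \<le> b\<close>] by simp
qed

lemma sum_cell_nn_integral:
  assumes g: "time_grid q N T h" and "l \<le> N" and [measurable]: "G \<in> borel_measurable borel"
  shows "(\<Sum>j<l. \<integral>\<^sup>+s\<in>{q j<..q (Suc j)}. G s \<partial>lborel) = (\<integral>\<^sup>+s\<in>{0<..q l}. G s \<partial>lborel)"
  using \<open>l \<le> N\<close>
proof (induction l)
  case 0
  then show ?case using g by (simp add: time_grid_def)
next
  case (Suc l)
  have st: "0 \<le> q l" "q l < q (Suc l)"
    using time_grid_nonneg[OF g, of l] time_grid_step[OF g, of l] Suc.prems by auto
  have "(\<integral>\<^sup>+s\<in>{0<..q (Suc l)}. G s \<partial>lborel) =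
     (\<integral>\<^sup>+s. G s * indicator {0<..q l} s + G s * indicator {q l<..q (Suc l)} s \<partial>lborel)"
    using st by (intro nn_integral_cong) (auto simp: indicator_def)
  also have "\<dots> = (\<integral>\<^sup>+s\<in>{0<..q l}. G s \<partial>lborel) + (\<integral>\<^sup>+s\<in>{q l<..q (Suc l)}. G s \<partial>lborel)"
    by (rule nn_integral_add) auto
  finally show ?case using Suc by simp
qed

lemma square_diff_le_two_squares: "(a - c)\<^sup>2 \<le> 2 * (a - b)\<^sup>2 + 2 * (b - c :: real)\<^sup>2"
proof -
  have "0 \<le> ((a - b) - (b - c))\<^sup>2" by simp
  then show ?thesis by (simp add: power2_eq_square algebra_simps)
qed

text \<open>
  The integrand H follows y and jumps to 0 at time b.  On a cell that starts before b, the value of y at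
  its left end is close to H, except within distance h after the jump, where the error is bounded by K.
\<close>
lemma grid_square_error:
  fixes y \<phi> H :: "real \<Rightarrow> real" and c :: "nat \<Rightarrow> real"
  assumes g: "time_grid q N T h" and y: "continuous_on {0..b} y" and "b \<le> T"
    and osc: "\<And>s r. s \<in> {0..b} \<Longrightarrow> r \<in> {0..b} \<Longrightarrow> \<bar>s - r\<bar> \<le> h \<Longrightarrow> \<bar>y s - y r\<bar> \<le> \<epsilon>"
    and K: "\<And>s. s \<in> {0..b} \<Longrightarrow> \<bar>y s\<bar> \<le> K" and "0 \<le> K" "0 \<le> \<epsilon>" "0 \<le> h"
    and H: "\<And>s. s \<in> {0..T} \<Longrightarrow> H s = (if s \<le> b then y s else 0)"
    and \<phi>: "\<And>j s. j < N \<Longrightarrow> q j < s \<Longrightarrow> s \<le> q (Suc j) \<Longrightarrow> \<phi> s = \<phi> (q (Suc j))"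
    and \<phi>m [measurable]: "\<phi> \<in> borel_measurable borel"
    and c: "\<And>j. j < N \<Longrightarrow> c j = 0 \<or> c j = 1 \<and> q j \<le> b"
  shows "ennreal (\<Sum>j<N. (c j * y (q j) - c j * \<phi> (q (Suc j)))\<^sup>2 * (q (Suc j) - q j))
    \<le> ennreal (2 * \<epsilon>\<^sup>2 * T + 2 * K\<^sup>2 * h) + 2 * (\<integral>\<^sup>+s\<in>{0..T}. ennreal ((\<phi> s - H s)\<^sup>2) \<partial>lborel)"
proof -
  define Y where "Y s = (if s \<in> {0..b} then y s else 0)" for s
  have [measurable]: "Y \<in> borel_measurable borel"
  proof -
    have "Y = (\<lambda>s. indicator {0..b} s *\<^sub>R y s)" by (auto simp: Y_def fun_eq_iff indicator_def)
    then show ?thesis using borel_measurable_continuous_on_indicator[OF _ y] by simp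
  qed
  have HY: "H s = Y s" if "s \<in> {0..T}" for s using H[OF that] that unfolding Y_def by auto
  have T0: "0 \<le> T" using time_grid_nonneg[OF g, of N] g by (simp add: time_grid_def)
  define G where "G s = (ennreal (2 * \<epsilon>\<^sup>2) + ennreal (2 * K\<^sup>2) * indicator {b..b + h} s) + 2 * ennreal ((\<phi> s - Y s)\<^sup>2)" for s
  have [measurable]: "G \<in> borel_measurable borel" unfolding G_def by measurable
  have cell: "ennreal ((c j * y (q j) - c j * \<phi> (q (Suc j)))\<^sup>2 * (q (Suc j) - q j))
      \<le> (\<integral>\<^sup>+s\<in>{q j<..q (Suc j)}. G s \<partial>lborel)" if j: "j < N" for j
  proof (cases "c j = 0")
    case False
    then have cj: "c j = 1" "q j \<le> b" using c[OF j] by auto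
    have st: "0 \<le> q j" "q j < q (Suc j)" "q (Suc j) - q j \<le> h" "q (Suc j) \<le> T"
      using time_grid_nonneg[OF g, of j] time_grid_step[OF g j] time_grid_le[OF g, of "Suc j"] j by auto
    have "ennreal ((c j * y (q j) - c j * \<phi> (q (Suc j)))\<^sup>2 * (q (Suc j) - q j))
      = (\<integral>\<^sup>+s\<in>{q j<..q (Suc j)}. ennreal ((y (q j) - \<phi> (q (Suc j)))\<^sup>2) \<partial>lborel)"
      using st cj by (subst nn_integral_cmult_indicator) (auto simp: ennreal_mult'')
    also have "\<dots> \<le> (\<integral>\<^sup>+s\<in>{q j<..q (Suc j)}. G s \<partial>lborel)"
    proof (rule nn_integral_mono, goal_cases)
      case (1 s)
      show ?case
      proof (cases "s \<in> {q j<..q (Suc j)}")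
        case True
        then have s: "q j < s" "s \<le> q (Suc j)" by auto
        have yY: "(y (q j) - Y s)\<^sup>2 \<le> \<epsilon>\<^sup>2 + K\<^sup>2 * indicator {b..b + h} s"
        proof (cases "s \<le> b")
          case True
          then have "\<bar>y (q j) - y s\<bar> \<le> \<epsilon>" using s st by (intro osc) auto
          then have "(y (q j) - y s)\<^sup>2 \<le> \<epsilon>\<^sup>2" using \<open>0 \<le> \<epsilon>\<close> by (simp add: abs_le_square_iff[symmetric])
          then show ?thesis using True s st by (simp add: Y_def add_increasing2)
        next
          case False
          then have "indicator {b..b + h} s = (1::real)" using s st cj by (auto simp: indicator_def)
          moreover have "(y (q j))\<^sup>2 \<le> K\<^sup>2"
            using K[of "q j"] st cj \<open>0 \<le> K\<close> by (simp add: abs_le_square_iff[symmetric])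
          ultimately show ?thesis using False by (simp add: Y_def add_increasing)
        qed
        have "(y (q j) - \<phi> (q (Suc j)))\<^sup>2 \<le> 2 * (y (q j) - Y s)\<^sup>2 + 2 * (Y s - \<phi> s)\<^sup>2"
          using square_diff_le_two_squares[of "y (q j)" "\<phi> s" "Y s"] \<phi>[OF j s] by simp
        also have "\<dots> \<le> (2 * \<epsilon>\<^sup>2 + 2 * K\<^sup>2 * indicator {b..b + h} s) + 2 * (\<phi> s - Y s)\<^sup>2"
          using yY by (simp add: power2_commute)
        finally have "ennreal ((y (q j) - \<phi> (q (Suc j)))\<^sup>2)
          \<le> ennreal ((2 * \<epsilon>\<^sup>2 + 2 * K\<^sup>2 * indicator {b..b + h} s) + 2 * (\<phi> s - Y s)\<^sup>2)"
          by (rule ennreal_leI)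
        also have "\<dots> = G s"
          unfolding G_def by (simp add: ennreal_plus ennreal_mult indicator_def)
        finally show ?thesis using True by simp
      qed simp
    qed
    finally show ?thesis .
  qed simp
  have "ennreal (\<Sum>j<N. (c j * y (q j) - c j * \<phi> (q (Suc j)))\<^sup>2 * (q (Suc j) - q j))
     = (\<Sum>j<N. ennreal ((c j * y (q j) - c j * \<phi> (q (Suc j)))\<^sup>2 * (q (Suc j) - q j)))"
    using time_grid_step(1)[OF g] by (intro sum_ennreal[symmetric]) (simp add: less_imp_le)
  also have "\<dots> \<le> (\<Sum>j<N. \<integral>\<^sup>+s\<in>{q j<..q (Suc j)}. G s \<partial>lborel)"
    using cell by (intro sum_mono) auto
  also have "\<dots> = (\<integral>\<^sup>+s\<in>{0<..T}. G s \<partial>lborel)"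
    using sum_cell_nn_integral[OF g order_refl, of G] g by (simp add: time_grid_def)
  also have "\<dots> \<le> (\<integral>\<^sup>+s. (ennreal (2 * \<epsilon>\<^sup>2) * indicator {0..T} s + ennreal (2 * K\<^sup>2) * indicator {b..b + h} s)
      + 2 * (ennreal ((\<phi> s - Y s)\<^sup>2) * indicator {0..T} s) \<partial>lborel)"
    unfolding G_def by (intro nn_integral_mono) (auto simp: indicator_def)
  also have "\<dots> = (ennreal (2 * \<epsilon>\<^sup>2) * ennreal T + ennreal (2 * K\<^sup>2) * ennreal h)
      + 2 * (\<integral>\<^sup>+s\<in>{0..T}. ennreal ((\<phi> s - Y s)\<^sup>2) \<partial>lborel)"
    using T0 \<open>0 \<le> h\<close> by (simp add: nn_integral_add nn_integral_cmult nn_integral_cmult_indicator)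
  also have "(\<integral>\<^sup>+s\<in>{0..T}. ennreal ((\<phi> s - Y s)\<^sup>2) \<partial>lborel) = (\<integral>\<^sup>+s\<in>{0..T}. ennreal ((\<phi> s - H s)\<^sup>2) \<partial>lborel)"
    using HY by (intro nn_integral_cong) (auto simp: indicator_def)
  also have "ennreal (2 * \<epsilon>\<^sup>2) * ennreal T + ennreal (2 * K\<^sup>2) * ennreal h = ennreal (2 * \<epsilon>\<^sup>2 * T + 2 * K\<^sup>2 * h)"
    using T0 \<open>0 \<le> h\<close> by (simp add: ennreal_mult'' ennreal_plus)
  finally show ?thesis .
qed

lemma (in prob_space) AE_tendsto_zero_imp_tail_tendsto_zero:
  fixes Z :: "nat \<Rightarrow> 'a \<Rightarrow> real"
  assumes [measurable]: "\<And>k. Z k \<in> borel_measurable M" and Z: "AE \<omega> in M. (\<lambda>k. Z k \<omega>) \<longlonglongrightarrow> 0" and "0 < \<epsilon>"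
  shows "(\<lambda>k. prob {\<omega> \<in> space M. \<epsilon> < Z k \<omega>}) \<longlonglongrightarrow> 0"
proof -
  have "(\<lambda>k. expectation (indicator {\<omega> \<in> space M. \<epsilon> < Z k \<omega>} :: 'a \<Rightarrow> real)) \<longlonglongrightarrow> expectation (\<lambda>_. 0)"
  proof (rule integral_dominated_convergence[where w = "\<lambda>_. 1"])
    show "AE \<omega> in M. (\<lambda>k. indicator {\<omega> \<in> space M. \<epsilon> < Z k \<omega>} \<omega> :: real) \<longlonglongrightarrow> 0"
      using Z
    proof eventually_elim
      case (elim \<omega>)
      then have "eventually (\<lambda>k. Z k \<omega> < \<epsilon>) sequentially" using \<open>0 < \<epsilon>\<close> by (rule order_tendstoD)
      then have "eventually (\<lambda>k. indicator {\<omega> \<in> space M. \<epsilon> < Z k \<omega>} \<omega> = (0::real)) sequentially"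
        by (rule eventually_mono) auto
      then show ?case by (rule tendsto_eventually)
    qed
  qed auto
  then show ?thesis by simp
qed

text \<open>
  The Ito equation with drift \<open>\<mu>\<close> and diffusion \<open>\<sigma>\<close> up to a stopping time \<open>\<rho>\<close>.  The process X is
  defined and adapted at all times, but it solves the equation only up to \<open>\<rho>\<close>.
\<close>

locale localized_sde = brownian_motion M F W
  for M :: "'a measure" and F :: "ennreal \<Rightarrow> 'a measure" and W :: "real \<Rightarrow> 'a \<Rightarrow> real" +
  fixes X H I :: "real \<Rightarrow> 'a \<Rightarrow> real" and \<mu> \<sigma> :: "real \<Rightarrow> real" and x0 :: real and \<rho> :: "'a \<Rightarrow> ennreal"
  assumes X_adapted: "adapted F X"
    and \<rho>_stopping: "stopping_time F \<rho>"
    and coefficients_continuous: "continuous_on UNIV \<mu>" "continuous_on UNIV \<sigma>"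
    and H_integral: "has_ito_integral M F W H I"
    and H_eq: "AE \<omega> in M. \<forall>s\<ge>0. H s \<omega> = (if ennreal s \<le> \<rho> \<omega> then \<sigma> (X s \<omega>) else 0)"
    and X_continuous: "AE \<omega> in M. continuous_on {t. 0 \<le> t \<and> ennreal t \<le> \<rho> \<omega>} (\<lambda>t. X t \<omega>)"
    and X_equation: "AE \<omega> in M. \<forall>t\<ge>0. ennreal t \<le> \<rho> \<omega> \<longrightarrow>
      X t \<omega> = x0 + (LBINT s:{0..t}. \<mu> (X s \<omega>)) + I t \<omega>"
begin

text \<open>
  The switch of the Euler scheme: up to and including time \<open>q j\<close> the process has been seen in \<open>[-R, R]\<close>
  at all grid points, and \<open>\<rho>\<close> has not been reached.  The strict inequality for \<open>\<rho>\<close> makes the switch adapted.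
\<close>
definition active :: "real \<Rightarrow> (nat \<Rightarrow> real) \<Rightarrow> nat \<Rightarrow> 'a \<Rightarrow> real" where
  "active R q j \<omega> = (if (\<forall>i\<le>j. \<bar>X (q i) \<omega>\<bar> \<le> R) \<and> ennreal (q j) < \<rho> \<omega> then 1 else 0)"

definition drift :: "real \<Rightarrow> (nat \<Rightarrow> real) \<Rightarrow> nat \<Rightarrow> 'a \<Rightarrow> real" where
  "drift R q j \<omega> = active R q j \<omega> * \<mu> (X (q j) \<omega>)"

definition diffusion :: "real \<Rightarrow> (nat \<Rightarrow> real) \<Rightarrow> nat \<Rightarrow> 'a \<Rightarrow> real" where
  "diffusion R q j \<omega> = active R q j \<omega> * \<sigma> (X (q j) \<omega>)"

lemma X_measurable: "0 \<le> s \<Longrightarrow> s \<le> t \<Longrightarrow> X s \<in> known_at t"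
  using X_adapted unfolding adapted_def by (meson ennreal_leI filtration_measurable_mono)

lemma X_random_variable: "0 \<le> s \<Longrightarrow> X s \<in> borel_measurable M"
  using X_measurable[of s s] filtration_measurableD by blast

lemma active_adapted:
  assumes g: "time_grid q N T h" and "j \<le> N"
  shows "active R q j \<in> known_at (q j)"
proof -
  have [measurable]: "X (q i) \<in> known_at (q j)" if "i \<le> j" for i
    using time_grid_nonneg[OF g, of i] time_grid_mono[OF g that] that \<open>j \<le> N\<close> by (intro X_measurable) auto
  have [measurable]: "Measurable.pred (F (ennreal (q j))) (\<lambda>\<omega>. ennreal (q j) < \<rho> \<omega>)"
    by (rule stopping_timeD2[OF \<rho>_stopping])
  have "Measurable.pred (F (ennreal (q j))) (\<lambda>\<omega>. \<forall>i\<in>{..j}. \<bar>X (q i) \<omega>\<bar> \<le> R)"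
    by (rule pred_intros_finite) auto
  then have [measurable]: "Measurable.pred (F (ennreal (q j))) (\<lambda>\<omega>. \<forall>i\<le>j. \<bar>X (q i) \<omega>\<bar> \<le> R)" by simp
  show ?thesis unfolding active_def by measurable
qed

lemma coefficients_adapted:
  assumes g: "time_grid q N T h" and "j \<le> N"
  shows "drift R q j \<in> known_at (q j)"
  and "diffusion R q j \<in> known_at (q j)"
proof -
  note [measurable] = borel_measurable_continuous_onI[OF coefficients_continuous(1)]
    borel_measurable_continuous_onI[OF coefficients_continuous(2)] active_adapted[OF assms]
    X_measurable[OF time_grid_nonneg[OF g \<open>j \<le> N\<close>] order_refl]
  show "drift R q j \<in> known_at (q j)"
    and "diffusion R q j \<in> known_at (q j)"
    unfolding drift_def diffusion_def by measurable
qed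

lemma active_01: "active R q j \<omega> = 0 \<or> active R q j \<omega> = 1"
  by (simp add: active_def)

lemma active_bound: "active R q j \<omega> = 1 \<Longrightarrow> \<bar>X (q j) \<omega>\<bar> \<le> R \<and> ennreal (q j) < \<rho> \<omega>"
  by (auto simp: active_def split: if_splits)

lemma active_antimono:
  assumes g: "time_grid q N T h" and "active R q l \<omega> = 1" "j \<le> l" "l \<le> N"
  shows "active R q j \<omega> = 1"
proof -
  have "ennreal (q j) \<le> ennreal (q l)" using time_grid_mono[OF g] assms by (intro ennreal_leI) auto
  then show ?thesis using assms by (auto simp: active_def split: if_splits)
qed

lemma coefficients_locally_bounded:
  obtains K where "1 \<le> K" "\<And>x. \<bar>x\<bar> \<le> R \<Longrightarrow> \<bar>\<mu> x\<bar> \<le> K" "\<And>x. \<bar>x\<bar> \<le> R \<Longrightarrow> \<bar>\<sigma> x\<bar> \<le> K"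
proof -
  have "compact (\<mu> ` {-R..R})" "compact (\<sigma> ` {-R..R})"
    using coefficients_continuous by (auto intro!: compact_continuous_image elim: continuous_on_subset)
  then have "bounded (\<mu> ` {-R..R})" "bounded (\<sigma> ` {-R..R})" by (auto intro: compact_imp_bounded)
  then obtain K1 K2 where K: "\<And>x. x \<in> {-R..R} \<Longrightarrow> \<bar>\<mu> x\<bar> \<le> K1" "\<And>x. x \<in> {-R..R} \<Longrightarrow> \<bar>\<sigma> x\<bar> \<le> K2"
    unfolding bounded_iff by fastforce
  have "\<bar>\<mu> x\<bar> \<le> max 1 (max K1 K2)" "\<bar>\<sigma> x\<bar> \<le> max 1 (max K1 K2)" if "\<bar>x\<bar> \<le> R" for x
    using K[of x] that by (auto simp: abs_le_iff)
  then show ?thesis by (intro that[of "max 1 (max K1 K2)"]) auto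
qed

lemma coefficients_bounded:
  assumes "0 \<le> K" "\<And>x. \<bar>x\<bar> \<le> R \<Longrightarrow> \<bar>\<mu> x\<bar> \<le> K" "\<And>x. \<bar>x\<bar> \<le> R \<Longrightarrow> \<bar>\<sigma> x\<bar> \<le> K"
  shows "\<bar>drift R q j \<omega>\<bar> \<le> K" "\<bar>diffusion R q j \<omega>\<bar> \<le> K"
  using assms active_bound[of R q j \<omega>] active_01[of R q j \<omega>] by (auto simp: drift_def diffusion_def)

text \<open>
  The times of \<open>[0, T]\<close> before or at \<open>\<rho>\<close> form a compact interval, on which paths are uniformly continuous.
\<close>
lemma path_window:
  assumes "0 < T"
  defines "b \<equiv> \<lambda>\<omega>. enn2real (min (\<rho> \<omega>) (ennreal T))"
  shows "0 \<le> b \<omega>" "b \<omega> \<le> T" "\<And>t. t \<in> {0..T} \<Longrightarrow> t \<le> b \<omega> \<longleftrightarrow> ennreal t \<le> \<rho> \<omega>"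
proof -
  have fin: "min (\<rho> \<omega>) (ennreal T) < top" by (simp add: min_less_iff_disj)
  have eq: "ennreal (b \<omega>) = min (\<rho> \<omega>) (ennreal T)" unfolding b_def using fin by simp
  show b0: "0 \<le> b \<omega>" unfolding b_def by simp
  have "ennreal (b \<omega>) \<le> ennreal T" unfolding eq by simp
  then show "b \<omega> \<le> T" using \<open>0 < T\<close> by (simp add: ennreal_le_iff)
  fix t assume t: "t \<in> {0..T}"
  have "t \<le> b \<omega> \<longleftrightarrow> ennreal t \<le> ennreal (b \<omega>)" using b0 by (simp add: ennreal_le_iff)
  also have "\<dots> \<longleftrightarrow> ennreal t \<le> \<rho> \<omega>" unfolding eq using t by (simp add: ennreal_leI)
  finally show "t \<le> b \<omega> \<longleftrightarrow> ennreal t \<le> \<rho> \<omega>" .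
qed

text \<open>
  The k-th grid refines the break points of the k-th approximating step process.  While the switch is
  on, the scheme differs from X by three errors: the Riemann sum of the drift and the error of the
  approximating step integrals, which both vanish pathwise, and a stochastic sum whose weights are the
  differences a between the diffusion coefficient and the step process.  Its quadratic variation Y vanishes pathwise, and the Lenglart
  inequality converts this into smallness in probability, uniformly over the grid points.
\<close>
lemma euler_close_to_solution:
  assumes "0 < T" "0 < h" "0 < \<epsilon>" "0 < \<eta>"
  shows "\<exists>q N. time_grid q N T h \<and> (\<forall>l\<le>N.
    prob {\<omega> \<in> space M. active R q l \<omega> = 1 \<and>
      \<epsilon> < \<bar>euler x0 q (drift R q) (diffusion R q) l \<omega> - X (q l) \<omega>\<bar>} \<le> \<eta>)"
proof -
  obtain n p \<xi> where sd: "\<And>k. step_data M F (n k) (p k) (\<xi> k)"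
    and Z1: "AE \<omega> in M. (\<lambda>k. \<integral>\<^sup>+s\<in>{0..T}. ennreal ((step_process (n k) (p k) (\<xi> k) s \<omega> - H s \<omega>)\<^sup>2) \<partial>lborel) \<longlonglongrightarrow> 0"
    and Z2: "AE \<omega> in M. (\<lambda>k. SUP t\<in>{0..T}. ennreal \<bar>step_integral W (n k) (p k) (\<xi> k) t \<omega> - I t \<omega>\<bar>) \<longlonglongrightarrow> 0"
    using ito_integral_step_approximation[OF H_integral \<open>0 < T\<close>] by blast
  define hh where "hh k = h / real (Suc k)" for k
  have hpos: "0 < hh k" for k using \<open>0 < h\<close> by (simp add: hh_def)
  have hlim: "hh \<longlonglongrightarrow> 0"
    unfolding hh_def divide_inverse by (rule tendsto_mult_right_zero[OF LIMSEQ_inverse_real_of_nat])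
  have "\<exists>q N. time_grid q N T (hh k) \<and> grid_carries q N T (n k) (p k)" for k
  proof -
    obtain q N where "time_grid q N T (hh k)" "\<And>r. r \<in> p k ` {..n k} \<Longrightarrow> 0 \<le> r \<Longrightarrow> r \<le> T \<Longrightarrow> \<exists>i\<le>N. q i = r"
      using time_grid_refinement[of "p k ` {..n k}" T "hh k"] \<open>0 < T\<close> hpos by auto
    then show ?thesis
      using step_data_nonneg[OF sd[of k]] unfolding grid_carries_def by (intro exI[of _ q] exI[of _ N]) auto
  qed
  then obtain q N where g: "\<And>k. time_grid (q k) (N k) T (hh k)" and gc: "\<And>k. grid_carries (q k) (N k) T (n k) (p k)"
    by metis
  define Xi where "Xi k j \<omega> = step_process (n k) (p k) (\<xi> k) (q k (Suc j)) \<omega>" for k j \<omega>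
  define c where "c k j \<omega> = active R (q k) j \<omega>" for k j \<omega>
  define a where "a k j \<omega> = diffusion R (q k) j \<omega> - c k j \<omega> * Xi k j \<omega>" for k j \<omega>
  define E where "E k l \<omega> = euler x0 (q k) (drift R (q k)) (diffusion R (q k)) l \<omega>" for k l \<omega>
  define S where "S k l \<omega> = (\<Sum>j<l. a k j \<omega> * (dW (q k) j \<omega>))" for k l \<omega>
  define Y where "Y k \<omega> = (\<Sum>j<N k. (a k j \<omega>)\<^sup>2 * (q k (Suc j) - q k j))" for k \<omega>
  define D where "D k \<omega> = Max ((\<lambda>l. \<bar>c k l \<omega> * (E k l \<omega> - X (q k l) \<omega> - S k l \<omega>)\<bar>) ` {..N k})" for k \<omega>
  obtain K where K: "1 \<le> K" "\<And>x. \<bar>x\<bar> \<le> R \<Longrightarrow> \<bar>\<mu> x\<bar> \<le> K" "\<And>x. \<bar>x\<bar> \<le> R \<Longrightarrow> \<bar>\<sigma> x\<bar> \<le> K"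
    using coefficients_locally_bounded by blast
  have K0: "0 \<le> K" using K(1) by simp
  have aF: "a k j \<in> known_at (q k j)" if "j < N k" for k j
  proof -
    have jN: "j \<le> N k" using that by simp
    note [measurable] = coefficients_adapted(2)[OF g jN] active_adapted[OF g jN]
      step_process_on_cell_adapted[OF g gc that sd]
    show ?thesis unfolding a_def c_def Xi_def by measurable
  qed
  have aM: "a k j \<in> borel_measurable M" if "j < N k" for k j using aF[OF that] filtration_measurableD by blast
  have ab: "\<exists>B. \<forall>j<N k. \<forall>\<omega>\<in>space M. \<bar>a k j \<omega>\<bar> \<le> B" for k
  proof -
    obtain C where C: "\<And>s \<omega>. \<omega> \<in> space M \<Longrightarrow> \<bar>step_process (n k) (p k) (\<xi> k) s \<omega>\<bar> \<le> C"
      using step_process_bounded[OF sd] by blast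
    have "\<bar>a k j \<omega>\<bar> \<le> K + \<bar>C\<bar>" if "\<omega> \<in> space M" for j \<omega>
    proof -
      have "\<bar>c k j \<omega> * Xi k j \<omega>\<bar> \<le> \<bar>C\<bar>"
        using C[OF that, of "q k (Suc j)"] active_01[of R "q k" j \<omega>] unfolding c_def Xi_def by auto
      then show ?thesis using coefficients_bounded(2)[where R = R and q = "q k" and j = j and \<omega> = \<omega>, OF K0 K(2,3)] unfolding a_def by linarith
    qed
    then show ?thesis by blast
  qed
  have YM: "Y k \<in> borel_measurable M" for k
    unfolding Y_def using aM by (intro borel_measurable_sum) auto
  have SM: "S k l \<in> borel_measurable M" if "l \<le> N k" for k l
    using adapted_transform_sum[OF g that aF, of "\<lambda>_ x. x"] filtration_measurableD unfolding S_def by auto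
  have EM: "E k l \<in> borel_measurable M" if "l \<le> N k" for k l
  proof -
    have "euler x0 (q k) (drift R (q k)) (diffusion R (q k)) l \<in> known_at (q k l)"
      by (rule euler_adapted[OF g that]) (auto intro!: coefficients_adapted[OF g])
    then show ?thesis using filtration_measurableD unfolding E_def by auto
  qed
  have cM: "c k l \<in> borel_measurable M" if "l \<le> N k" for k l
    using active_adapted[OF g that] filtration_measurableD unfolding c_def by blast
  have XM: "X (q k l) \<in> borel_measurable M" if "l \<le> N k" for k l
    using X_random_variable time_grid_nonneg[OF g that] by blast
  have DM: "D k \<in> borel_measurable M" for k
    unfolding D_def using SM EM cM XM by (intro borel_measurable_Max) auto
  \<comment> \<open>\<open>D\<close> collects the two errors that are not stochastic sums; both it and \<open>Y\<close> vanish along almost every path\<close>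
  have "AE \<omega> in M. (\<lambda>k. Y k \<omega>) \<longlonglongrightarrow> 0 \<and> (\<lambda>k. D k \<omega>) \<longlonglongrightarrow> 0"
    using Z1 Z2 H_eq X_continuous X_equation AE_space
  proof eventually_elim
    case (elim \<omega>)
    define b where "b = enn2real (min (\<rho> \<omega>) (ennreal T))"
    note b = path_window[where \<omega> = \<omega>, OF \<open>0 < T\<close>, folded b_def]
    have xc: "continuous_on {0..b} (\<lambda>t. X t \<omega>)"
    proof (rule continuous_on_subset[OF elim(4)])
      show "{0..b} \<subseteq> {t. 0 \<le> t \<and> ennreal t \<le> \<rho> \<omega>}"
      proof
        fix t assume "t \<in> {0..b}"
        then show "t \<in> {t. 0 \<le> t \<and> ennreal t \<le> \<rho> \<omega>}" using b(3)[of t] b(2) by auto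
      qed
    qed
    have yc: "continuous_on {0..b} (\<lambda>t. \<mu> (X t \<omega>))" "continuous_on {0..b} (\<lambda>t. \<sigma> (X t \<omega>))"
      using continuous_on_compose2[OF coefficients_continuous(1) xc] continuous_on_compose2[OF coefficients_continuous(2) xc] by auto
    have uc: "\<exists>d>0. \<forall>s\<in>{0..b}. \<forall>r\<in>{0..b}. \<bar>s - r\<bar> < d \<longrightarrow> \<bar>y s - y r\<bar> \<le> e"
      if "continuous_on {0..b} y" "0 < e" for y and e :: real
    proof -
      have "uniformly_continuous_on {0..b} y" using that(1) by (intro compact_uniformly_continuous) auto
      then obtain d where "d > 0" "\<forall>s\<in>{0..b}. \<forall>r\<in>{0..b}. dist r s < d \<longrightarrow> dist (y r) (y s) < e"
        using \<open>0 < e\<close> unfolding uniformly_continuous_on_def by metis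
      then show ?thesis by (intro exI[of _ d]) (auto simp: dist_real_def abs_minus_commute less_imp_le)
    qed
    obtain K' where K': "\<And>s. s \<in> {0..b} \<Longrightarrow> \<bar>\<sigma> (X s \<omega>)\<bar> \<le> K'" "0 \<le> K'"
    proof -
      have "bounded ((\<lambda>t. \<sigma> (X t \<omega>)) ` {0..b})"
        using yc(2) by (intro compact_imp_bounded compact_continuous_image) auto
      then obtain B where "\<And>s. s \<in> {0..b} \<Longrightarrow> \<bar>\<sigma> (X s \<omega>)\<bar> \<le> B" unfolding bounded_iff by fastforce
      then show ?thesis by (intro that[of "max B 0"]) (auto simp: le_max_iff_disj)
    qed
    have grid_b: "q k j \<le> b" if "c k j \<omega> = 1" "j \<le> N k" for k j

      using active_bound[where R = R and q = "q k" and j = j and \<omega> = \<omega>] that b(3)[of "q k j"] time_grid_nonneg[OF g that(2)] time_grid_le[OF g that(2)]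
      unfolding c_def by auto
    have Y: "(\<lambda>k. Y k \<omega>) \<longlonglongrightarrow> 0"
    proof (rule LIMSEQ_I)
      fix e :: real assume "0 < e"
      define e' where "e' = sqrt (e / (8 * T))"
      have e': "0 < e'" "2 * e'\<^sup>2 * T = e / 4" using \<open>0 < e\<close> \<open>0 < T\<close> by (auto simp: e'_def)
      obtain d where d: "d > 0" "\<And>s r. s \<in> {0..b} \<Longrightarrow> r \<in> {0..b} \<Longrightarrow> \<bar>s - r\<bar> < d \<Longrightarrow> \<bar>\<sigma> (X s \<omega>) - \<sigma> (X r \<omega>)\<bar> \<le> e'"
        using uc[OF yc(2) e'(1)] by blast
      have "(\<lambda>k. 2 * K'\<^sup>2 * hh k) \<longlonglongrightarrow> 2 * K'\<^sup>2 * 0" by (intro tendsto_intros hlim)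
      then have ev1: "eventually (\<lambda>k. 2 * K'\<^sup>2 * hh k < e / 4) sequentially"
        using \<open>0 < e\<close> by (intro order_tendstoD(2)) auto
      have ev2: "eventually (\<lambda>k. hh k < d) sequentially" using hlim d(1) by (intro order_tendstoD(2))
      have ev3: "eventually (\<lambda>k. (\<integral>\<^sup>+s\<in>{0..T}. ennreal ((step_process (n k) (p k) (\<xi> k) s \<omega> - H s \<omega>)\<^sup>2) \<partial>lborel)
          < ennreal (e / 8)) sequentially"
        using elim(1) \<open>0 < e\<close> by (intro order_tendstoD(2)) auto
      have "eventually (\<lambda>k. norm (Y k \<omega> - 0) < e) sequentially"
        using ev1 ev2 ev3
      proof eventually_elim
        case (elim k)
        have "ennreal (\<Sum>j<N k. (c k j \<omega> * \<sigma> (X (q k j) \<omega>) - c k j \<omega> * step_process (n k) (p k) (\<xi> k) (q k (Suc j)) \<omega>)\<^sup>2 * (q k (Suc j) - q k j))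
          \<le> ennreal (2 * e'\<^sup>2 * T + 2 * K'\<^sup>2 * hh k) +
              2 * (\<integral>\<^sup>+s\<in>{0..T}. ennreal ((step_process (n k) (p k) (\<xi> k) s \<omega> - H s \<omega>)\<^sup>2) \<partial>lborel)"
        proof (rule grid_square_error[OF g yc(2) b(2)])
          show "\<bar>\<sigma> (X s \<omega>) - \<sigma> (X r \<omega>)\<bar> \<le> e'" if "s \<in> {0..b}" "r \<in> {0..b}" "\<bar>s - r\<bar> \<le> hh k" for s r
            using d(2)[OF that(1,2)] that(3) elim(2) by simp
          show "H s \<omega> = (if s \<le> b then \<sigma> (X s \<omega>) else 0)" if "s \<in> {0..T}" for s
            using \<open>\<forall>s\<ge>0. H s \<omega> = (if ennreal s \<le> \<rho> \<omega> then \<sigma> (X s \<omega>) else 0)\<close> that b(3)[OF that] by auto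
          show "step_process (n k) (p k) (\<xi> k) s \<omega> = step_process (n k) (p k) (\<xi> k) (q k (Suc j)) \<omega>"
            if "j < N k" "q k j < s" "s \<le> q k (Suc j)" for j s
            by (rule step_process_const_on_cell[OF g gc that])
          show "(\<lambda>s. step_process (n k) (p k) (\<xi> k) s \<omega>) \<in> borel_measurable borel"
            unfolding step_process_def by measurable
          show "c k j \<omega> = 0 \<or> c k j \<omega> = 1 \<and> q k j \<le> b" if "j < N k" for j
            using grid_b[of k j] active_01[of R "q k" j \<omega>] that unfolding c_def by auto
        qed (use K' e' hpos[of k] in auto)
        also have "\<dots> \<le> ennreal (2 * e'\<^sup>2 * T + 2 * K'\<^sup>2 * hh k) + 2 * ennreal (e / 8)"
          using elim(3) by (intro add_left_mono mult_left_mono) auto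
        also have "\<dots> = ennreal (e / 4 + 2 * K'\<^sup>2 * hh k + e / 4)"
        proof -
          have "2 * ennreal (e / 8) = ennreal 2 * ennreal (e / 8)" by simp
          also have "\<dots> = ennreal (e / 4)" using \<open>0 < e\<close> by (subst ennreal_mult[symmetric]) auto
          finally have "2 * ennreal (e / 8) = ennreal (e / 4)" .
          moreover have "0 \<le> e / 4 + 2 * K'\<^sup>2 * hh k" using \<open>0 < e\<close> hpos[of k] by simp
          ultimately show ?thesis
            unfolding e'(2) using \<open>0 < e\<close> by (simp only: ennreal_plus[of "e / 4 + 2 * K'\<^sup>2 * hh k" "e / 4"])
        qed
        finally have "ennreal (Y k \<omega>) \<le> ennreal (e / 4 + 2 * K'\<^sup>2 * hh k + e / 4)"
          unfolding Y_def a_def diffusion_def c_def[symmetric] Xi_def .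
        then have "Y k \<omega> \<le> e / 4 + 2 * K'\<^sup>2 * hh k + e / 4"
          using \<open>0 < e\<close> hpos[of k] by (subst (asm) ennreal_le_iff) (auto intro!: add_nonneg_nonneg mult_nonneg_nonneg less_imp_le)
        moreover have "0 \<le> Y k \<omega>"
          unfolding Y_def using time_grid_step(1)[OF g] by (intro sum_nonneg mult_nonneg_nonneg) (auto simp: less_imp_le)
        ultimately show ?case using elim(1) \<open>0 < e\<close> by simp
      qed
      then show "\<exists>no. \<forall>k\<ge>no. norm (Y k \<omega> - 0) < e" by (simp add: eventually_sequentially)
    qed
    have D: "(\<lambda>k. D k \<omega>) \<longlonglongrightarrow> 0"
    proof (rule LIMSEQ_I)
      fix e :: real assume "0 < e"
      define e' where "e' = e / (4 * T)"
      have e': "0 < e'" "e' * T = e / 4" using \<open>0 < e\<close> \<open>0 < T\<close> by (auto simp: e'_def)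
      obtain d where d: "d > 0" "\<And>s r. s \<in> {0..b} \<Longrightarrow> r \<in> {0..b} \<Longrightarrow> \<bar>s - r\<bar> < d \<Longrightarrow> \<bar>\<mu> (X s \<omega>) - \<mu> (X r \<omega>)\<bar> \<le> e'"
        using uc[OF yc(1) e'(1)] by blast
      have ev2: "eventually (\<lambda>k. hh k < d) sequentially" using hlim d(1) by (intro order_tendstoD(2))
      have ev3: "eventually (\<lambda>k. (SUP t\<in>{0..T}. ennreal \<bar>step_integral W (n k) (p k) (\<xi> k) t \<omega> - I t \<omega>\<bar>)
          < ennreal (e / 4)) sequentially"
        using elim(2) \<open>0 < e\<close> by (intro order_tendstoD(2)) auto
      have "eventually (\<lambda>k. norm (D k \<omega> - 0) < e) sequentially"
        using ev2 ev3
      proof eventually_elim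
        case (elim k)
        have each: "\<bar>c k l \<omega> * (E k l \<omega> - X (q k l) \<omega> - S k l \<omega>)\<bar> \<le> e / 2" if l: "l \<le> N k" for l
        proof (cases "c k l \<omega> = 1")
          case True
          have ql: "q k l \<in> {0..T}" "q k l \<le> b" "ennreal (q k l) \<le> \<rho> \<omega>"
            using time_grid_nonneg[OF g l] time_grid_le[OF g l] grid_b[OF True l] b(3)[of "q k l"] by auto
          have c1: "c k j \<omega> = 1" if "j < l" for j
            using active_antimono[where R = R and l = l and \<omega> = \<omega> and j = j, OF g[of k]] True that l unfolding c_def by auto
          have Xq: "X (q k l) \<omega> = x0 + (LBINT s:{0..q k l}. \<mu> (X s \<omega>)) + I (q k l) \<omega>"
            using \<open>\<forall>t\<ge>0. ennreal t \<le> \<rho> \<omega> \<longrightarrow> X t \<omega> = x0 + (LBINT s:{0..t}. \<mu> (X s \<omega>)) + I t \<omega>\<close> ql by auto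
          have si: "step_integral W (n k) (p k) (\<xi> k) (q k l) \<omega> = (\<Sum>j<l. Xi k j \<omega> * (dW (q k) j \<omega>))"
            unfolding Xi_def using sd[of k]
            by (intro step_integral_on_grid[OF g gc l]) (auto simp: step_data_def)
          have "E k l \<omega> - S k l \<omega> = x0 + (\<Sum>j<l. \<mu> (X (q k j) \<omega>) * (q k (Suc j) - q k j))
             + step_integral W (n k) (p k) (\<xi> k) (q k l) \<omega>"
            unfolding E_def S_def euler_def si a_def drift_def diffusion_def c_def[symmetric]
            using c1 by (simp add: left_diff_distrib sum_subtractf)
          then have "E k l \<omega> - X (q k l) \<omega> - S k l \<omega> =
            ((\<Sum>j<l. \<mu> (X (q k j) \<omega>) * (q k (Suc j) - q k j)) - (LBINT s:{0..q k l}. \<mu> (X s \<omega>)))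
             + (step_integral W (n k) (p k) (\<xi> k) (q k l) \<omega> - I (q k l) \<omega>)"
            unfolding Xq by simp
          moreover have "\<bar>(\<Sum>j<l. \<mu> (X (q k j) \<omega>) * (q k (Suc j) - q k j)) - (LBINT s:{0..q k l}. \<mu> (X s \<omega>))\<bar> \<le> e' * q k l"
          proof (rule riemann_sum_error[OF yc(1) g l ql(2)])
            show "\<bar>\<mu> (X s \<omega>) - \<mu> (X r \<omega>)\<bar> \<le> e'" if "s \<in> {0..b}" "r \<in> {0..b}" "\<bar>s - r\<bar> \<le> hh k" for s r
              using d(2)[OF that(1,2)] that(3) elim(1) by simp
          qed
          moreover have "e' * q k l \<le> e / 4"
            using mult_left_mono[of "q k l" T e'] ql e' by auto
          moreover have "\<bar>step_integral W (n k) (p k) (\<xi> k) (q k l) \<omega> - I (q k l) \<omega>\<bar> \<le> e / 4"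
          proof -
            have "ennreal \<bar>step_integral W (n k) (p k) (\<xi> k) (q k l) \<omega> - I (q k l) \<omega>\<bar>
              \<le> (SUP t\<in>{0..T}. ennreal \<bar>step_integral W (n k) (p k) (\<xi> k) t \<omega> - I t \<omega>\<bar>)"
              using ql(1) by (rule SUP_upper)
            also have "\<dots> \<le> ennreal (e / 4)" using elim(2) by simp
            finally show ?thesis using \<open>0 < e\<close> by (simp add: ennreal_le_iff)
          qed
          ultimately have "\<bar>E k l \<omega> - X (q k l) \<omega> - S k l \<omega>\<bar> \<le> e / 2" by linarith
          then show ?thesis using True by simp
        next
          case False
          then have "c k l \<omega> = 0" using active_01[of R "q k" l \<omega>] unfolding c_def by auto
          then show ?thesis using \<open>0 < e\<close> by simp
        qed
        have "D k \<omega> \<le> e / 2" unfolding D_def using each by (subst Max_le_iff) auto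
        moreover have "0 \<le> D k \<omega>"
          unfolding D_def by (rule order_trans[OF abs_ge_zero Max_ge]) auto
        ultimately show ?case using \<open>0 < e\<close> by simp
      qed
      then show "\<exists>no. \<forall>k\<ge>no. norm (D k \<omega> - 0) < e" by (simp add: eventually_sequentially)
    qed
    show ?case using Y D by blast
  qed
  then have YD: "AE \<omega> in M. (\<lambda>k. Y k \<omega>) \<longlonglongrightarrow> 0" "AE \<omega> in M. (\<lambda>k. D k \<omega>) \<longlonglongrightarrow> 0" by auto
  \<comment> \<open>the level for which the second term of the Lenglart inequality at \<open>\<epsilon> / 2\<close> is \<open>\<eta> / 4\<close>\<close>
  define \<delta> where "\<delta> = \<eta> / 4 * (\<epsilon> / 2)\<^sup>2"
  have \<delta>: "0 < \<delta>" "\<delta> / (\<epsilon> / 2)\<^sup>2 = \<eta> / 4" using assms by (auto simp: \<delta>_def)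
  have "eventually (\<lambda>k. prob {\<omega> \<in> space M. \<delta> < Y k \<omega>} < \<eta> / 4) sequentially"
    "eventually (\<lambda>k. prob {\<omega> \<in> space M. \<epsilon> / 2 < D k \<omega>} < \<eta> / 4) sequentially"
    using order_tendstoD(2)[OF AE_tendsto_zero_imp_tail_tendsto_zero[OF YM YD(1) \<delta>(1)], of "\<eta> / 4"]
      order_tendstoD(2)[OF AE_tendsto_zero_imp_tail_tendsto_zero[OF DM YD(2), of "\<epsilon> / 2"], of "\<eta> / 4"] assms
    by auto
  then have "eventually (\<lambda>k. prob {\<omega> \<in> space M. \<delta> < Y k \<omega>} < \<eta> / 4 \<and> prob {\<omega> \<in> space M. \<epsilon> / 2 < D k \<omega>} < \<eta> / 4) sequentially"
    by (rule eventually_conj)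
  then obtain k where k: "prob {\<omega> \<in> space M. \<delta> < Y k \<omega>} < \<eta> / 4" "prob {\<omega> \<in> space M. \<epsilon> / 2 < D k \<omega>} < \<eta> / 4"
    using eventually_happens[of _ sequentially] by auto
  have gk: "time_grid (q k) (N k) T h"
  proof -
    have "hh k \<le> h" using \<open>0 < h\<close> by (simp add: hh_def divide_le_eq)
    then show ?thesis using g[of k] unfolding time_grid_def by fastforce
  qed
  have "prob {\<omega> \<in> space M. c k l \<omega> = 1 \<and> \<epsilon> < \<bar>E k l \<omega> - X (q k l) \<omega>\<bar>} \<le> \<eta>" if l: "l \<le> N k" for l
  proof -
    note [measurable] = SM[OF l] EM[OF l] cM[OF l] XM[OF l] YM[of k] DM[of k]
    obtain B where B: "\<And>j \<omega>. j < N k \<Longrightarrow> \<omega> \<in> space M \<Longrightarrow> \<bar>a k j \<omega>\<bar> \<le> B" using ab by blast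
    have "{\<omega> \<in> space M. c k l \<omega> = 1 \<and> \<epsilon> < \<bar>E k l \<omega> - X (q k l) \<omega>\<bar>}
      \<subseteq> {\<omega> \<in> space M. \<epsilon> / 2 < D k \<omega>} \<union> {\<omega> \<in> space M. \<epsilon> / 2 < \<bar>S k l \<omega>\<bar>}"
    proof
      fix \<omega> assume w: "\<omega> \<in> {\<omega> \<in> space M. c k l \<omega> = 1 \<and> \<epsilon> < \<bar>E k l \<omega> - X (q k l) \<omega>\<bar>}"
      have "\<bar>c k l \<omega> * (E k l \<omega> - X (q k l) \<omega> - S k l \<omega>)\<bar> \<le> D k \<omega>"
        unfolding D_def using l by (intro Max_ge) auto
      then show "\<omega> \<in> {\<omega> \<in> space M. \<epsilon> / 2 < D k \<omega>} \<union> {\<omega> \<in> space M. \<epsilon> / 2 < \<bar>S k l \<omega>\<bar>}"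
        using w by auto
    qed
    then have "prob {\<omega> \<in> space M. c k l \<omega> = 1 \<and> \<epsilon> < \<bar>E k l \<omega> - X (q k l) \<omega>\<bar>}
      \<le> prob ({\<omega> \<in> space M. \<epsilon> / 2 < D k \<omega>} \<union> {\<omega> \<in> space M. \<epsilon> / 2 < \<bar>S k l \<omega>\<bar>})"
      by (intro finite_measure_mono) auto
    also have "\<dots> \<le> prob {\<omega> \<in> space M. \<epsilon> / 2 < D k \<omega>} + prob {\<omega> \<in> space M. \<epsilon> / 2 < \<bar>S k l \<omega>\<bar>}"
      by (intro measure_Un_le) auto
    also have "prob {\<omega> \<in> space M. \<epsilon> / 2 < \<bar>S k l \<omega>\<bar>} \<le> prob {\<omega> \<in> space M. \<delta> < Y k \<omega>} + \<delta> / (\<epsilon> / 2)\<^sup>2"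
      unfolding S_def Y_def
      by (rule stochastic_sum_tail_bound[OF g l aF B]) (use \<delta> assms in auto)
    finally show ?thesis using k \<delta>(2) \<open>0 < \<eta>\<close> by simp
  qed
  then show ?thesis
    using gk unfolding c_def E_def by blast
qed

end

section \<open>Consequences of the Ito formula for the solution\<close>

definition test_function :: "(real \<Rightarrow> real) \<Rightarrow> (real \<Rightarrow> real) \<Rightarrow> (real \<Rightarrow> real) \<Rightarrow> real \<Rightarrow> bool" where
  "test_function f f1 f2 C \<longleftrightarrow>
     (\<forall>x. (f has_real_derivative f1 x) (at x)) \<and> (\<forall>x. (f1 has_real_derivative f2 x) (at x)) \<and>
     uniformly_continuous_on UNIV f1 \<and> uniformly_continuous_on UNIV f2 \<and>
     (\<forall>x. \<bar>f1 x\<bar> \<le> C \<and> \<bar>f2 x\<bar> \<le> C)"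

lemma test_functionD:
  assumes "test_function f f1 f2 C"
  shows "(f has_real_derivative f1 x) (at x)" "(f1 has_real_derivative f2 x) (at x)"
    "uniformly_continuous_on UNIV f1" "uniformly_continuous_on UNIV f2"
    "\<bar>f1 x\<bar> \<le> C" "\<bar>f2 x\<bar> \<le> C"
  using assms unfolding test_function_def by auto

context localized_sde
begin

abbreviation euler_X :: "real \<Rightarrow> (nat \<Rightarrow> real) \<Rightarrow> nat \<Rightarrow> 'a \<Rightarrow> real" where
  "euler_X R q \<equiv> euler x0 q (drift R q) (diffusion R q)"

abbreviation defect_X where
  "defect_X f f1 f2 R q N \<equiv> euler_ito_defect f f1 f2 x0 q N (drift R q) (diffusion R q) (\<lambda>j. X (q j))"

text \<open>
  The grid on which the scheme is close enough to X also carries an Ito formula whose error is small in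
  mean; at time T the scheme may then be replaced by X itself.
\<close>
lemma ito_formula_on_grids:
  fixes f f1 f2 :: "real \<Rightarrow> real"
  assumes tf: "test_function f f1 f2 C"
    and pos: "0 < T" "0 < h" "0 < e"
  obtains q N where "time_grid q N T h"
    "integrable M (defect_X f f1 f2 R q N)"
    "expectation (\<lambda>\<omega>. \<bar>defect_X f f1 f2 R q N \<omega>\<bar>) \<le> e"
    "prob {\<omega> \<in> space M. active R q N \<omega> = 1 \<and> e < \<bar>euler_X R q N \<omega> - X T \<omega>\<bar>} \<le> e"
proof -
  note f1 = test_functionD(1)[OF tf] and f2 = test_functionD(2)[OF tf]
    and uc = test_functionD(3,4)[OF tf] and C = test_functionD(5,6)[OF tf]
  obtain K0 where K0: "1 \<le> K0" "\<And>x. \<bar>x\<bar> \<le> R \<Longrightarrow> \<bar>\<mu> x\<bar> \<le> K0" "\<And>x. \<bar>x\<bar> \<le> R \<Longrightarrow> \<bar>\<sigma> x\<bar> \<le> K0"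
    using coefficients_locally_bounded by blast
  define K where "K = max K0 C"
  have K: "0 \<le> K" "\<And>x. \<bar>x\<bar> \<le> R \<Longrightarrow> \<bar>\<mu> x\<bar> \<le> K" "\<And>x. \<bar>x\<bar> \<le> R \<Longrightarrow> \<bar>\<sigma> x\<bar> \<le> K"
    "\<And>x. \<bar>f1 x\<bar> \<le> K" "\<And>x. \<bar>f2 x\<bar> \<le> K"
    using K0 C unfolding K_def by (auto simp: le_max_iff_disj)
  define B where "B = 2 + T * (2 * K ^ 3 * (1 + 2 * K) + K ^ 6 / 2 +
            ((K + K\<^sup>2 / 2) * (1 + 2 * K) + 5 / 2 * K ^ 3 + 2 * K\<^sup>2 + 32 * K ^ 5))"
  have B: "0 < B" unfolding B_def using K pos by (intro add_pos_nonneg mult_nonneg_nonneg add_nonneg_nonneg) auto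
  define \<theta> where "\<theta> = min 1 (min e (e / B))"
  have \<theta>: "0 < \<theta>" "\<theta> \<le> 1" "\<theta> \<le> e" "\<theta> \<le> e / B" using pos B by (auto simp: \<theta>_def)
  have "0 < \<theta>\<^sup>2" using \<theta> by simp
  then obtain d1 d2 where d: "0 < d1" "\<And>x y. dist x y < d1 \<Longrightarrow> dist (f1 x) (f1 y) < \<theta>\<^sup>2"
    "0 < d2" "\<And>x y. dist x y < d2 \<Longrightarrow> dist (f2 x) (f2 y) < \<theta>\<^sup>2"
    using uc unfolding uniformly_continuous_on_def by (metis UNIV_I)
  define \<eta> where "\<eta> = min e (min (d1 / 2) (d2 / 2))"
  have \<eta>: "0 < \<eta>" "\<eta> \<le> e" "\<eta> < d1" "\<eta> < d2" using d pos by (auto simp: \<eta>_def)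
  have mod1: "\<bar>f1 x - f1 y\<bar> \<le> \<theta>\<^sup>2" and mod2: "\<bar>f2 x - f2 y\<bar> \<le> \<theta>\<^sup>2" if "\<bar>x - y\<bar> \<le> \<eta>" for x y
    using d(2)[of x y] d(4)[of x y] that \<eta> by (auto simp: dist_real_def)
  define h' where "h' = min h (min (\<theta> ^ 4) (\<theta>\<^sup>2 * \<eta>\<^sup>2))"
  have h': "0 < h'" "h' \<le> h" "h' \<le> \<theta> ^ 4" "h' \<le> \<theta>\<^sup>2 * \<eta>\<^sup>2" using pos \<theta> \<eta> by (auto simp: h'_def)
  obtain q N where g: "time_grid q N T h'" and close: "\<And>l. l \<le> N \<Longrightarrow>
      prob {\<omega> \<in> space M. active R q l \<omega> = 1 \<and> \<eta> < \<bar>euler_X R q l \<omega> - X (q l) \<omega>\<bar>} \<le> \<theta>\<^sup>2"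
    using euler_close_to_solution[OF \<open>0 < T\<close> h'(1) \<eta>(1) \<open>0 < \<theta>\<^sup>2\<close>, of R] by blast
  have EM: "euler_X R q l \<in> borel_measurable M" if "l \<le> N" for l
  proof -
    have "euler_X R q l \<in> known_at (q l)"
      by (rule euler_adapted[OF g that]) (auto intro!: coefficients_adapted[OF g])
    then show ?thesis using filtration_measurableD by auto
  qed
  have meas: "{\<omega> \<in> space M. active R q l \<omega> = 1 \<and> a < \<bar>euler_X R q l \<omega> - X (q l) \<omega>\<bar>} \<in> sets M"
    if "l \<le> N" for l a
  proof -
    have [measurable]: "active R q l \<in> borel_measurable M"
      using active_adapted[OF g that] filtration_measurableD by blast
    note [measurable] = EM[OF that] X_random_variable[OF time_grid_nonneg[OF g that]]
    show ?thesis by measurable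
  qed
  have close': "prob {\<omega> \<in> space M. (drift R q j \<omega> \<noteq> 0 \<or> diffusion R q j \<omega> \<noteq> 0) \<and> \<eta> < \<bar>euler_X R q j \<omega> - X (q j) \<omega>\<bar>} \<le> \<theta>\<^sup>2"
    if "j < N" for j
  proof -
    have jN: "j \<le> N" using that by simp
    have "prob {\<omega> \<in> space M. (drift R q j \<omega> \<noteq> 0 \<or> diffusion R q j \<omega> \<noteq> 0) \<and> \<eta> < \<bar>euler_X R q j \<omega> - X (q j) \<omega>\<bar>}
      \<le> prob {\<omega> \<in> space M. active R q j \<omega> = 1 \<and> \<eta> < \<bar>euler_X R q j \<omega> - X (q j) \<omega>\<bar>}"
    proof (rule finite_measure_mono[OF _ meas[OF jN]], rule subsetI)
      fix \<omega> assume w: "\<omega> \<in> {\<omega> \<in> space M. (drift R q j \<omega> \<noteq> 0 \<or> diffusion R q j \<omega> \<noteq> 0) \<and> \<eta> < \<bar>euler_X R q j \<omega> - X (q j) \<omega>\<bar>}"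
      then have "active R q j \<omega> = 1"
        using active_01[of R q j \<omega>] by (auto simp: drift_def diffusion_def)
      then show "\<omega> \<in> {\<omega> \<in> space M. active R q j \<omega> = 1 \<and> \<eta> < \<bar>euler_X R q j \<omega> - X (q j) \<omega>\<bar>}" using w by simp
    qed
    then show ?thesis using close[OF jN] by simp
  qed
  have p1: "drift R q j \<in> known_at (q j)"
    and p3: "diffusion R q j \<in> known_at (q j)"
    and p5: "X (q j) \<in> known_at (q j)" if "j < N" for j
    using coefficients_adapted[OF g, of j] X_measurable[OF time_grid_nonneg[OF g, of j] order_refl] that by auto
  have p2: "\<bar>drift R q j \<omega>\<bar> \<le> K" and p4: "\<bar>diffusion R q j \<omega>\<bar> \<le> K" for j \<omega>
    using coefficients_bounded[OF K(1-3)] by auto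
  have ito: "integrable M (defect_X f f1 f2 R q N)"
    "expectation (\<lambda>\<omega>. \<bar>defect_X f f1 f2 R q N \<omega>\<bar>) \<le> B * \<theta>"
    unfolding B_def
    using euler_ito_defect_bound[OF g f1 f2 uniformly_continuous_imp_continuous[OF uc(2)] K(4,5) \<theta>(1,2) \<eta>(1) mod1 mod2 h'(3,4)
        p1 p2 p3 p4 p5 close'] by auto
  have "B * \<theta> \<le> e" using \<theta>(4) B by (simp add: field_simps)
  moreover have "time_grid q N T h" using g h'(2) unfolding time_grid_def by fastforce
  moreover have "prob {\<omega> \<in> space M. active R q N \<omega> = 1 \<and> e < \<bar>euler_X R q N \<omega> - X T \<omega>\<bar>} \<le> e"
  proof -
    have qN: "q N = T" using g by (simp add: time_grid_def)
    have "prob {\<omega> \<in> space M. active R q N \<omega> = 1 \<and> e < \<bar>euler_X R q N \<omega> - X (q N) \<omega>\<bar>}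
      \<le> prob {\<omega> \<in> space M. active R q N \<omega> = 1 \<and> \<eta> < \<bar>euler_X R q N \<omega> - X (q N) \<omega>\<bar>}"
      using \<eta>(2) by (intro finite_measure_mono meas) auto
    also have "\<dots> \<le> \<theta>\<^sup>2" by (rule close) simp
    also have "\<dots> \<le> \<theta>" using \<theta>(1,2) by (simp add: power2_eq_square mult_left_le)
    finally show ?thesis using \<theta>(3) unfolding qN by simp
  qed
  ultimately show ?thesis using that ito by fastforce
qed

text \<open>
  On such an event the scheme is never switched off before T.
\<close>
definition contained_until :: "real \<Rightarrow> real \<Rightarrow> 'a set \<Rightarrow> bool" where
  "contained_until T R G \<longleftrightarrow> G \<in> sets M \<and>
    (\<forall>\<omega>\<in>G. ennreal T < \<rho> \<omega> \<and> (\<forall>t. 0 \<le> t \<longrightarrow> t \<le> T \<longrightarrow> \<bar>X t \<omega>\<bar> \<le> R))"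

lemma contained_until_active:
  assumes "contained_until T R G" "\<omega> \<in> G" "time_grid q N T h" "j \<le> N"
  shows "active R q j \<omega> = 1" "\<bar>X (q j) \<omega>\<bar> \<le> R"
proof -
  have "\<bar>X (q i) \<omega>\<bar> \<le> R" if "i \<le> N" for i
    using assms(1,2) time_grid_nonneg[OF assms(3) that] time_grid_le[OF assms(3) that]
    unfolding contained_until_def by auto
  moreover have "ennreal (q j) < \<rho> \<omega>"
    using assms(1,2) ennreal_leI[OF time_grid_le[OF assms(3,4)]]
    unfolding contained_until_def by (auto elim: le_less_trans)
  ultimately show "active R q j \<omega> = 1" "\<bar>X (q j) \<omega>\<bar> \<le> R" using assms(4) by (auto simp: active_def)
qed

text \<open>
  If f transforms the diffusion coefficient into 1, the martingale part of f(X) is W, and what remains is the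
  integral of the generator applied to f, which is nonnegative here.
\<close>
lemma transformed_solution_dominates_W:
  fixes f f1 f2 :: "real \<Rightarrow> real"
  assumes tf: "test_function f f1 f2 C"
    and "0 < T" and G: "contained_until T R G"
    and unit: "\<And>x. \<bar>x\<bar> \<le> R \<Longrightarrow> f1 x * \<sigma> x = 1"
    and Lf: "\<And>x. \<bar>x\<bar> \<le> R \<Longrightarrow> 0 \<le> f1 x * \<mu> x + f2 x * (\<sigma> x)\<^sup>2 / 2"
  shows "AE \<omega> in M. \<omega> \<in> G \<longrightarrow> W T \<omega> - W 0 \<omega> \<le> f (X T \<omega>) - f x0"
proof -
  note f1 = test_functionD(1)[OF tf] and f2 = test_functionD(2)[OF tf]
    and uc = test_functionD(3,4)[OF tf] and C = test_functionD(5,6)[OF tf]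
  have [measurable]: "G \<in> sets M" using G unfolding contained_until_def by simp
  have T0: "0 \<le> T" using \<open>0 < T\<close> by simp
  note [measurable] = X_random_variable[OF T0] W_random_variable[OF T0] W_random_variable[OF order_refl]
  have [measurable]: "f \<in> borel_measurable borel"
    by (rule borel_measurable_continuous_onI, rule DERIV_continuous_on[of _ f f1]) (use f1 in auto)
  have C0: "0 \<le> C" using C(1)[of 0] by linarith
  have Lip: "\<bar>f x - f y\<bar> \<le> C * \<bar>x - y\<bar>" for x y
    using field_differentiable_bound[of UNIV f f1 C x y] f1 C(1) by (simp add: abs_minus_commute)
  let ?V = "\<lambda>\<omega>. f (X T \<omega>) - f x0 - (W T \<omega> - W 0 \<omega>)"
  have small: "prob {\<omega> \<in> space M. \<omega> \<in> G \<and> ?V \<omega> < - a} = 0" if "0 < a" for a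
  proof (rule antisym)
    show "prob {\<omega> \<in> space M. \<omega> \<in> G \<and> ?V \<omega> < - a} \<le> 0"
    proof (rule field_le_epsilon)
      fix z :: real assume "0 < z"
      define e where "e = min (a / (2 * (C + 1))) (min (z / 2) (z * a / 4))"
      have e: "0 < e" "e \<le> z / 2" "2 * e / a \<le> z / 2" "C * e \<le> a / 2"
      proof -
        show "0 < e" using \<open>0 < a\<close> \<open>0 < z\<close> C0 by (simp add: e_def)
        have "e \<le> z * a / 4" "e \<le> a / (2 * (C + 1))" and "e \<le> z / 2"
          unfolding e_def by (meson min.cobounded1 min.cobounded2 order_trans)+
        then show "e \<le> z / 2" by simp
        show "2 * e / a \<le> z / 2" using \<open>e \<le> z * a / 4\<close> \<open>0 < a\<close> by (simp add: divide_le_eq)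
        have "(C + 1) * e \<le> a / 2" using \<open>e \<le> a / (2 * (C + 1))\<close> C0 by (simp add: field_simps)
        then show "C * e \<le> a / 2" using \<open>0 < e\<close> by (simp add: algebra_simps)
      qed
      obtain q N where g: "time_grid q N T 1"
        and dI: "integrable M (defect_X f f1 f2 R q N)"
        and dE: "expectation (\<lambda>\<omega>. \<bar>defect_X f f1 f2 R q N \<omega>\<bar>) \<le> e"
        and cl: "prob {\<omega> \<in> space M. active R q N \<omega> = 1 \<and> e < \<bar>euler_X R q N \<omega> - X T \<omega>\<bar>} \<le> e"
        using ito_formula_on_grids[OF tf \<open>0 < T\<close> zero_less_one e(1)] by blast
      have qN: "q N = T" "q 0 = 0" using g by (simp_all add: time_grid_def)
      have EMN: "euler_X R q N \<in> borel_measurable M"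
      proof -
        have "euler_X R q N \<in> known_at (q N)"
          by (rule euler_adapted[OF g order_refl]) (auto intro!: coefficients_adapted[OF g])
        then show ?thesis using filtration_measurableD by auto
      qed
      have aM: "active R q N \<in> borel_measurable M"
        using active_adapted[OF g order_refl] filtration_measurableD by blast
      note [measurable] = EMN aM borel_measurable_integrable[OF dI]
      let ?A = "{\<omega> \<in> space M. active R q N \<omega> = 1 \<and> e < \<bar>euler_X R q N \<omega> - X T \<omega>\<bar>}"
      let ?B = "{\<omega> \<in> space M. a / 2 \<le> \<bar>defect_X f f1 f2 R q N \<omega>\<bar>}"
      have "{\<omega> \<in> space M. \<omega> \<in> G \<and> ?V \<omega> < - a} \<subseteq> ?A \<union> ?B"
      proof
        fix \<omega> assume w: "\<omega> \<in> {\<omega> \<in> space M. \<omega> \<in> G \<and> ?V \<omega> < - a}"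
        then have wG: "\<omega> \<in> G" and V: "?V \<omega> < - a" and ws: "\<omega> \<in> space M" by auto
        note act = contained_until_active[OF G wG g]
        have s1: "(\<Sum>j<N. f1 (X (q j) \<omega>) * diffusion R q j \<omega> * (dW q j \<omega>)) = W T \<omega> - W 0 \<omega>"
        proof -
          have "(\<Sum>j<N. f1 (X (q j) \<omega>) * diffusion R q j \<omega> * (dW q j \<omega>))
            = (\<Sum>j<N. dW q j \<omega>)"
            using act unit by (intro sum.cong) (auto simp: diffusion_def)
          then show ?thesis using sum_lessThan_telescope[of "\<lambda>j. W (q j) \<omega>" N] qN by simp
        qed
        have s2: "0 \<le> (\<Sum>j<N. (f1 (X (q j) \<omega>) * drift R q j \<omega> + f2 (X (q j) \<omega>) * (diffusion R q j \<omega>)\<^sup>2 / 2) * (q (Suc j) - q j))"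
          using act Lf time_grid_step(1)[OF g]
          by (intro sum_nonneg mult_nonneg_nonneg) (auto simp: drift_def diffusion_def less_imp_le)
        have "defect_X f f1 f2 R q N \<omega> \<le> f (euler_X R q N \<omega>) - f x0 - (W T \<omega> - W 0 \<omega>)"
          unfolding euler_ito_defect_def s1 using s2 by simp
        moreover have "f (euler_X R q N \<omega>) \<le> f (X T \<omega>) + C * \<bar>euler_X R q N \<omega> - X T \<omega>\<bar>"
          using Lip[of "euler_X R q N \<omega>" "X T \<omega>"] by linarith
        ultimately have d: "defect_X f f1 f2 R q N \<omega> < - a + C * \<bar>euler_X R q N \<omega> - X T \<omega>\<bar>"
          using V by linarith
        show "\<omega> \<in> ?A \<union> ?B"
        proof (cases "e < \<bar>euler_X R q N \<omega> - X T \<omega>\<bar>")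
          case True
          then show ?thesis using act(1)[OF order_refl] ws by simp
        next
          case False
          then have "C * \<bar>euler_X R q N \<omega> - X T \<omega>\<bar> \<le> C * e" using C0 by (intro mult_left_mono) auto
          then show ?thesis using d e(4) ws by auto
        qed
      qed
      then have "prob {\<omega> \<in> space M. \<omega> \<in> G \<and> ?V \<omega> < - a} \<le> prob (?A \<union> ?B)"
        by (intro finite_measure_mono) auto
      also have "\<dots> \<le> prob ?A + prob ?B" by (intro measure_Un_le) auto
      also have "prob ?B \<le> expectation (\<lambda>\<omega>. \<bar>defect_X f f1 f2 R q N \<omega>\<bar>) / (a / 2)"
        using dI \<open>0 < a\<close> by (intro integral_Markov_inequality_measure[where A="{}"]) auto
      also have "\<dots> \<le> e / (a / 2)" using dE \<open>0 < a\<close> by (intro divide_right_mono) auto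
      also have "\<dots> \<le> z / 2" using e(3) by simp
      finally show "prob {\<omega> \<in> space M. \<omega> \<in> G \<and> ?V \<omega> < - a} \<le> 0 + z" using cl e(2) by simp
    qed
  qed simp
  have "AE \<omega> in M. \<forall>n::nat. \<not> (\<omega> \<in> G \<and> ?V \<omega> < - inverse (real (Suc n)))"
    unfolding AE_all_countable
  proof
    fix n :: nat
    have [measurable]: "{\<omega> \<in> space M. \<omega> \<in> G \<and> ?V \<omega> < - inverse (real (Suc n))} \<in> sets M" by measurable
    have "{\<omega> \<in> space M. \<omega> \<in> G \<and> ?V \<omega> < - inverse (real (Suc n))} \<in> null_sets M"
      using small[of "inverse (real (Suc n))"] by (intro null_setsI) (auto simp: emeasure_eq_measure)
    from AE_not_in[OF this] show "AE \<omega> in M. \<not> (\<omega> \<in> G \<and> ?V \<omega> < - inverse (real (Suc n)))"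
      using AE_space by eventually_elim auto
  qed
  then show ?thesis
  proof eventually_elim
    case (elim \<omega>)
    show ?case
    proof (rule impI, rule ccontr)
      assume w: "\<omega> \<in> G" "\<not> W T \<omega> - W 0 \<omega> \<le> f (X T \<omega>) - f x0"
      then have "0 < - ?V \<omega>" by simp
      then obtain n where "inverse (real (Suc n)) < - ?V \<omega>" using reals_Archimedean by blast
      then show False using elim w(1) by (metis neg_less_iff_less minus_minus)
    qed
  qed
qed

text \<open>
  The martingale part has mean zero, so the generator, summed along X, has mean at least \<open>- f x0 - e\<close>
  because f stays nonnegative.  Each time step at which X is above 1 on the event G contributes at most minus its
  length.
\<close>
lemma occupation_bound:
  fixes f f1 f2 :: "real \<Rightarrow> real"
  assumes tf: "test_function f f1 f2 C"
    and pos: "0 < T" "0 < h" "0 < e" and G: "contained_until T R G"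
    and f0: "\<And>x. 0 \<le> f x"
    and Lf: "\<And>x. \<bar>x\<bar> \<le> R \<Longrightarrow> f1 x * \<mu> x + f2 x * (\<sigma> x)\<^sup>2 / 2 \<le> 0"
    and Lf1: "\<And>x. \<bar>x\<bar> \<le> R \<Longrightarrow> 1 \<le> x \<Longrightarrow> f1 x * \<mu> x + f2 x * (\<sigma> x)\<^sup>2 / 2 \<le> - 1"
  obtains q N where "time_grid q N T h"
    "(\<Sum>j<N. prob {\<omega> \<in> G. 1 \<le> X (q j) \<omega>} * (q (Suc j) - q j)) \<le> f x0 + e"
proof -
  note f1 = test_functionD(1)[OF tf] and f2 = test_functionD(2)[OF tf]
    and uc = test_functionD(3,4)[OF tf] and C = test_functionD(5,6)[OF tf]
  obtain q N where g: "time_grid q N T h"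
    and dI: "integrable M (defect_X f f1 f2 R q N)"
    and dE: "expectation (\<lambda>\<omega>. \<bar>defect_X f f1 f2 R q N \<omega>\<bar>) \<le> e"
    using ito_formula_on_grids[OF tf pos] by blast
  have GM [measurable]: "G \<in> sets M" using G unfolding contained_until_def by simp
  obtain K where K: "1 \<le> K" "\<And>x. \<bar>x\<bar> \<le> R \<Longrightarrow> \<bar>\<mu> x\<bar> \<le> K" "\<And>x. \<bar>x\<bar> \<le> R \<Longrightarrow> \<bar>\<sigma> x\<bar> \<le> K"
    using coefficients_locally_bounded by blast
  have K0: "0 \<le> K" using K(1) by simp
  have C0: "0 \<le> C" using C(1)[of 0] by linarith
  note [measurable] = borel_measurable_continuous_onI[OF uniformly_continuous_imp_continuous[OF uc(1)]]
  define a where "a j \<omega> = f1 (X (q j) \<omega>) * diffusion R q j \<omega>" for j \<omega>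
  have aF: "a j \<in> known_at (q j)" if "j < N" for j
  proof -
    have jN: "j \<le> N" using that by simp
    note [measurable] = coefficients_adapted(2)[OF g jN] X_measurable[OF time_grid_nonneg[OF g jN] order_refl]
    show ?thesis unfolding a_def by measurable
  qed
  have ab: "\<bar>a j \<omega>\<bar> \<le> C * K" for j \<omega>
    unfolding a_def abs_mult using C(1) coefficients_bounded(2)[OF K0 K(2,3)] C0 by (intro mult_mono) auto
  define S where "S \<omega> = (\<Sum>j<N. a j \<omega> * (dW q j \<omega>))" for \<omega>
  have S: "integrable M S" "expectation S = 0"
    using stochastic_sum_moments[OF g order_refl aF ab] unfolding S_def by auto
  define A where "A j = {\<omega> \<in> G. 1 \<le> X (q j) \<omega>}" for j
  have AM: "A j \<in> sets M" if "j \<le> N" for j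
  proof -
    note [measurable] = X_random_variable[OF time_grid_nonneg[OF g that]]
    have "A j = {\<omega> \<in> space M. \<omega> \<in> G \<and> 1 \<le> X (q j) \<omega>}"
      unfolding A_def using sets.sets_into_space[OF GM] by auto
    then show ?thesis by simp
  qed
  have Ai: "integrable M (\<lambda>\<omega>. indicator (A j) \<omega> * (q (Suc j) - q j))" if "j < N" for j
    using AM[of j] that by (intro integrable_mult_left integrable_real_indicator) (auto simp: less_top[symmetric])
  have pw: "(\<Sum>j<N. indicator (A j) \<omega> * (q (Suc j) - q j)) \<le> f x0 + S \<omega> + \<bar>defect_X f f1 f2 R q N \<omega>\<bar>"
    if ws: "\<omega> \<in> space M" for \<omega>
  proof -
    have "(f1 (X (q j) \<omega>) * drift R q j \<omega> + f2 (X (q j) \<omega>) * (diffusion R q j \<omega>)\<^sup>2 / 2) \<le> - indicator (A j) \<omega>"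
      if j: "j < N" for j
    proof (cases "active R q j \<omega> = 1")
      case True
      then show ?thesis
        using active_bound[OF True] Lf[of "X (q j) \<omega>"] Lf1[of "X (q j) \<omega>"]
        by (auto simp: drift_def diffusion_def A_def indicator_def)
    next
      case False
      then have "\<omega> \<notin> A j" using contained_until_active(1)[OF G _ g, of \<omega> j] j by (auto simp: A_def)
      moreover have "active R q j \<omega> = 0" using False active_01 by blast
      ultimately show ?thesis by (simp add: drift_def diffusion_def)
    qed
    then have "(\<Sum>j<N. (f1 (X (q j) \<omega>) * drift R q j \<omega> + f2 (X (q j) \<omega>) * (diffusion R q j \<omega>)\<^sup>2 / 2) * (q (Suc j) - q j))
      \<le> (\<Sum>j<N. - indicator (A j) \<omega> * (q (Suc j) - q j))"
      using time_grid_step(1)[OF g] by (intro sum_mono mult_right_mono) (auto simp: less_imp_le)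
    also have "\<dots> = - (\<Sum>j<N. indicator (A j) \<omega> * (q (Suc j) - q j))" by (simp add: sum_negf)
    finally show ?thesis
      using f0[of "euler_X R q N \<omega>"] unfolding euler_ito_defect_def S_def a_def by linarith
  qed
  have "(\<Sum>j<N. prob (A j) * (q (Suc j) - q j)) = expectation (\<lambda>\<omega>. \<Sum>j<N. indicator (A j) \<omega> * (q (Suc j) - q j))"
    using AM Ai sets.sets_into_space[OF AM]
    by (subst Bochner_Integration.integral_sum) (auto simp: Int_absorb2 intro!: sum.cong)
  also have "\<dots> \<le> expectation (\<lambda>\<omega>. f x0 + S \<omega> + \<bar>defect_X f f1 f2 R q N \<omega>\<bar>)"
    using Ai S(1) dI pw
    by (intro integral_mono Bochner_Integration.integrable_sum Bochner_Integration.integrable_add integrable_abs) auto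
  also have "\<dots> = f x0 + expectation S + expectation (\<lambda>\<omega>. \<bar>defect_X f f1 f2 R q N \<omega>\<bar>)"
    using S(1) dI by (simp add: prob_space)
  also have "\<dots> \<le> f x0 + e" using S(2) dE by simp
  finally show ?thesis using that[OF g] unfolding A_def by blast
qed

end

section \<open>The scale function and a Lyapunov function\<close>

lemma continuous_antiderivative:
  fixes f :: "real \<Rightarrow> real"
  assumes "continuous_on UNIV f"
  obtains F where "\<And>x. (F has_real_derivative f x) (at x)" "F 0 = 0"
proof -
  have "isCont f x" for x using assms continuous_on_eq_continuous_at[of UNIV f] by auto
  then have "\<exists>F. \<forall>x. - \<infinity> < ereal x \<longrightarrow> ereal x < \<infinity> \<longrightarrow> (F has_vector_derivative f x) (at x)"
    using einterval_antiderivative[of "- \<infinity>" "\<infinity>" f] by auto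
  then obtain F where F: "(F has_real_derivative f x) (at x)" for x
    by (auto simp: has_real_derivative_iff_has_vector_derivative)
  show ?thesis
    by (rule that[of "\<lambda>x. F x - F 0"]) (auto intro!: derivative_eq_intros F)
qed

lemma compact_support_uniformly_continuous:
  fixes p :: "real \<Rightarrow> real"
  assumes p: "continuous_on UNIV p" and z: "\<And>x. B \<le> \<bar>x\<bar> \<Longrightarrow> p x = 0" and "0 \<le> B"
  shows "uniformly_continuous_on UNIV p" "\<exists>C. \<forall>x. \<bar>p x\<bar> \<le> C"
proof -
  define cl where "cl x = max (- B) (min B x)" for x
  have cl: "cl x \<in> {-B..B}" "p (cl x) = p x" for x
    using z[of x] z[of B] z[of "- B"] \<open>0 \<le> B\<close> by (auto simp: cl_def max_def min_def)
  have clL: "\<bar>cl x - cl y\<bar> \<le> \<bar>x - y\<bar>" for x y unfolding cl_def by (auto simp: max_def min_def)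
  have pc: "continuous_on {-B..B} p" using p by (rule continuous_on_subset) simp
  have "uniformly_continuous_on {-B..B} p" using pc by (rule compact_uniformly_continuous) simp
  show "uniformly_continuous_on UNIV p"
    unfolding uniformly_continuous_on_def
  proof (intro allI impI)
    fix e :: real assume "0 < e"
    then obtain d where d: "0 < d" "\<And>x y. x \<in> {-B..B} \<Longrightarrow> y \<in> {-B..B} \<Longrightarrow> dist y x < d \<Longrightarrow> dist (p y) (p x) < e"
      using \<open>uniformly_continuous_on {-B..B} p\<close> unfolding uniformly_continuous_on_def by metis
    have "dist (p y) (p x) < e" if "dist y x < d" for x y
      using d(2)[OF cl(1)[of x] cl(1)[of y]] clL[of y x] that unfolding cl(2) by (simp add: dist_real_def)
    then show "\<exists>d>0. \<forall>x\<in>UNIV. \<forall>x'\<in>UNIV. dist x' x < d \<longrightarrow> dist (p x') (p x) < e" using d(1) by blast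
  qed
  have "bounded (p ` {-B..B})"
    using pc by (intro compact_imp_bounded compact_continuous_image) auto
  then obtain C where "\<And>x. x \<in> {-B..B} \<Longrightarrow> \<bar>p x\<bar> \<le> C" unfolding bounded_iff by fastforce
  then have "\<bar>p x\<bar> \<le> C" for x using cl[of x] by metis
  then show "\<exists>C. \<forall>x. \<bar>p x\<bar> \<le> C" by blast
qed

lemma has_derivative_positive_part_square:
  "((\<lambda>s. (max 0 s)\<^sup>2) has_real_derivative 2 * max 0 s) (at s)" for s :: real
proof -
  consider "s < 0" | "s = 0" | "0 < s" by linarith
  then show ?thesis
  proof cases
    case 1
    have "((\<lambda>s::real. 0) has_real_derivative 0) (at s)" by simp
    then have "((\<lambda>s. (max 0 s)\<^sup>2) has_real_derivative 0) (at s)"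
      by (rule has_field_derivative_transform_within_open[of _ _ _ "{..<0}"]) (use 1 in auto)
    then show ?thesis using 1 by simp
  next
    case 2
    have "((\<lambda>h. (max 0 (0 + h))\<^sup>2 / h) \<longlongrightarrow> 0) (at (0::real))"
    proof (rule Lim_null_comparison)
      show "\<forall>\<^sub>F h in at (0::real). norm ((max 0 (0 + h))\<^sup>2 / h) \<le> \<bar>h\<bar>"
        by (rule always_eventually) (auto simp: max_def power2_eq_square)
      show "((\<lambda>h. \<bar>h\<bar>) \<longlongrightarrow> 0) (at (0::real))" by (auto intro!: tendsto_eq_intros)
    qed
    then show ?thesis using 2 by (simp add: DERIV_def)
  next
    case 3
    have "((\<lambda>s::real. s\<^sup>2) has_real_derivative 2 * s) (at s)" by (auto intro!: derivative_eq_intros)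
    then have "((\<lambda>s. (max 0 s)\<^sup>2) has_real_derivative 2 * s) (at s)"
      by (rule has_field_derivative_transform_within_open[of _ _ _ "{0<..}"]) (use 3 in auto)
    then show ?thesis using 3 by simp
  qed
qed

text \<open>
  The cutoff is built from the function \<open>(max 0 s)\<^sup>2\<close>, which is continuously differentiable and vanishes for negative s.
\<close>
lemma smooth_cutoff:
  assumes "0 \<le> (R::real)"
  obtains \<kappa> \<kappa>1 where "\<And>x. (\<kappa> has_real_derivative \<kappa>1 x) (at x)" "continuous_on UNIV \<kappa>1"
    "\<And>x. 0 \<le> \<kappa> x \<and> \<kappa> x \<le> 1" "\<And>x. \<bar>x\<bar> \<le> R \<Longrightarrow> \<kappa> x = 1 \<and> \<kappa>1 x = 0"
    "\<And>x. R + 1 \<le> \<bar>x\<bar> \<Longrightarrow> \<kappa> x = 0 \<and> \<kappa>1 x = 0"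
proof -
  define a where "a x = 1 - (max 0 (x - R))\<^sup>2 - (max 0 (- x - R))\<^sup>2" for x
  define a1 where "a1 x = - (2 * max 0 (x - R)) + 2 * max 0 (- x - R)" for x
  note D = has_derivative_positive_part_square
  have a: "(a has_real_derivative a1 x) (at x)" for x
    unfolding a_def a1_def
    by (rule derivative_eq_intros DERIV_chain2[OF D] refl | simp)+
  have "((\<lambda>x. (max 0 (a x))\<^sup>2) has_real_derivative 2 * max 0 (a x) * a1 x) (at x)" for x
    by (rule DERIV_chain2[OF D a])
  moreover have "continuous_on UNIV (\<lambda>x. 2 * max 0 (a x) * a1 x)"
    unfolding a_def a1_def by (intro continuous_intros)
  moreover have "0 \<le> (max 0 (a x))\<^sup>2 \<and> (max 0 (a x))\<^sup>2 \<le> 1" for x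
    by (auto simp: a_def intro!: power_le_one)
  moreover have "(max 0 (a x))\<^sup>2 = 1 \<and> 2 * max 0 (a x) * a1 x = 0" if "\<bar>x\<bar> \<le> R" for x
  proof -
    have "max 0 (x - R) = 0" "max 0 (- x - R) = 0" using that by auto
    then show ?thesis by (simp add: a_def a1_def)
  qed
  moreover have "(max 0 (a x))\<^sup>2 = 0 \<and> 2 * max 0 (a x) * a1 x = 0" if x: "R + 1 \<le> \<bar>x\<bar>" for x
  proof -
    have "1 \<le> (max 0 (x - R))\<^sup>2 + (max 0 (- x - R))\<^sup>2"
    proof (cases "0 \<le> x")
      case True
      then have "1 \<le> (max 0 (x - R))\<^sup>2" using x by (intro one_le_power) auto
      then show ?thesis by (simp add: add_increasing2)
    next
      case False
      then have "1 \<le> (max 0 (- x - R))\<^sup>2" using x by (intro one_le_power) auto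
      then show ?thesis by (simp add: add_increasing)
    qed
    then show ?thesis by (auto simp: a_def max_def)
  qed
  ultimately show ?thesis by (rule that)
qed

text \<open>
  A prescribed derivative w is multiplied by a cutoff and then integrated.  Cutting off the derivative
  rather than the function keeps monotonicity, and with it the sign conditions needed for Lyapunov
  functions.
\<close>
lemma truncated_test_function:
  fixes w w1 :: "real \<Rightarrow> real"
  assumes w: "\<And>x. (w has_real_derivative w1 x) (at x)" and w1: "continuous_on UNIV w1" and "0 \<le> R"
  obtains f f1 f2 C \<kappa> where "test_function f f1 f2 C" "\<And>x. f1 x = w x * \<kappa> x"
    "\<And>x. 0 \<le> \<kappa> x \<and> \<kappa> x \<le> 1" "\<And>x. \<bar>x\<bar> \<le> R \<Longrightarrow> f1 x = w x \<and> f2 x = w1 x" "f 0 = 0"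
proof -
  obtain \<kappa> \<kappa>1 where X: "\<And>x. (\<kappa> has_real_derivative \<kappa>1 x) (at x)" "continuous_on UNIV \<kappa>1"
    "\<And>x. 0 \<le> \<kappa> x \<and> \<kappa> x \<le> 1" "\<And>x. \<bar>x\<bar> \<le> R \<Longrightarrow> \<kappa> x = 1 \<and> \<kappa>1 x = 0"
    "\<And>x. R + 1 \<le> \<bar>x\<bar> \<Longrightarrow> \<kappa> x = 0 \<and> \<kappa>1 x = 0"
    using smooth_cutoff[OF \<open>0 \<le> R\<close>] by blast
  define f1 where "f1 x = w x * \<kappa> x" for x
  define f2 where "f2 x = w1 x * \<kappa> x + w x * \<kappa>1 x" for x
  have f2: "(f1 has_real_derivative f2 x) (at x)" for x
    unfolding f1_def[abs_def] f2_def by (auto intro!: derivative_eq_intros w X(1))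
  have "continuous_on UNIV w" "continuous_on UNIV \<kappa>"
    using w X(1) by (intro DERIV_continuous_on; auto)+
  then have c: "continuous_on UNIV f1" "continuous_on UNIV f2"
    unfolding f1_def[abs_def] f2_def[abs_def] using w1 X(2) by (auto intro!: continuous_intros)
  obtain f where f: "\<And>x. (f has_real_derivative f1 x) (at x)" "f 0 = 0"
    using continuous_antiderivative[OF c(1)] by blast
  have z: "f1 x = 0" "f2 x = 0" if "R + 1 \<le> \<bar>x\<bar>" for x using X(5)[OF that] by (auto simp: f1_def f2_def)
  have R1: "0 \<le> R + 1" using \<open>0 \<le> R\<close> by simp
  obtain C1 C2 where C: "\<And>x. \<bar>f1 x\<bar> \<le> C1" "\<And>x. \<bar>f2 x\<bar> \<le> C2"
    using compact_support_uniformly_continuous(2)[OF c(1) z(1) R1]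
      compact_support_uniformly_continuous(2)[OF c(2) z(2) R1] by blast
  have "test_function f f1 f2 (max C1 C2)"
    unfolding test_function_def
    using f f2 C compact_support_uniformly_continuous(1)[OF c(1) z(1) R1]
      compact_support_uniformly_continuous(1)[OF c(2) z(2) R1] by (auto simp: le_max_iff_disj)
  moreover have "f1 x = w x * \<kappa> x" for x by (simp add: f1_def)
  moreover have "f1 x = w x \<and> f2 x = w1 x" if "\<bar>x\<bar> \<le> R" for x using X(4)[OF that] by (simp add: f1_def f2_def)
  ultimately show ?thesis using that X(3) f(2) by blast
qed

lemma derivative_le_imp_increment_le:
  fixes f g :: "real \<Rightarrow> real"
  assumes "a \<le> b" "\<And>x. a \<le> x \<Longrightarrow> x \<le> b \<Longrightarrow> (f has_real_derivative f' x) (at x)"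
    "\<And>x. a \<le> x \<Longrightarrow> x \<le> b \<Longrightarrow> (g has_real_derivative g' x) (at x)"
    "\<And>x. a \<le> x \<Longrightarrow> x \<le> b \<Longrightarrow> f' x \<le> g' x"
  shows "f b - f a \<le> g b - g a"
proof -
  have "(\<lambda>x. g x - f x) a \<le> (\<lambda>x. g x - f x) b"
    using assms by (intro DERIV_nonneg_imp_nondecreasing[OF assms(1)]) (fastforce intro!: derivative_eq_intros)
  then show ?thesis by simp
qed

text \<open>
  The transformation that makes the diffusion coefficient equal to 1; its generator is then \<open>b / \<sigma>\<close>.
\<close>
lemma scale_test_function:
  fixes b \<sigma> \<sigma>1 S :: "real \<Rightarrow> real"
  assumes \<sigma>1: "\<And>x. (\<sigma> has_real_derivative \<sigma>1 x) (at x)" "continuous_on UNIV \<sigma>1"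
    and pos: "\<And>x. 0 < b x" "\<And>x. 0 < \<sigma> x"
    and S: "\<And>x. (S has_real_derivative 1 / \<sigma> x) (at x)"
    and "0 \<le> R" "\<bar>x0\<bar> \<le> R"
  obtains f f1 f2 C where "test_function f f1 f2 C" "\<And>x. \<bar>x\<bar> \<le> R \<Longrightarrow> f1 x * \<sigma> x = 1"
    "\<And>x. \<bar>x\<bar> \<le> R \<Longrightarrow> 0 \<le> f1 x * (b x + 1/2 * \<sigma> x * \<sigma>1 x) + f2 x * (\<sigma> x)\<^sup>2 / 2"
    "\<And>x. \<bar>x\<bar> \<le> R \<Longrightarrow> f x - f x0 = S x - S x0"
proof -
  have nz: "\<sigma> x \<noteq> 0" for x using pos(2)[of x] by simp
  have w: "((\<lambda>x. 1 / \<sigma> x) has_real_derivative - \<sigma>1 x / (\<sigma> x)\<^sup>2) (at x)" for x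
    using nz by (auto intro!: derivative_eq_intros \<sigma>1 simp: power2_eq_square)
  have \<sigma>c: "continuous_on UNIV \<sigma>" using \<sigma>1(1) by (intro DERIV_continuous_on) auto
  have w1: "continuous_on UNIV (\<lambda>x. - \<sigma>1 x / (\<sigma> x)\<^sup>2)"
    using nz by (intro continuous_intros \<sigma>1 \<sigma>c) auto
  obtain f f1 f2 C \<kappa> where tf: "test_function f f1 f2 C"
    and f12: "\<And>x. \<bar>x\<bar> \<le> R \<Longrightarrow> f1 x = 1 / \<sigma> x \<and> f2 x = - \<sigma>1 x / (\<sigma> x)\<^sup>2"
    using truncated_test_function[OF w w1 \<open>0 \<le> R\<close>] by metis
  have 1: "f1 x * \<sigma> x = 1" if "\<bar>x\<bar> \<le> R" for x using f12[OF that] nz by simp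
  have 2: "0 \<le> f1 x * (b x + 1/2 * \<sigma> x * \<sigma>1 x) + f2 x * (\<sigma> x)\<^sup>2 / 2" if "\<bar>x\<bar> \<le> R" for x
  proof -
    have "f1 x * (b x + 1/2 * \<sigma> x * \<sigma>1 x) + f2 x * (\<sigma> x)\<^sup>2 / 2 = b x / \<sigma> x"
    proof -
      have e: "f1 x = 1 / \<sigma> x" "f2 x = - \<sigma>1 x / (\<sigma> x)\<^sup>2" using f12[OF that] by auto
      show ?thesis unfolding e using nz[of x] by (simp add: field_simps power2_eq_square)
    qed
    then show ?thesis using pos(1)[of x] pos(2)[of x] by simp
  qed
  have diff: "f y - f x = S y - S x" if "x \<le> y" "\<bar>x\<bar> \<le> R" "\<bar>y\<bar> \<le> R" for x y
  proof (rule antisym)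
    have "\<bar>z\<bar> \<le> R" if "x \<le> z" "z \<le> y" for z using that \<open>\<bar>x\<bar> \<le> R\<close> \<open>\<bar>y\<bar> \<le> R\<close> by auto
    then have e: "f1 z = 1 / \<sigma> z" if "x \<le> z" "z \<le> y" for z using f12 that by blast
    show "f y - f x \<le> S y - S x"
      by (rule derivative_le_imp_increment_le[OF \<open>x \<le> y\<close> test_functionD(1)[OF tf] S]) (simp add: e)
    show "S y - S x \<le> f y - f x"
      by (rule derivative_le_imp_increment_le[OF \<open>x \<le> y\<close> S test_functionD(1)[OF tf]]) (simp add: e)
  qed
  have 3: "f x - f x0 = S x - S x0" if "\<bar>x\<bar> \<le> R" for x
    using diff[of x x0] diff[of x0 x] that \<open>\<bar>x0\<bar> \<le> R\<close> by (cases "x \<le> x0") auto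
  show ?thesis using that[OF tf 1 2 3] .
qed

lemma antiderivative_le_nn_integral:
  fixes g :: "real \<Rightarrow> real"
  assumes B: "\<And>x. (B has_real_derivative g x) (at x)" and g: "continuous_on UNIV g" "\<And>x. 0 \<le> g x"
    and C: "(\<integral>\<^sup>+z\<in>{0..}. ennreal (g z) \<partial>lborel) = ennreal C" "0 \<le> C" and "0 \<le> x"
  shows "B x - B 0 \<le> C"
proof -
  have "ennreal (B x - B 0) = (\<integral>\<^sup>+z\<in>{0..x}. ennreal (g z) \<partial>lborel)"
    using nn_integral_FTC_Icc[of g 0 x B] B g \<open>0 \<le> x\<close> borel_measurable_continuous_onI[OF g(1)]
    by (auto simp: ennreal_mult'' ennreal_indicator mult.commute)
  also have "\<dots> \<le> (\<integral>\<^sup>+z\<in>{0..}. ennreal (g z) \<partial>lborel)"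
    by (intro nn_integral_mono) (auto simp: indicator_def)
  finally show ?thesis using C by simp
qed

text \<open>
  With \<open>v = - u' = V / \<sigma>\<close>, the equation for u is the linear equation \<open>V' = - 2 (b / \<sigma>\<^sup>2) V + 2 k / \<sigma>\<close>, which is solved by an
  integrating factor with V = 0 on the negative half line.  The total mass of v is controlled by an
  energy estimate: differentiating \<open>V\<^sup>2 / 4\<close> and using \<open>k \<le> 1\<close> gives
  \<open>(V\<^sup>2 / 4)' \<le> v - b v\<^sup>2\<close>, and completing the square in \<open>2 v \<le> b v\<^sup>2 + 1 / b\<close> gives
  \<open>v + (V\<^sup>2 / 4)' \<le> 1 / b\<close>.  So v has mass at most C, the integral of \<open>1 / b\<close>, and
  \<open>u = C - \<integral> v\<close> is nonnegative.
\<close>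
lemma lyapunov_function:
  fixes b \<sigma> \<sigma>1 :: "real \<Rightarrow> real"
  assumes bc: "continuous_on UNIV b"
    and \<sigma>1: "\<And>x. (\<sigma> has_real_derivative \<sigma>1 x) (at x)" "continuous_on UNIV \<sigma>1"
    and pos: "\<And>x. 0 < b x" "\<And>x. 0 < \<sigma> x"
    and fin: "(\<integral>\<^sup>+z\<in>{0..}. ennreal (1 / b z) \<partial>lborel) < \<infinity>"
  obtains u v v1 where "\<And>x. (u has_real_derivative - v x) (at x)" "\<And>x. (v has_real_derivative v1 x) (at x)"
    "continuous_on UNIV v1" "\<And>x. 0 \<le> v x" "\<And>x. 0 \<le> u x"
    "\<And>x. v x * (b x + 1/2 * \<sigma> x * \<sigma>1 x) + v1 x * (\<sigma> x)\<^sup>2 / 2 = max 0 (min 1 x)"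
proof -
  have nz: "\<sigma> x \<noteq> 0" "b x \<noteq> 0" for x using pos(1)[of x] pos(2)[of x] by auto
  have \<sigma>c: "continuous_on UNIV \<sigma>" using \<sigma>1(1) by (intro DERIV_continuous_on) auto
  define k where "k x = max 0 (min 1 x)" for x :: real
  have k: "0 \<le> k x" "k x \<le> 1" "x \<le> 0 \<Longrightarrow> k x = 0" for x by (auto simp: k_def)
  have kc: "continuous_on UNIV k" unfolding k_def[abs_def] by (intro continuous_intros)
  have "continuous_on UNIV (\<lambda>x. b x / (\<sigma> x)\<^sup>2)" using nz by (intro continuous_intros bc \<sigma>c) auto
  then obtain G where G: "\<And>x. (G has_real_derivative b x / (\<sigma> x)\<^sup>2) (at x)"
    using continuous_antiderivative by blast
  have Gc: "continuous_on UNIV G" using G by (intro DERIV_continuous_on) auto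
  have "continuous_on UNIV (\<lambda>x. 2 * k x / \<sigma> x * exp (2 * G x))" using nz by (intro continuous_intros kc \<sigma>c Gc) auto
  then obtain P where P: "\<And>x. (P has_real_derivative 2 * k x / \<sigma> x * exp (2 * G x)) (at x)" "P 0 = 0"
    using continuous_antiderivative by blast
  have P0: "P x = 0" if "x \<le> 0" for x
  proof (rule antisym)
    show "P x \<le> 0"
      using derivative_le_imp_increment_le[OF that, of "\<lambda>_. 0" "\<lambda>_. 0" P "\<lambda>x. 2 * k x / \<sigma> x * exp (2 * G x)", OF _ P(1)] P(2) k(3) by auto
    show "0 \<le> P x"
      using derivative_le_imp_increment_le[OF that, of P "\<lambda>x. 2 * k x / \<sigma> x * exp (2 * G x)" "\<lambda>_. 0" "\<lambda>_. 0", OF P(1)] P(2) k(3) by auto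
  qed
  have Ppos: "0 \<le> P x" for x
  proof (cases "0 \<le> x")
    case True
    show ?thesis
      using derivative_le_imp_increment_le[OF True, of "\<lambda>_. 0" "\<lambda>_. 0" P "\<lambda>x. 2 * k x / \<sigma> x * exp (2 * G x)", OF _ P(1)] P(2) k(1) pos(2)
      by (auto simp: less_imp_le)
  qed (use P0 in simp)
  define V where "V x = exp (- 2 * G x) * P x" for x
  define V1 where "V1 x = - 2 * b x / (\<sigma> x)\<^sup>2 * V x + 2 * k x / \<sigma> x" for x
  have V1: "(V has_real_derivative V1 x) (at x)" for x
  proof -
    have "(V has_real_derivative (- 2 * (b x / (\<sigma> x)\<^sup>2)) * exp (- 2 * G x) * P x
       + exp (- 2 * G x) * (2 * k x / \<sigma> x * exp (2 * G x))) (at x)"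
      unfolding V_def[abs_def] by (auto intro!: derivative_eq_intros G P(1) simp: mult_ac)
    moreover have eq: "exp (- 2 * G x) * (2 * k x / \<sigma> x * exp (2 * G x)) = 2 * k x / \<sigma> x"
      by (simp add: exp_minus)
    have "(- 2 * (b x / (\<sigma> x)\<^sup>2)) * exp (- 2 * G x) * P x
       + exp (- 2 * G x) * (2 * k x / \<sigma> x * exp (2 * G x)) = V1 x"
      unfolding V1_def V_def eq by simp
    ultimately show ?thesis by simp
  qed
  have V0: "0 \<le> V x" for x using Ppos by (simp add: V_def)
  have Vc: "continuous_on UNIV V" using V1 by (intro DERIV_continuous_on) auto
  define v where "v x = V x / \<sigma> x" for x
  define v1 where "v1 x = (V1 x * \<sigma> x - V x * \<sigma>1 x) / (\<sigma> x)\<^sup>2" for x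
  have v1: "(v has_real_derivative v1 x) (at x)" for x
    unfolding v_def[abs_def] v1_def using nz
    by (auto intro!: derivative_eq_intros V1 \<sigma>1 simp: power2_eq_square)
  have v1c: "continuous_on UNIV v1"
    unfolding v1_def[abs_def] V1_def using nz by (intro continuous_intros bc \<sigma>c \<sigma>1 kc Vc) auto
  have v0: "0 \<le> v x" for x using V0[of x] pos(2)[of x] by (simp add: v_def)
  have vc: "continuous_on UNIV v" using v1 by (intro DERIV_continuous_on) auto
  have gen: "v x * (b x + 1/2 * \<sigma> x * \<sigma>1 x) + v1 x * (\<sigma> x)\<^sup>2 / 2 = k x" for x
    unfolding v_def v1_def V1_def using nz[of x] by (simp add: field_simps power2_eq_square)
  obtain \<Phi> where \<Phi>: "\<And>x. (\<Phi> has_real_derivative v x) (at x)" "\<Phi> 0 = 0"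
    using continuous_antiderivative[OF vc] by blast
  have bic: "continuous_on UNIV (\<lambda>x. 1 / b x)" using nz by (intro continuous_intros bc) auto
  obtain B where B: "\<And>x. (B has_real_derivative 1 / b x) (at x)" "B 0 = 0"
    using continuous_antiderivative[OF bic] by blast
  obtain C where C: "(\<integral>\<^sup>+z\<in>{0..}. ennreal (1 / b z) \<partial>lborel) = ennreal C" "0 \<le> C"
    using fin by (metis ennreal_cases infinity_ennreal_def less_irrefl)
  have \<Phi>C: "\<Phi> x \<le> C" for x
  proof (cases "0 \<le> x")
    case True
    have "(\<Phi> x + (V x)\<^sup>2 / 4) - (\<Phi> 0 + (V 0)\<^sup>2 / 4) \<le> B x - B 0"
    proof (rule derivative_le_imp_increment_le[OF True])
      show "((\<lambda>x. \<Phi> x + (V x)\<^sup>2 / 4) has_real_derivative v z + V z * V1 z / 2) (at z)" for z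
        by (auto intro!: derivative_eq_intros \<Phi>(1) V1)
      show "(B has_real_derivative 1 / b z) (at z)" for z by (rule B)
      fix z
      have "V z * V1 z / 2 = - (b z / (\<sigma> z)\<^sup>2) * (V z)\<^sup>2 + k z * v z"
        unfolding V1_def v_def using nz[of z] by (simp add: field_simps power2_eq_square)
      moreover have "k z * v z \<le> v z" using k[of z] v0[of z] by (simp add: mult_left_le_one_le)
      moreover have "0 \<le> (b z * v z - 1)\<^sup>2 / b z" using pos(1)[of z] by simp
      moreover have "(b z * v z - 1)\<^sup>2 / b z = b z / (\<sigma> z)\<^sup>2 * (V z)\<^sup>2 - 2 * v z + 1 / b z"
        unfolding v_def using nz[of z] by (simp add: field_simps power2_eq_square)
      ultimately show "v z + V z * V1 z / 2 \<le> 1 / b z" by linarith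
    qed
    moreover have "V 0 = 0" using P(2) by (simp add: V_def)
    moreover have "B x - B 0 \<le> C"
      using pos(1) by (intro antiderivative_le_nn_integral[OF B(1) bic _ C True]) (simp add: less_imp_le)
    ultimately have "\<Phi> x + (V x)\<^sup>2 / 4 \<le> C" using \<Phi>(2) by simp
    then show ?thesis using zero_le_power2[of "V x"] by linarith
  next
    case False
    then have "0 - 0 \<le> \<Phi> 0 - \<Phi> x"
      using derivative_le_imp_increment_le[of x 0 "\<lambda>_. 0" "\<lambda>_. 0" \<Phi> v] \<Phi>(1) v0 by auto
    then show ?thesis using \<Phi>(2) C(2) by simp
  qed
  have u: "((\<lambda>x. C - \<Phi> x) has_real_derivative - v x) (at x)" for x
    by (auto intro!: derivative_eq_intros \<Phi>(1))
  have u0: "0 \<le> C - \<Phi> x" for x using \<Phi>C[of x] by simp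
  show ?thesis using that[OF u v1 v1c v0 u0] gen unfolding k_def by blast
qed

text \<open>
  The truncation f starts from the value of u at \<open>x0\<close>.  It is nonincreasing, and less steep than u, so to the
  right of \<open>x0\<close> it lies above u and to the left it lies above \<open>u x0\<close>.
\<close>
lemma lyapunov_test_function:
  fixes b \<sigma> \<sigma>1 u v v1 :: "real \<Rightarrow> real"
  assumes u: "\<And>x. (u has_real_derivative - v x) (at x)" and v: "\<And>x. (v has_real_derivative v1 x) (at x)"
    and v1: "continuous_on UNIV v1" and v0: "\<And>x. 0 \<le> v x" and u0: "\<And>x. 0 \<le> u x"
    and gen: "\<And>x. v x * \<mu> x + v1 x * (\<sigma> x)\<^sup>2 / 2 = max 0 (min 1 x)" and "0 \<le> R"
  obtains f f1 f2 C where "test_function f f1 f2 C" "f x0 = u x0" "\<And>x. 0 \<le> f x"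
    "\<And>x. \<bar>x\<bar> \<le> R \<Longrightarrow> f1 x * \<mu> x + f2 x * (\<sigma> x)\<^sup>2 / 2 \<le> 0"
    "\<And>x. \<bar>x\<bar> \<le> R \<Longrightarrow> 1 \<le> x \<Longrightarrow> f1 x * \<mu> x + f2 x * (\<sigma> x)\<^sup>2 / 2 \<le> - 1"
proof -
  have w: "((\<lambda>x. - v x) has_real_derivative - v1 x) (at x)" for x
    by (auto intro!: derivative_eq_intros v)
  have w1: "continuous_on UNIV (\<lambda>x. - v1 x)" by (intro continuous_intros v1)
  obtain g f1 f2 C \<kappa> where tf: "test_function g f1 f2 C" and f1: "\<And>x. f1 x = - v x * \<kappa> x"
    and \<kappa>: "\<And>x. 0 \<le> \<kappa> x \<and> \<kappa> x \<le> 1"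
    and f12: "\<And>x. \<bar>x\<bar> \<le> R \<Longrightarrow> f1 x = - v x \<and> f2 x = - v1 x"
    using truncated_test_function[OF w w1 \<open>0 \<le> R\<close>] by metis
  define f where "f x = u x0 + (g x - g x0)" for x
  have fD: "(f has_real_derivative f1 x) (at x)" for x
    unfolding f_def[abs_def] by (auto intro!: derivative_eq_intros test_functionD(1)[OF tf])
  have tf': "test_function f f1 f2 C" using tf fD unfolding test_function_def by auto
  have f0: "0 \<le> f x" for x
  proof (cases "x0 \<le> x")
    case True
    have "u x - u x0 \<le> f x - f x0"
    proof (rule derivative_le_imp_increment_le[OF True u fD])
      fix z show "- v z \<le> f1 z" unfolding f1 using \<kappa>[of z] v0[of z] by (simp add: mult_left_le)
    qed
    then show ?thesis using u0[of x] by (simp add: f_def)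
  next
    case False
    then have "f x0 - f x \<le> 0 - 0"
      using \<kappa> v0 fD by (intro derivative_le_imp_increment_le[of x x0 f f1 "\<lambda>_. 0" "\<lambda>_. 0"]) (auto simp: f1)
    then show ?thesis using u0[of x0] by (simp add: f_def)
  qed
  have L: "f1 x * \<mu> x + f2 x * (\<sigma> x)\<^sup>2 / 2 = - max 0 (min 1 x)" if "\<bar>x\<bar> \<le> R" for x
    using gen[of x] f12[OF that] by simp
  show ?thesis
    by (rule that[OF tf' _ f0]) (use L in \<open>auto simp: f_def\<close>)
qed

section \<open>Brownian motion on the survival event and explosion\<close>

context brownian_motion
begin

text \<open>
  After division by its standard deviation, every increment has the same law, which charges \<open>[1, \<infinity>)\<close>.
\<close>
lemma increment_exceeds_std_deviation:
  obtains p0 where "0 < p0"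
    "\<And>s t m. 0 \<le> s \<Longrightarrow> s < t \<Longrightarrow> m \<le> sqrt (t - s) \<Longrightarrow> p0 \<le> prob {\<omega> \<in> space M. m \<le> W t \<omega> - W s \<omega>}"
proof -
  let ?N = "\<integral>\<^sup>+x\<in>{1..}. ennreal (std_normal_density x) \<partial>lborel"
  have eq: "emeasure M {\<omega> \<in> space M. 1 \<le> (W t \<omega> - W s \<omega>) / sqrt (t - s)} = ?N" if "0 \<le> s" "s < t" for s t
  proof -
    have "0 < sqrt (t - s)" using that by simp
    then have D: "distributed M lborel (\<lambda>\<omega>. (W t \<omega> - W s \<omega>) / sqrt (t - s)) std_normal_density"
      using normal_standard_normal_convert[of "sqrt (t - s)" "\<lambda>\<omega>. W t \<omega> - W s \<omega>" 0] bm_gaussian[OF that] by simp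
    have "emeasure M ((\<lambda>\<omega>. (W t \<omega> - W s \<omega>) / sqrt (t - s)) -` {1..} \<inter> space M) = ?N"
      by (rule distributed_emeasure[OF D]) simp
    moreover have "(\<lambda>\<omega>. (W t \<omega> - W s \<omega>) / sqrt (t - s)) -` {1..} \<inter> space M
       = {\<omega> \<in> space M. 1 \<le> (W t \<omega> - W s \<omega>) / sqrt (t - s)}" by auto
    ultimately show ?thesis by simp
  qed
  have "?N \<noteq> 0"
  proof
    assume "?N = 0"
    then have "AE x in lborel. ennreal (std_normal_density x) * indicator {1..} x = 0"
      by (subst (asm) nn_integral_0_iff_AE) auto
    then have "AE x in lborel. x \<notin> {1..2::real}"
    proof eventually_elim
      case (elim x)
      have "0 < std_normal_density x" by (rule normal_density_pos) simp
      then show ?case using elim by (auto simp: indicator_def ennreal_eq_0_iff split: if_splits)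
    qed
    then have "{1..2::real} \<in> null_sets lborel" by (intro Measure_Space.AE_iff_null_sets[THEN iffD2]) auto
    then show False by (simp add: null_sets_def)
  qed
  have pr: "prob {\<omega> \<in> space M. 1 \<le> (W t \<omega> - W s \<omega>) / sqrt (t - s)} = enn2real ?N" if "0 \<le> s" "s < t" for s t
    unfolding eq[OF that, symmetric] by (simp add: measure_def)
  show ?thesis
  proof (rule that)
    define r where "r = prob {\<omega> \<in> space M. 1 \<le> (W 1 \<omega> - W 0 \<omega>) / sqrt (1 - 0)}"
    have r: "?N = ennreal r" "0 \<le> r"
      unfolding r_def using eq[of 0 1] by (simp_all add: emeasure_eq_measure)
    then have "r \<noteq> 0" using \<open>?N \<noteq> 0\<close> by auto
    then show "0 < enn2real ?N" unfolding r(1) using r(2) by simp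
    fix s t m :: real assume st: "0 \<le> s" "s < t" and m: "m \<le> sqrt (t - s)"
    have [measurable]: "(\<lambda>\<omega>. W t \<omega> - W s \<omega>) \<in> borel_measurable M"
      using W_increment_measurable[of s t t] st filtration_measurableD by auto
    have "1 \<le> x / sqrt (t - s) \<Longrightarrow> m \<le> x" for x
      using st m by (simp add: le_divide_eq)
    then show "enn2real ?N \<le> prob {\<omega> \<in> space M. m \<le> W t \<omega> - W s \<omega>}"
      unfolding pr[OF st, symmetric] by (intro finite_measure_mono) auto
  qed
qed

text \<open>
  The event A is approximated from outside by the event \<open>n < \<tau>\<close> of the past at time n.  A later
  increment that exceeds one standard deviation compensates for a bounded past increment, and it is
  independent of both.  The error of the approximation is chosen small compared with the probability p0
  of such an increment.
\<close>
lemma W_large_on_survival_event: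
  assumes \<tau>: "stopping_time F \<tau>"
  defines "A \<equiv> {\<omega> \<in> space M. \<tau> \<omega> = \<infinity>}"
  assumes A0: "0 < prob A"
  obtains a s0 where "0 < a" "\<And>s. s0 \<le> s \<Longrightarrow> a \<le> prob {\<omega> \<in> A. c \<le> W s \<omega> - W 0 \<omega>}"
proof -
  obtain p0 where p0: "0 < p0"
    "\<And>s t m. 0 \<le> s \<Longrightarrow> s < t \<Longrightarrow> m \<le> sqrt (t - s) \<Longrightarrow> p0 \<le> prob {\<omega> \<in> space M. m \<le> W t \<omega> - W s \<omega>}"
    using increment_exceeds_std_deviation by blast
  define An where "An n = {\<omega> \<in> space M. ennreal (real n) < \<tau> \<omega>}" for n :: nat
  have AnF: "An n \<in> sets (F (ennreal (real n)))" for n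
    using stopping_timeD2[OF \<tau>, of "ennreal (real n)"] by (simp add: An_def pred_def)
  have AnM: "An n \<in> sets M" for n using AnF filtration_subalgebra unfolding subalgebra_def by blast
  have IA: "(\<Inter>n. An n) = A"
  proof -
    have "\<tau> \<omega> = \<infinity>" if "\<forall>n. ennreal (real n) < \<tau> \<omega>" for \<omega>
    proof (rule ccontr)
      assume "\<tau> \<omega> \<noteq> \<infinity>"
      then obtain r where r: "\<tau> \<omega> = ennreal r" "0 \<le> r" by (cases "\<tau> \<omega>") auto
      obtain n where "r \<le> real n" using real_arch_simple by blast
      then have "\<tau> \<omega> \<le> ennreal (real n)" using r by (simp add: ennreal_leI)
      then show False using that not_less by blast
    qed
    then show ?thesis by (auto simp: An_def A_def less_top[symmetric])
  qed
  have AM: "A \<in> sets M" unfolding IA[symmetric] using AnM by auto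
  have sub: "A \<subseteq> An n" for n unfolding IA[symmetric] by auto
  have "decseq An"
  proof (rule antimonoI)
    fix i j :: nat assume "i \<le> j"
    then have "ennreal (real i) \<le> ennreal (real j)" by (intro ennreal_leI) simp
    then show "An j \<subseteq> An i" unfolding An_def using le_less_trans by blast
  qed
  then have "(\<lambda>n. prob (An n)) \<longlonglongrightarrow> prob A"
    using finite_Lim_measure_decseq[of An] AnM unfolding IA by auto
  then have "eventually (\<lambda>n. prob (An n) < prob A + p0 * prob A / 4) sequentially"
    using p0(1) A0 by (intro order_tendstoD(2)) auto
  from eventually_happens[OF this] obtain n where n: "prob (An n) < prob A + p0 * prob A / 4" by auto
  have [measurable]: "(\<lambda>\<omega>. W (real n) \<omega> - W 0 \<omega>) \<in> borel_measurable M"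
    using W_increment_measurable[of 0 "real n" "real n"] filtration_measurableD by auto
  define Bm where "Bm m = {\<omega> \<in> space M. W (real n) \<omega> - W 0 \<omega> < - real m}" for m :: nat
  have BmM: "Bm m \<in> sets M" for m unfolding Bm_def by measurable
  have "decseq Bm" by (rule antimonoI) (auto simp: Bm_def)
  moreover have "(\<Inter>m. Bm m) = {}"
  proof -
    have "\<exists>m::nat. \<not> x < - real m" for x
      using reals_Archimedean2[of "- x"] by (metis less_minus_iff not_less_iff_gr_or_eq)
    then show ?thesis by (fastforce simp: Bm_def)
  qed
  ultimately have "(\<lambda>m. prob (Bm m)) \<longlonglongrightarrow> 0"
    using finite_Lim_measure_decseq[of Bm] BmM by auto
  then have "eventually (\<lambda>m. prob (Bm m) < prob A / 2) sequentially"
    using A0 by (intro order_tendstoD(2)) auto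
  from eventually_happens[OF this] obtain m where m: "prob (Bm m) < prob A / 2" by auto
  define B where "B = An n - Bm m"
  have "W (real n) \<in> known_at (real n)" "W 0 \<in> known_at (real n)"
    using W_measurable[of "real n"] filtration_measurable_mono[OF W_measurable[of 0], of "ennreal (real n)"] by auto
  then have "Bm m \<in> sets (F (ennreal (real n)))"
    unfolding Bm_def space_filtration[of "ennreal (real n)", symmetric] by measurable
  then have BF: "B \<in> sets (F (ennreal (real n)))" unfolding B_def using AnF by auto
  have BM: "B \<in> sets M" unfolding B_def using AnM BmM by auto
  have "prob A \<le> prob (An n)" using sub AnM by (intro finite_measure_mono) auto
  also have "\<dots> \<le> prob (B \<union> Bm m)" using BM BmM by (intro finite_measure_mono sets.Un) (auto simp: B_def)
  also have "\<dots> \<le> prob B + prob (Bm m)" using BM BmM by (intro measure_Un_le) auto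
  finally have PB: "prob A / 2 \<le> prob B" using m by simp
  show ?thesis
  proof (rule that)
    show "0 < p0 * prob A / 4" using p0(1) A0 by simp
    fix s assume s: "real n + 1 + (c + real m)\<^sup>2 \<le> s"
    have ns: "real n < s" using s zero_le_power2[of "c + real m"] by linarith
    define E where "E = {\<omega> \<in> space M. c + real m \<le> W s \<omega> - W (real n) \<omega>}"
    have "c + real m \<le> sqrt ((c + real m)\<^sup>2)" by simp
    also have "\<dots> \<le> sqrt (s - real n)" using s by (intro real_sqrt_le_mono) simp
    finally have PE: "p0 \<le> prob E" unfolding E_def using ns by (intro p0(2)) auto
    have "E \<in> sets (vimage_algebra (space M) (\<lambda>\<omega>. W s \<omega> - W (real n) \<omega>) borel)"
    proof -
      have "E = (\<lambda>\<omega>. W s \<omega> - W (real n) \<omega>) -` {c + real m..} \<inter> space M" unfolding E_def by auto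
      then show ?thesis using in_vimage_algebra[of "{c + real m..}" borel] by auto
    qed
    then have ind: "prob (B \<inter> E) = prob B * prob E" and EM: "E \<in> sets M"
      using bm_independent[of "real n" s] ns BF unfolding indep_sets2_eq by auto
    have W0M [measurable]: "(\<lambda>\<omega>. W s \<omega> - W 0 \<omega>) \<in> borel_measurable M"
      using W_increment_measurable[of 0 s s] ns filtration_measurableD by auto
    have LM: "{\<omega> \<in> A. c \<le> W s \<omega> - W 0 \<omega>} \<in> sets M"
    proof -
      have "{\<omega> \<in> A. c \<le> W s \<omega> - W 0 \<omega>} = A \<inter> {\<omega> \<in> space M. c \<le> W s \<omega> - W 0 \<omega>}"
        by (auto simp: A_def)
      then show ?thesis using AM by simp
    qed
    have "B \<inter> E \<subseteq> {\<omega> \<in> A. c \<le> W s \<omega> - W 0 \<omega>} \<union> (An n - A)"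
      by (auto simp: B_def Bm_def E_def)
    then have "prob (B \<inter> E) \<le> prob ({\<omega> \<in> A. c \<le> W s \<omega> - W 0 \<omega>} \<union> (An n - A))"
      using LM AnM AM by (intro finite_measure_mono) auto
    also have "\<dots> \<le> prob {\<omega> \<in> A. c \<le> W s \<omega> - W 0 \<omega>} + prob (An n - A)"
      using LM AnM AM by (intro measure_Un_le) auto
    also have "prob (An n - A) = prob (An n) - prob A"
      by (rule finite_measure_Diff[OF AnM AM sub])
    also have "\<dots> \<le> p0 * prob A / 4" using n by simp
    finally have "prob B * prob E \<le> prob {\<omega> \<in> A. c \<le> W s \<omega> - W 0 \<omega>} + p0 * prob A / 4"
      unfolding ind by simp
    moreover have "p0 * prob A / 2 \<le> prob B * prob E"
      using mult_mono[OF PB PE] A0 p0(1) by (simp add: mult.commute)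
    ultimately show "p0 * prob A / 4 \<le> prob {\<omega> \<in> A. c \<le> W s \<omega> - W 0 \<omega>}" by simp
  qed
qed

end

text \<open>
  The comparison function \<open>\<psi>\<close> starts to grow one unit after s0 because the first cell that starts after
  s0 may be preceded by one that contains s0 and has length up to 1.
\<close>
lemma grid_sum_tail_lower_bound:
  assumes g: "time_grid q N T 1" and "0 \<le> s0" "0 \<le> a"
    and w: "\<And>j. j < N \<Longrightarrow> 0 \<le> w j" "\<And>j. j < N \<Longrightarrow> s0 \<le> q j \<Longrightarrow> a \<le> w j"
  shows "a * (T - s0 - 1) \<le> (\<Sum>j<N. w j * (q (Suc j) - q j))"
proof -
  define \<psi> where "\<psi> x = a * max 0 (x - s0 - 1)" for x
  have "a * (T - s0 - 1) \<le> \<psi> T - \<psi> 0"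
    using \<open>0 \<le> s0\<close> \<open>0 \<le> a\<close> by (simp add: \<psi>_def mult_left_mono)
  also have "\<dots> = (\<Sum>j<N. \<psi> (q (Suc j)) - \<psi> (q j))"
    using g sum_lessThan_telescope[of "\<lambda>j. \<psi> (q j)" N] by (simp add: time_grid_def)
  also have "\<dots> \<le> (\<Sum>j<N. w j * (q (Suc j) - q j))"
  proof (rule sum_mono)
    fix j assume "j \<in> {..<N}"
    then have j: "j < N" by simp
    note st = time_grid_step[OF g j]
    show "\<psi> (q (Suc j)) - \<psi> (q j) \<le> w j * (q (Suc j) - q j)"
    proof (cases "s0 \<le> q j")
      case True
      have "\<psi> (q (Suc j)) - \<psi> (q j) = a * (max 0 (q (Suc j) - s0 - 1) - max 0 (q j - s0 - 1))"
        by (simp add: \<psi>_def algebra_simps)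
      also have "\<dots> \<le> a * (q (Suc j) - q j)" using st \<open>0 \<le> a\<close> by (intro mult_left_mono) auto
      also have "\<dots> \<le> w j * (q (Suc j) - q j)" using w(2)[OF j True] st by (intro mult_right_mono) auto
      finally show ?thesis .
    next
      case False
      then have "\<psi> (q (Suc j)) = 0" "\<psi> (q j) = 0" using st by (auto simp: \<psi>_def)
      then show ?thesis using w(1)[OF j] st by simp
    qed
  qed
  finally show ?thesis .
qed

theorem proposition5p1:
  fixes M :: "'a measure" and F :: "ennreal \<Rightarrow> 'a measure" and W :: "real \<Rightarrow> 'a \<Rightarrow> real"
    and b \<sigma> :: "real \<Rightarrow> real" and x0 :: real
    and X :: "real \<Rightarrow> 'a \<Rightarrow> real" and \<tau> :: "'a \<Rightarrow> ennreal"
  assumes "brownian_motion M F W"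
    and "locally_lipschitz b"
    and "\<sigma> C1_differentiable_on UNIV"
    and "locally_lipschitz (deriv \<sigma>)"
    and "\<And>x. 0 < b x"
    and "\<And>x. 0 < \<sigma> x"
    and "(\<integral>\<^sup>+z\<in>{0..}. ennreal (1 / b z) \<partial>lborel) < \<infinity>"
    and "stratonovich_maximal_solution M F W b \<sigma> x0 X \<tau>"
  shows "measure M {\<omega> \<in> space M. \<tau> \<omega> < \<infinity>} = 1"
proof -
  interpret brownian_motion M F W by (rule assms(1))
  define \<mu> where "\<mu> x = b x + 1/2 * \<sigma> x * deriv \<sigma> x" for x
  have bc: "continuous_on UNIV b" and \<sigma>1c: "continuous_on UNIV (deriv \<sigma>)"
    using local_lipschitz_continuous_on[OF assms(2)] local_lipschitz_continuous_on[OF assms(4)] by auto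
  have \<sigma>1: "(\<sigma> has_real_derivative deriv \<sigma> x) (at x)" for x
    using assms(3) by (auto simp: C1_differentiable_on_eq DERIV_deriv_iff_real_differentiable)
  have \<sigma>c: "continuous_on UNIV \<sigma>" using \<sigma>1 by (intro DERIV_continuous_on) auto
  have \<mu>c: "continuous_on UNIV \<mu>" unfolding \<mu>_def[abs_def] by (intro continuous_intros bc \<sigma>c \<sigma>1c)
  have nz: "\<sigma> x \<noteq> 0" for x using assms(6)[of x] by simp
  have "ito_local_solution M F W \<mu> \<sigma> x0 X \<tau>"
    using assms(8) unfolding stratonovich_maximal_solution_def stratonovich_local_solution_def \<mu>_def by blast
  then obtain Tn where \<tau>: "stopping_time F \<tau>"
    and XM: "\<And>t. 0 \<le> t \<Longrightarrow> X t \<in> borel_measurable (restrict_space (F (ennreal t)) {\<omega> \<in> space M. ennreal t < \<tau> \<omega>})"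
    and Xc: "AE \<omega> in M. X 0 \<omega> = x0 \<and> continuous_on {t. 0 \<le> t \<and> ennreal t < \<tau> \<omega>} (\<lambda>t. X t \<omega>)"
    and Tn: "\<And>n::nat. stopping_time F (Tn n)"
      "AE \<omega> in M. incseq (\<lambda>n. Tn n \<omega>) \<and> (\<forall>n. Tn n \<omega> < \<tau> \<omega>) \<and> (\<lambda>n. Tn n \<omega>) \<longlonglongrightarrow> \<tau> \<omega>"
    and eqn: "\<And>n. \<exists>I. has_ito_integral M F W (\<lambda>s \<omega>. if ennreal s \<le> Tn n \<omega> then \<sigma> (X s \<omega>) else 0) I \<and>
           (AE \<omega> in M. \<forall>t\<ge>0. ennreal t \<le> Tn n \<omega> \<longrightarrow>
              X t \<omega> = x0 + (LBINT s:{0..t}. \<mu> (X s \<omega>)) + I t \<omega>)"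
    unfolding ito_local_solution_def by blast
  \<comment> \<open>outside its lifetime \<open>X\<close> is set to 0, which makes it adapted at all times\<close>
  define X' where "X' t \<omega> = (if ennreal t < \<tau> \<omega> then X t \<omega> else 0)" for t \<omega>
  have X'a: "adapted F X'"
    unfolding adapted_def
  proof (intro allI impI)
    fix t :: real assume "0 \<le> t"
    have s: "{\<omega> \<in> space M. ennreal t < \<tau> \<omega>} \<in> sets (F (ennreal t))"
      using stopping_timeD2[OF \<tau>, of "ennreal t"] by (simp add: pred_def)
    then have s': "{\<omega> \<in> space M. ennreal t < \<tau> \<omega>} \<inter> space (F (ennreal t)) \<in> sets (F (ennreal t))"
      by (rule sets.Int[OF _ sets.top])
    have "(\<lambda>\<omega>. indicator {\<omega> \<in> space M. ennreal t < \<tau> \<omega>} \<omega> *\<^sub>R X t \<omega>) \<in> known_at t"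
      using XM[OF \<open>0 \<le> t\<close>] borel_measurable_restrict_space_iff[OF s', of "X t"] by simp
    then show "X' t \<in> known_at t"
      by (rule measurable_cong[THEN iffD1, rotated]) (auto simp: X'_def indicator_def)
  qed
  have loc: "\<exists>I. localized_sde M F W X' (\<lambda>s \<omega>. if ennreal s \<le> Tn n \<omega> then \<sigma> (X s \<omega>) else 0) I \<mu> \<sigma> x0 (Tn n)" for n
  proof -
    obtain I where I: "has_ito_integral M F W (\<lambda>s \<omega>. if ennreal s \<le> Tn n \<omega> then \<sigma> (X s \<omega>) else 0) I"
      and IX: "AE \<omega> in M. \<forall>t\<ge>0. ennreal t \<le> Tn n \<omega> \<longrightarrow> X t \<omega> = x0 + (LBINT s:{0..t}. \<mu> (X s \<omega>)) + I t \<omega>"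
      using eqn[of n] by blast
    have "localized_sde M F W X' (\<lambda>s \<omega>. if ennreal s \<le> Tn n \<omega> then \<sigma> (X s \<omega>) else 0) I \<mu> \<sigma> x0 (Tn n)"
    proof
      show "adapted F X'" by (rule X'a)
      show "stopping_time F (Tn n)" by (rule Tn)
      show "continuous_on UNIV \<mu>" "continuous_on UNIV \<sigma>" by fact+
      show "has_ito_integral M F W (\<lambda>s \<omega>. if ennreal s \<le> Tn n \<omega> then \<sigma> (X s \<omega>) else 0) I" by (rule I)
      show "AE \<omega> in M. \<forall>s\<ge>0. (if ennreal s \<le> Tn n \<omega> then \<sigma> (X s \<omega>) else 0) = (if ennreal s \<le> Tn n \<omega> then \<sigma> (X' s \<omega>) else 0)"
        using Tn(2) by eventually_elim (auto simp: X'_def dest: le_less_trans)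
      show "AE \<omega> in M. continuous_on {t. 0 \<le> t \<and> ennreal t \<le> Tn n \<omega>} (\<lambda>t. X' t \<omega>)"
        using Tn(2) Xc
      proof eventually_elim
        case (elim \<omega>)
        then have lt: "ennreal t < \<tau> \<omega>" if "ennreal t \<le> Tn n \<omega>" for t using that le_less_trans by blast
        have "continuous_on {t. 0 \<le> t \<and> ennreal t \<le> Tn n \<omega>} (\<lambda>t. X t \<omega>)"
          by (rule continuous_on_subset[of "{t. 0 \<le> t \<and> ennreal t < \<tau> \<omega>}"]) (use elim lt in auto)
        then show ?case by (rule continuous_on_cong[THEN iffD1, rotated 2]) (use lt in \<open>auto simp: X'_def\<close>)
      qed
      show "AE \<omega> in M. \<forall>t\<ge>0. ennreal t \<le> Tn n \<omega> \<longrightarrow> X' t \<omega> = x0 + (LBINT s:{0..t}. \<mu> (X' s \<omega>)) + I t \<omega>"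
        using Tn(2) IX
      proof eventually_elim
        case (elim \<omega>)
        show ?case
        proof (intro allI impI)
          fix t assume t: "0 \<le> t" "ennreal t \<le> Tn n \<omega>"
          have lt: "ennreal s < \<tau> \<omega>" if "s \<le> t" for s
            using ennreal_leI[OF that] t(2) elim(1) by (meson le_less_trans order_trans)
          have "(LBINT s:{0..t}. \<mu> (X' s \<omega>)) = (LBINT s:{0..t}. \<mu> (X s \<omega>))"
            by (rule set_lebesgue_integral_cong) (auto simp: X'_def lt)
          then show "X' t \<omega> = x0 + (LBINT s:{0..t}. \<mu> (X' s \<omega>)) + I t \<omega>"
            using elim(2) t lt[of t] by (simp add: X'_def)
        qed
      qed
    qed
    then show ?thesis by blast
  qed
  have \<tau>M: "\<tau> \<in> borel_measurable M"
    by (rule measurable_stopping_time[OF \<tau>]) (use filtration_subalgebra in \<open>auto simp: subalgebra_def\<close>)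
  define A where "A = {\<omega> \<in> space M. \<tau> \<omega> = \<infinity>}"
  have AM: "A \<in> sets M" unfolding A_def using \<tau>M by measurable
  have "prob A = 0"
  proof (rule ccontr)
    assume "prob A \<noteq> 0"
    then have A0: "0 < prob A" by (simp add: zero_less_measure_iff)
    have "continuous_on UNIV (\<lambda>x. 1 / \<sigma> x)" using nz by (intro continuous_intros \<sigma>c) auto
    then obtain S where S: "\<And>x. (S has_real_derivative 1 / \<sigma> x) (at x)" using continuous_antiderivative by blast
    have Smono: "S x < S y" if "x < y" for x y
      using that by (rule DERIV_pos_imp_increasing) (use S assms(6) in \<open>auto intro!: exI[of _ "1 / \<sigma> _"]\<close>)
    obtain u v v1 where u: "\<And>x. (u has_real_derivative - v x) (at x)" "\<And>x. (v has_real_derivative v1 x) (at x)"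
      "continuous_on UNIV v1" "\<And>x. 0 \<le> v x" "\<And>x. 0 \<le> u x"
      and gen: "\<And>x. v x * (b x + 1/2 * \<sigma> x * deriv \<sigma> x) + v1 x * (\<sigma> x)\<^sup>2 / 2 = max 0 (min 1 x)"
      by (rule lyapunov_function[OF bc \<sigma>1 \<sigma>1c assms(5,6,7)]) blast
    define c where "c = S 1 - S x0"
    obtain a s1 where a: "0 < a" "\<And>s. s1 \<le> s \<Longrightarrow> a \<le> prob {\<omega> \<in> A. c \<le> W s \<omega> - W 0 \<omega>}"
      unfolding A_def by (rule W_large_on_survival_event[OF \<tau> A0[unfolded A_def], of c]) blast
    define s0 where "s0 = max 1 s1"
    \<comment> \<open>large enough for the lower bound \<open>a / 2 * (T - s0 - 1)\<close> to exceed the upper bound \<open>u x0 + 1\<close>\<close>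
    define T where "T = s0 + 2 + 2 * (u x0 + 1) / a"
    have "0 \<le> 2 * (u x0 + 1) / a" "1 \<le> s0" using u(5)[of x0] a(1) by (auto simp: s0_def)
    then have T: "0 < T" unfolding T_def by linarith
    \<comment> \<open>\<open>G n\<close> is the part of \<open>A\<close> on which the localisation with bound \<open>n\<close> is not felt before \<open>T\<close>; it is described
      through rational times to be measurable, and the null set \<open>Nl\<close> of discontinuous paths is removed\<close>
    define P where "P \<omega> \<longleftrightarrow> continuous_on {t. 0 \<le> t \<and> ennreal t < \<tau> \<omega>} (\<lambda>t. X t \<omega>)" for \<omega>
    have "AE \<omega> in M. P \<omega>" using Xc unfolding P_def by eventually_elim simp
    then obtain Nl where Nl: "{\<omega> \<in> space M. \<not> P \<omega>} \<subseteq> Nl" "Nl \<in> null_sets M"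
      by (elim AE_E) (auto intro: null_setsI)
    define G where "G n = {\<omega> \<in> A. ennreal T < Tn n \<omega> \<and> (\<forall>t\<in>{0<..<T} \<inter> \<rat>. \<bar>X' t \<omega>\<bar> \<le> real n)} - Nl" for n
    have contX': "continuous_on {0..T} (\<lambda>t. X' t \<omega>)" if "\<omega> \<in> A" "P \<omega>" for \<omega>
    proof -
      have "continuous_on {0..T} (\<lambda>t. X t \<omega>)"
        using that unfolding P_def A_def by (elim continuous_on_subset) auto
      then show ?thesis using that unfolding A_def X'_def by simp
    qed
    have TnM [measurable]: "Tn n \<in> borel_measurable M" for n
      by (rule measurable_stopping_time[OF Tn(1)]) (use filtration_subalgebra in \<open>auto simp: subalgebra_def\<close>)
    have X'M: "X' t \<in> borel_measurable M" if "0 \<le> t" for t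
      using X'a that filtration_measurableD unfolding adapted_def by blast
    have GM: "G n \<in> sets M" for n
    proof -
      have "{\<omega> \<in> space M. \<forall>t\<in>{0<..<T} \<inter> \<rat>. \<bar>X' t \<omega>\<bar> \<le> real n} \<in> sets M"
      proof (rule sets.sets_Collect_countable_All')
        show "countable ({0<..<T} \<inter> \<rat>)" by (intro countable_Int2 countable_rat)
        fix t assume "t \<in> {0<..<T} \<inter> \<rat>"
        then have "0 \<le> t" by auto
        note [measurable] = X'M[OF this]
        show "{\<omega> \<in> space M. \<bar>X' t \<omega>\<bar> \<le> real n} \<in> sets M" by measurable
      qed
      then have [measurable]: "Measurable.pred M (\<lambda>\<omega>. \<forall>t\<in>{0<..<T} \<inter> \<rat>. \<bar>X' t \<omega>\<bar> \<le> real n)"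
        by (simp add: pred_def)
      have "{\<omega> \<in> space M. ennreal T < Tn n \<omega> \<and> (\<forall>t\<in>{0<..<T} \<inter> \<rat>. \<bar>X' t \<omega>\<bar> \<le> real n)} \<in> sets M"
        by measurable
      moreover have "G n = A \<inter> {\<omega> \<in> space M. ennreal T < Tn n \<omega> \<and> (\<forall>t\<in>{0<..<T} \<inter> \<rat>. \<bar>X' t \<omega>\<bar> \<le> real n)} - Nl"
        unfolding G_def A_def by auto
      ultimately show ?thesis using AM Nl(2) by auto
    qed
    have Gb: "\<bar>X' t \<omega>\<bar> \<le> real n" if "\<omega> \<in> G n" "0 \<le> t" "t \<le> T" for n \<omega> t
    proof -
      have w: "\<omega> \<in> A" "P \<omega>" "\<forall>t\<in>{0<..<T} \<inter> \<rat>. \<bar>X' t \<omega>\<bar> \<le> real n"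
        using that(1) Nl(1) unfolding G_def A_def by auto
      have "ennreal \<bar>X' t \<omega>\<bar> \<le> (SUP t\<in>{0..T}. ennreal \<bar>X' t \<omega>\<bar>)" using that by (intro SUP_upper) auto
      also have "\<dots> = (SUP t\<in>{0<..<T} \<inter> \<rat>. ennreal \<bar>X' t \<omega>\<bar>)"
        by (rule continuous_SUP_eq_rational_SUP[OF T contX'[OF w(1,2)]])
      also have "\<dots> \<le> ennreal (real n)" using w(3) by (intro SUP_least ennreal_leI) auto
      finally show ?thesis by simp
    qed
    have "(\<lambda>n. prob {\<omega> \<in> space M. 1/2 < (indicator (A - G n) \<omega> :: real)}) \<longlonglongrightarrow> 0"
    proof (rule AE_tendsto_zero_imp_tail_tendsto_zero)
      show "(indicator (A - G n) :: 'a \<Rightarrow> real) \<in> borel_measurable M" for n using AM GM by measurable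
      show "AE \<omega> in M. (\<lambda>n. indicator (A - G n) \<omega> :: real) \<longlonglongrightarrow> 0"
        using Tn(2) AE_not_in[OF Nl(2)] AE_space
      proof eventually_elim
        case (elim \<omega>)
        have "eventually (\<lambda>n. \<omega> \<notin> A - G n) sequentially"
        proof (cases "\<omega> \<in> A")
          case True
          have "P \<omega>" using elim Nl(1) by auto
          then have "bounded ((\<lambda>t. X' t \<omega>) ` {0..T})"
            using contX'[OF True] by (intro compact_imp_bounded compact_continuous_image) auto
          then obtain K where K: "\<And>t. t \<in> {0..T} \<Longrightarrow> \<bar>X' t \<omega>\<bar> \<le> K" unfolding bounded_iff by fastforce
          obtain k where k: "K \<le> real k" using real_arch_simple by blast
          have "eventually (\<lambda>n. ennreal T < Tn n \<omega>) sequentially"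
            using elim(1) True by (intro order_tendstoD(1)[of _ "\<tau> \<omega>"]) (auto simp: A_def)
          moreover have "eventually (\<lambda>n. k \<le> n) sequentially" by (rule eventually_ge_at_top)
          ultimately show ?thesis
          proof eventually_elim
            case (elim n)
            have "\<bar>X' t \<omega>\<bar> \<le> real n" if "t \<in> {0<..<T} \<inter> \<rat>" for t
              using K[of t] that k elim(2) by fastforce
            then show ?case using elim True \<open>\<omega> \<notin> Nl\<close> unfolding G_def by auto
          qed
        qed simp
        then have "eventually (\<lambda>n. indicator (A - G n) \<omega> = (0::real)) sequentially"
          by (rule eventually_mono) simp
        then show ?case by (rule tendsto_eventually)
      qed
    qed simp
    moreover have "{\<omega> \<in> space M. 1/2 < (indicator (A - G n) \<omega> :: real)} = A - G n" for n
      using sets.sets_into_space[OF AM] by (auto simp: indicator_def)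
    ultimately have "(\<lambda>n. prob (A - G n)) \<longlonglongrightarrow> 0" by simp
    then have "eventually (\<lambda>n. prob (A - G n) < a / 2) sequentially"
      using a(1) by (intro order_tendstoD(2)) auto
    moreover obtain k where k: "\<bar>x0\<bar> \<le> real k" using real_arch_simple by blast
    have "eventually (\<lambda>n. k \<le> n) sequentially" by (rule eventually_ge_at_top)
    ultimately have "eventually (\<lambda>n. prob (A - G n) < a / 2 \<and> k \<le> n) sequentially" by (rule eventually_conj)
    from eventually_happens[OF this] obtain n where n: "prob (A - G n) < a / 2" "k \<le> n" by auto
    define R where "R = real n"
    have R: "0 \<le> R" "\<bar>x0\<bar> \<le> R" using k n(2) by (auto simp: R_def)
    obtain I where "localized_sde M F W X' (\<lambda>s \<omega>. if ennreal s \<le> Tn n \<omega> then \<sigma> (X s \<omega>) else 0) I \<mu> \<sigma> x0 (Tn n)"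
      using loc by blast
    then interpret L: localized_sde M F W X' "\<lambda>s \<omega>. if ennreal s \<le> Tn n \<omega> then \<sigma> (X s \<omega>) else 0" I \<mu> \<sigma> x0 "Tn n" .
    have cont: "L.contained_until t R (G n)" if "t \<le> T" for t
      unfolding L.contained_until_def
    proof (intro conjI ballI allI impI)
      show "G n \<in> sets M" by (rule GM)
      fix \<omega> assume w: "\<omega> \<in> G n"
      show "ennreal t < Tn n \<omega>" using w ennreal_leI[OF that] unfolding G_def by (auto elim: le_less_trans)
      show "\<bar>X' r \<omega>\<bar> \<le> R" if "0 \<le> r" "r \<le> t" for r
        using Gb[OF w that(1)] that(2) \<open>t \<le> T\<close> unfolding R_def by simp
    qed
    obtain f f1 f2 C where sc: "test_function f f1 f2 C" "\<And>x. \<bar>x\<bar> \<le> R \<Longrightarrow> f1 x * \<sigma> x = 1"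
      "\<And>x. \<bar>x\<bar> \<le> R \<Longrightarrow> 0 \<le> f1 x * (b x + 1/2 * \<sigma> x * deriv \<sigma> x) + f2 x * (\<sigma> x)\<^sup>2 / 2"
      "\<And>x. \<bar>x\<bar> \<le> R \<Longrightarrow> f x - f x0 = S x - S x0"
      by (rule scale_test_function[where b = b, OF \<sigma>1 \<sigma>1c assms(5,6) S R]) blast
    have dom: "AE \<omega> in M. \<omega> \<in> G n \<longrightarrow> W t \<omega> - W 0 \<omega> \<le> S (X' t \<omega>) - S x0" if "0 < t" "t \<le> T" for t
    proof -
      have "AE \<omega> in M. \<omega> \<in> G n \<longrightarrow> W t \<omega> - W 0 \<omega> \<le> f (X' t \<omega>) - f x0"
        by (rule L.transformed_solution_dominates_W[OF sc(1) that(1) cont[OF that(2)]])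
          (use sc(2,3) in \<open>auto simp: \<mu>_def\<close>)
      then show ?thesis
      proof eventually_elim
        case (elim \<omega>)
        then show ?case using sc(4)[of "X' t \<omega>"] Gb[of \<omega> n t] that unfolding R_def by auto
      qed
    qed
    obtain g g1 g2 D where ly: "test_function g g1 g2 D" "g x0 = u x0" "\<And>x. 0 \<le> g x"
      "\<And>x. \<bar>x\<bar> \<le> R \<Longrightarrow> g1 x * \<mu> x + g2 x * (\<sigma> x)\<^sup>2 / 2 \<le> 0"
      "\<And>x. \<bar>x\<bar> \<le> R \<Longrightarrow> 1 \<le> x \<Longrightarrow> g1 x * \<mu> x + g2 x * (\<sigma> x)\<^sup>2 / 2 \<le> - 1"
      by (rule lyapunov_test_function[OF u gen[folded \<mu>_def] R(1), of x0]) blast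
    obtain q N where q: "time_grid q N T 1"
      and occ: "(\<Sum>j<N. prob {\<omega> \<in> G n. 1 \<le> X' (q j) \<omega>} * (q (Suc j) - q j)) \<le> g x0 + 1"
      by (rule L.occupation_bound[OF ly(1) T zero_less_one zero_less_one cont[OF order_refl] ly(3-5)]) blast
    have "a / 2 * (T - s0 - 1) \<le> (\<Sum>j<N. prob {\<omega> \<in> G n. 1 \<le> X' (q j) \<omega>} * (q (Suc j) - q j))"
    proof (rule grid_sum_tail_lower_bound[OF q])
      show "0 \<le> s0" "0 \<le> a / 2" using a(1) by (auto simp: s0_def)
      fix j assume j: "j < N" and s: "s0 \<le> q j"
      have qj: "0 < q j" "q j \<le> T" using s time_grid_le[OF q, of j] j by (auto simp: s0_def)
      have [measurable]: "X' (q j) \<in> borel_measurable M" using X'M qj by simp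
      have [measurable]: "(\<lambda>\<omega>. W (q j) \<omega> - W 0 \<omega>) \<in> borel_measurable M"
        using W_random_variable[of "q j"] W_random_variable[of 0] qj by simp
      have GA: "G n \<subseteq> A" unfolding G_def by auto
      have As: "A \<subseteq> space M" unfolding A_def by auto
      let ?E = "{\<omega> \<in> space M. c \<le> W (q j) \<omega> - W 0 \<omega>}" and ?H = "{\<omega> \<in> space M. 1 \<le> X' (q j) \<omega>}"
      have EM: "?E \<in> sets M" "?H \<in> sets M" by measurable
      have "a \<le> prob {\<omega> \<in> A. c \<le> W (q j) \<omega> - W 0 \<omega>}" using s by (intro a(2)) (simp add: s0_def)
      also have "{\<omega> \<in> A. c \<le> W (q j) \<omega> - W 0 \<omega>} = A \<inter> ?E" using As by auto
      also have "prob (A \<inter> ?E) \<le> prob ((G n \<inter> ?E) \<union> (A - G n))"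
        using EM AM GM by (intro finite_measure_mono) auto
      also have "\<dots> \<le> prob (G n \<inter> ?E) + prob (A - G n)"
        using EM AM GM by (intro measure_Un_le) auto
      also have "prob (G n \<inter> ?E) \<le> prob (G n \<inter> ?H)"
      proof (rule finite_measure_mono_AE)
        show "AE \<omega> in M. \<omega> \<in> G n \<inter> ?E \<longrightarrow> \<omega> \<in> G n \<inter> ?H"
          using dom[OF qj]
        proof eventually_elim
          case (elim \<omega>)
          show ?case
          proof
            assume w: "\<omega> \<in> G n \<inter> ?E"
            then have "S 1 \<le> S (X' (q j) \<omega>)" using elim unfolding c_def by auto
            then have "1 \<le> X' (q j) \<omega>" using Smono[of "X' (q j) \<omega>" 1] by (meson leI not_less)
            then show "\<omega> \<in> G n \<inter> ?H" using w by auto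
          qed
        qed
        show "G n \<inter> ?H \<in> sets M" using EM GM by auto
      qed
      also have "G n \<inter> ?H = {\<omega> \<in> G n. 1 \<le> X' (q j) \<omega>}" using GA As by auto
      finally show "a / 2 \<le> prob {\<omega> \<in> G n. 1 \<le> X' (q j) \<omega>}" using n(1) by simp
    qed simp
    also have "\<dots> \<le> u x0 + 1" using occ ly(2) by simp
    finally have "a / 2 * (1 + 2 * (u x0 + 1) / a) \<le> u x0 + 1" unfolding T_def by simp
    moreover have "a / 2 * (1 + 2 * (u x0 + 1) / a) = a / 2 + (u x0 + 1)" using a(1) by (simp add: field_simps)
    ultimately have "a / 2 + (u x0 + 1) \<le> u x0 + 1" by simp
    then show False using a(1) by simp
  qed
  moreover have "{\<omega> \<in> space M. \<tau> \<omega> < \<infinity>} = space M - A" by (auto simp: A_def less_top)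
  ultimately show ?thesis using prob_compl[OF AM] by simp
qed

end
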